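(* The Dirichlet–Voronoi tiling numbers $\mathrm{div}_{n-1}$ satisfy $$\mathrm{div}_{n-1}=(2\pi e)^{-1}(n+\ln n)+O(1)$$ as $n\to\infty$; that is, there is an absolute constant $C>0$ such that $\left|\mathrm{div}_{n-1}-(2\pi e)^{-1}(n+\ln n)\right|\le C$ for all $n\ge2$.
   Context: For $n\ge 2$, the Dirichlet–Voronoi tiling number $\mathrm{div}_{n-1}$ is the positive constant, depending only on $n$, such that for every convex body $K\subset\mathbb{R}^n$ with $C^2$ boundary and positive Gaussian curvature $\kappa$, $$\lim_{N\to\infty}N^{\frac{2}{n-1}}\min\{|P\setminus K|:\ P\supset K,\ P\text{ a polytope with at most }N\text{ facets}\}=\frac12\,\mathrm{div}_{n-1}\,(\mathrm{as}(K))^{\frac{n+1}{n-1}},$$ where $|\cdot|$ is $n$-dimensional volume and $\mathrm{as}(K)=\int_{\partial K}\kappa(x)^{\frac1{n+1}}\,dS(x)$ is the affine surface area of $K$ (existence of this constant is a theorem of Gruber). For example, for $K=B_n$ the Euclidean unit ball, $\mathrm{as}(B_n)=|\partial B_n|$. *)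

theory Defs
  imports "HOL-Analysis.Analysis"
begin

text \<open>
  The dimension has to vary inside one formula, so \<open>\<real>\<^sup>n\<close> is represented by its coordinates: for a
  finite index set \<open>I\<close>, the space \<open>\<real>\<^sup>I\<close> is the set of extensional functions \<open>Pi\<^sub>E I (\<lambda>_. UNIV)\<close>, with
  the product topology and the product of Lebesgue measures.  \<open>\<real>\<^sup>n\<close> is the case \<open>I = {..<n}\<close>; the
  coordinate hyperplane on which the \<open>i\<close>-th coordinate is dropped is the case \<open>I = {..<n} - {i}\<close>.
  The measure lives on the Borel sets, which suffices because all sets measured below are Borel.
\<close>

abbreviation euclid :: "nat set \<Rightarrow> (nat \<Rightarrow> real) topology" where
  "euclid I \<equiv> product_topology (\<lambda>_. euclideanreal) I"

abbreviation leb :: "nat set \<Rightarrow> (nat \<Rightarrow> real) measure" where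
  "leb I \<equiv> Pi\<^sub>M I (\<lambda>_. lborel)"

abbreviation points :: "nat \<Rightarrow> (nat \<Rightarrow> real) set" where
  "points n \<equiv> Pi\<^sub>E {..<n} (\<lambda>_. UNIV)"

abbreviation bdry :: "nat \<Rightarrow> (nat \<Rightarrow> real) set \<Rightarrow> (nat \<Rightarrow> real) set" where
  "bdry n K \<equiv> euclid {..<n} frontier_of K"

definition dotp :: "nat \<Rightarrow> (nat \<Rightarrow> real) \<Rightarrow> (nat \<Rightarrow> real) \<Rightarrow> real" where
  "dotp n x y = (\<Sum>i<n. x i * y i)"

definition convex_body :: "nat \<Rightarrow> (nat \<Rightarrow> real) set \<Rightarrow> bool" where
  "convex_body n K \<longleftrightarrow>
     compactin (euclid {..<n}) K \<and>
     euclid {..<n} interior_of K \<noteq> {} \<and>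
     (\<forall>x\<in>K. \<forall>y\<in>K. \<forall>t\<in>{0..1}. (\<lambda>i\<in>{..<n}. (1 - t) * x i + t * y i) \<in> K)"


definition partial :: "nat \<Rightarrow> ((nat \<Rightarrow> real) \<Rightarrow> real) \<Rightarrow> (nat \<Rightarrow> real) \<Rightarrow> real" where
  "partial i f x = deriv (\<lambda>t. f (x(i := t))) (x i)"

text \<open>\<open>Ck_on I k U f\<close>: all partial derivatives of \<open>f\<close> up to order \<open>k\<close> exist and are continuous on the
  open set \<open>U\<close> in \<open>\<real>\<^sup>I\<close>.\<close>

primrec Ck_on :: "nat set \<Rightarrow> nat \<Rightarrow> (nat \<Rightarrow> real) set \<Rightarrow> ((nat \<Rightarrow> real) \<Rightarrow> real) \<Rightarrow> bool" where
  "Ck_on I 0 U f \<longleftrightarrow> continuous_map (subtopology (euclid I) U) euclideanreal f"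
| "Ck_on I (Suc k) U f \<longleftrightarrow>
     continuous_map (subtopology (euclid I) U) euclideanreal f \<and>
     (\<forall>i\<in>I. (\<forall>x\<in>U. (\<lambda>t. f (x(i := t))) field_differentiable at (x i)) \<and> Ck_on I k U (partial i f))"

definition C2_boundary :: "nat \<Rightarrow> (nat \<Rightarrow> real) set \<Rightarrow> bool" where
  "C2_boundary n K \<longleftrightarrow>
     (\<forall>p\<in>bdry n K. \<exists>U g. openin (euclid {..<n}) U \<and> p \<in> U \<and> Ck_on {..<n} 2 U g \<and>
        (\<forall>x\<in>U. \<exists>i<n. partial i g x \<noteq> 0) \<and> U \<inter> bdry n K = {x\<in>U. g x = 0})"


text \<open>Unique at every boundary point of a convex body with \<open>C\<^sup>2\<close> boundary.\<close>

definition outer_normal :: "nat \<Rightarrow> (nat \<Rightarrow> real) set \<Rightarrow> (nat \<Rightarrow> real) \<Rightarrow> nat \<Rightarrow> real" where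
  "outer_normal n K x =
     (THE v. v \<in> points n \<and> dotp n v v = 1 \<and> (\<forall>y\<in>K. dotp n v (\<lambda>i. y i - x i) \<le> 0))"

text \<open>The matrix \<open>W\<close> represents the differential at \<open>x\<close> of the Gauss map, i.e. of the outer unit normal
  as a map on the boundary; only its action on the tangent space is determined.\<close>

definition gauss_map_differential ::
    "nat \<Rightarrow> (nat \<Rightarrow> real) set \<Rightarrow> (nat \<Rightarrow> real) \<Rightarrow> (nat \<Rightarrow> nat \<Rightarrow> real) \<Rightarrow> bool" where
  "gauss_map_differential n K x W \<longleftrightarrow>
     ((\<lambda>y. L2_set (\<lambda>i. outer_normal n K y i - outer_normal n K x i
                         - (\<Sum>j<n. W i j * (y j - x j))) {..<n}
           / L2_set (\<lambda>i. y i - x i) {..<n})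
       \<longlongrightarrow> 0) (atin_within (euclid {..<n}) x (bdry n K))"

text \<open>The numbers \<open>k 0, \<dots>, k (n-2)\<close> are the principal curvatures at \<open>x\<close>, with principal directions
  \<open>u 0, \<dots>, u (n-2)\<close> forming an orthonormal basis of the tangent space.  With the outer normal the
  unit sphere has principal curvatures \<open>1\<close>.\<close>

definition principal_curvatures ::
    "nat \<Rightarrow> (nat \<Rightarrow> real) set \<Rightarrow> (nat \<Rightarrow> real) \<Rightarrow> (nat \<Rightarrow> real) \<Rightarrow> bool" where
  "principal_curvatures n K x k \<longleftrightarrow>
     (\<exists>W u. gauss_map_differential n K x W \<and>
        (\<forall>a<n - 1. dotp n (u a) (outer_normal n K x) = 0) \<and>
        (\<forall>a<n - 1. \<forall>b<n - 1. dotp n (u a) (u b) = (if a = b then 1 else 0)) \<and>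
        (\<forall>a<n - 1. \<forall>i<n. (\<Sum>j<n. W i j * u a j) = k a * u a i))"

definition gauss_curvature :: "nat \<Rightarrow> (nat \<Rightarrow> real) set \<Rightarrow> (nat \<Rightarrow> real) \<Rightarrow> real" where
  "gauss_curvature n K x = (THE \<kappa>. \<exists>k. principal_curvatures n K x k \<and> \<kappa> = (\<Prod>a<n - 1. k a))"


text \<open>The surface area measure \<open>dS\<close> on the boundary of \<open>K\<close> is the Borel measure that, on every piece
  of the boundary which is the graph of a \<open>C\<^sup>1\<close> function \<open>f\<close> over an open set \<open>U\<close> in a coordinate
  hyperplane (the coordinate \<open>i\<close> being the dependent one), has density \<open>sqrt (1 + |\<nabla>f|\<^sup>2)\<close>.
  Such pieces cover a \<open>C\<^sup>1\<close> boundary, so the measure is determined by this.\<close>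

definition is_surface_measure :: "nat \<Rightarrow> (nat \<Rightarrow> real) set \<Rightarrow> (nat \<Rightarrow> real) measure \<Rightarrow> bool" where
  "is_surface_measure n K \<sigma> \<longleftrightarrow>
     space \<sigma> = bdry n K \<and>
     sets \<sigma> = sets (restrict_space (leb {..<n}) (bdry n K)) \<and>
     (\<forall>i<n. \<forall>U f A. let I = {..<n} - {i} in
        openin (euclid I) U \<and> Ck_on I 1 U f \<and> (\<forall>y\<in>U. y(i := f y) \<in> bdry n K) \<and>
        A \<in> sets (leb I) \<and> A \<subseteq> U \<longrightarrow>
        emeasure \<sigma> ((\<lambda>y. y(i := f y)) ` A) =
          (\<integral>\<^sup>+y\<in>A. ennreal (sqrt (1 + (\<Sum>j\<in>I. (partial j f y)\<^sup>2))) \<partial>leb I))"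

definition surface_measure :: "nat \<Rightarrow> (nat \<Rightarrow> real) set \<Rightarrow> (nat \<Rightarrow> real) measure" where
  "surface_measure n K = (THE \<sigma>. is_surface_measure n K \<sigma>)"

definition affine_surface_area :: "nat \<Rightarrow> (nat \<Rightarrow> real) set \<Rightarrow> real" where
  "affine_surface_area n K =
     (\<integral>x. gauss_curvature n K x powr (1 / (real n + 1)) \<partial>surface_measure n K)"


text \<open>Polytopes are bounded intersections of finitely many closed half-spaces; a pair \<open>(a, b)\<close> stands
  for the half-space \<open>a \<bullet> x \<le> b\<close>.\<close>

definition is_polytope :: "nat \<Rightarrow> (nat \<Rightarrow> real) set \<Rightarrow> bool" where
  "is_polytope n P \<longleftrightarrow>
     (\<exists>H. finite H \<and> (\<forall>(a, b)\<in>H. \<exists>i<n. a i \<noteq> 0) \<and>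
        P = {x \<in> points n. \<forall>(a, b)\<in>H. dotp n a x \<le> b}) \<and>
     (\<exists>R. \<forall>x\<in>P. L2_set x {..<n} \<le> R)"

definition affinely_independent :: "nat \<Rightarrow> nat \<Rightarrow> (nat \<Rightarrow> nat \<Rightarrow> real) \<Rightarrow> bool" where
  "affinely_independent n m p \<longleftrightarrow>
     (\<forall>c. (\<Sum>k<m. c k) = 0 \<and> (\<forall>i<n. (\<Sum>k<m. c k * p k i) = 0) \<longrightarrow> (\<forall>k<m. c k = 0))"

text \<open>A facet is the intersection with a supporting hyperplane that has dimension \<open>n - 1\<close>, i.e. that
  contains \<open>n\<close> affinely independent points.\<close>

definition facets :: "nat \<Rightarrow> (nat \<Rightarrow> real) set \<Rightarrow> (nat \<Rightarrow> real) set set" where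
  "facets n P =
     {F. (\<exists>a b. (\<exists>i<n. a i \<noteq> 0) \<and> (\<forall>x\<in>P. dotp n a x \<le> b) \<and> F = {x\<in>P. dotp n a x = b}) \<and>
         (\<exists>p. (\<forall>k<n. p k \<in> F) \<and> affinely_independent n n p)}"

text \<open>The minimal volume of \<open>P - K\<close> over circumscribed polytopes with at most \<open>N\<close> facets.  The minimum
  is attained as soon as such polytopes exist, that is, for \<open>N > n\<close>.\<close>

definition min_volume_diff :: "nat \<Rightarrow> (nat \<Rightarrow> real) set \<Rightarrow> nat \<Rightarrow> real" where
  "min_volume_diff n K N =
     Inf {measure (leb {..<n}) (P - K) | P.
            is_polytope n P \<and> K \<subseteq> P \<and> finite (facets n P) \<and> card (facets n P) \<le> N}"

text \<open>\<open>is_div_number d \<delta>\<close>: the number \<open>\<delta>\<close> is the Dirichlet--Voronoi tiling number \<open>div\<^sub>d\<close>, that is, it is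
  positive and has the defining limit property for all smooth convex bodies in dimension \<open>n = d + 1\<close>.
  At most one \<open>\<delta>\<close> has this property (test it on the ball); that one exists is a theorem of Gruber.\<close>

definition is_div_number :: "nat \<Rightarrow> real \<Rightarrow> bool" where
  "is_div_number d \<delta> \<longleftrightarrow> (let n = d + 1 in
     \<delta> > 0 \<and>
     (\<forall>K. convex_body n K \<and> C2_boundary n K \<and> (\<forall>x\<in>bdry n K. gauss_curvature n K x > 0) \<longrightarrow>
        (\<lambda>N. real N powr (2 / (real n - 1)) * min_volume_diff n K N)
          \<longlonglongrightarrow> 1 / 2 * \<delta> * affine_surface_area n K powr ((real n + 1) / (real n - 1))))"

end

theory Submission
  imports Defs "HOL-Real_Asymp.Real_Asymp"
begin

text \<open>
  For the unit ball, \<open>as(B) = n \<omega>\<^sub>n\<close>, so \<open>div\<^sub>d\<close>, \<open>d = n - 1\<close>, is read off from the volume of the best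
  circumscribed polytopes with \<open>N\<close> facets; we show
  \<open>\<omega>\<^sub>d\<^sup>-\<^sup>2\<^sup>/\<^sup>d \<cdot> d / (d + 2) \<le> div\<^sub>d \<le> \<omega>\<^sub>d\<^sup>-\<^sup>2\<^sup>/\<^sup>d (1 + 2 / d)\<close> and conclude with Stirling's formula.

  Lower bound: a circumscribed polytope with \<open>N\<close> facets contains the intersection of \<open>N\<close> half-spaces
  \<open>u \<bullet> x \<le> 1\<close> with \<open>|u| = 1\<close>, each of which removes from the ball of radius \<open>1 + s\<close> only a cap of known volume.
  The union bound is optimized over \<open>s\<close>, which is of order \<open>N\<^sup>-\<^sup>2\<^sup>/\<^sup>d\<close>.

  Upper bound: for \<open>N\<close> independent uniformly distributed directions \<open>u\<close>, a point \<open>x\<close> with \<open>|x| > 1\<close> survives in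
  all half-spaces \<open>u \<bullet> x \<le> 1\<close> with probability \<open>(1 - p(|x|))\<^sup>N\<close>, where \<open>p\<close> is the normalized volume of a circular
  cone.  Integrating over \<open>x\<close> bounds the expected excess volume; the intersection with a cube costs \<open>2 n\<close>
  facets and keeps everything bounded.
\<close>

section \<open>Lebesgue measure on coordinate spaces\<close>

text \<open>The defining limit is tested on the unit ball alone. There its right-hand side is
  \<delta> times (n omega_n)^(1 + 2/d) / 2; the same factor occurs in both volume bounds and
  cancels. Relative errors of order 1/d are affordable: omega_d^(-2/d) is about d / (2 pi e), so a
  factor 1 + O(1/d) moves it by O(1), and crude estimates of caps and cones suffice. The logarithm
  stems from the factor sqrt d in Stirling's formula, raised to the power 2/d and multiplied by d.
  Two obstacles shape the text. Outer normal, Gauss curvature and surface measure are definite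
  descriptions, so nothing can be computed for the ball before existence and uniqueness of each are
  established on the sphere. And points are extensional functions under a product measure, so
  rotation invariance has to be assembled from maps that change one coordinate at a time, through
  Fubini's theorem.\<close>

definition sqn :: "nat set \<Rightarrow> (nat \<Rightarrow> real) \<Rightarrow> real" where
  "sqn I x = (\<Sum>i\<in>I. (x i)\<^sup>2)"

interpretation psf: product_sigma_finite "\<lambda>_::nat. lborel :: real measure" ..

lemma measurable_component_leb:
  "i \<in> I \<Longrightarrow> f \<in> M \<rightarrow>\<^sub>M leb I \<Longrightarrow> (\<lambda>x. f x i) \<in> borel_measurable M"
  using measurable_compose[OF _ measurable_component_singleton, of f M I "\<lambda>_. lborel" i]
  by simp

lemma coordinate_measurable: "i \<in> I \<Longrightarrow> (\<lambda>x. x i) \<in> borel_measurable (leb I)"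
  using measurable_component_leb[of i I "\<lambda>x. x" "leb I"] by simp

lemma sqn_measurable [measurable]: "sqn I \<in> borel_measurable (leb I)"
  unfolding sqn_def[abs_def]
  by (intro borel_measurable_sum borel_measurable_power measurable_component_leb[where I=I]) auto

lemma sqn_nonneg [simp]: "sqn I x \<ge> 0"
  unfolding sqn_def by (simp add: sum_nonneg)

lemma sqn_insert:
  "finite I \<Longrightarrow> i \<notin> I \<Longrightarrow> sqn (insert i I) x = (x i)\<^sup>2 + sqn I x"
  unfolding sqn_def by simp

lemma sqn_cong: "(\<And>i. i \<in> I \<Longrightarrow> x i = y i) \<Longrightarrow> sqn I x = sqn I y"
  unfolding sqn_def by simp

lemma sqn_upd_notin [simp]: "i \<notin> I \<Longrightarrow> sqn I (x(i := t)) = sqn I x"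
  by (rule sqn_cong) auto

lemma fun_upd_leb_measurable:
  assumes "i \<in> I" "h \<in> borel_measurable (leb I)"
  shows "(\<lambda>x. x(i := h x)) \<in> leb I \<rightarrow>\<^sub>M leb I"
  using assms by (intro measurable_fun_upd[where J=I]) (auto simp: insert_absorb)

lemma nn_integral_insert_leb:
  assumes "finite I" "i \<notin> I" "f \<in> borel_measurable (leb (insert i I))"
  shows "(\<integral>\<^sup>+x. f x \<partial>leb (insert i I)) = (\<integral>\<^sup>+w. \<integral>\<^sup>+z. f (w(i := z)) \<partial>lborel \<partial>leb I)"
    and "(\<integral>\<^sup>+x. f x \<partial>leb (insert i I)) = (\<integral>\<^sup>+z. \<integral>\<^sup>+w. f (w(i := z)) \<partial>leb I \<partial>lborel)"
  using psf.product_nn_integral_insert[OF assms] psf.product_nn_integral_insert_rev[OF assms] by simp_all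

lemma insert_section_measurable [measurable]:
  "(\<lambda>z. w(i := z)) \<in> borel \<rightarrow>\<^sub>M leb (insert i I)" if "w \<in> space (leb I)"
proof -
  have "(\<lambda>z. w(i := z)) \<in> lborel \<rightarrow>\<^sub>M leb (insert i I)"
    by (rule measurable_fun_upd[where J=I]) (use that in auto)
  then show ?thesis by simp
qed

lemma insert_pair_measurable:
  assumes "f \<in> borel_measurable (leb (insert i I))"
  shows "(\<lambda>(w, z). f (w(i := z))) \<in> borel_measurable (leb I \<Otimes>\<^sub>M lborel)"
  using measurable_compose[OF measurable_add_dim assms] by (simp add: case_prod_unfold)

text \<open>Fubini with coordinate \<open>i\<close> innermost: \<open>h\<close> is constant on lines
  in that direction, so each line undergoes an affine map of slope \<open>a\<close>, which preserves
  length because |a| = 1. Shears (\<open>a = 1\<close>) and reflections (\<open>a = -1\<close>) both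
  come from it.\<close>

lemma nn_integral_leb_coordinate_affine:
  assumes "finite I" "i \<in> I" and f: "f \<in> borel_measurable (leb I)" and a: "\<bar>a\<bar> = 1"
    and h: "h \<in> borel_measurable (leb I)" "\<And>x t. h (x(i := t)) = h x"
  shows "(\<integral>\<^sup>+x. f (x(i := h x + a * x i)) \<partial>leb I) = (\<integral>\<^sup>+x. f x \<partial>leb I)"
proof -
  define J where "J = I - {i}"
  have I: "I = insert i J" and J: "finite J" "i \<notin> J" using assms(1,2) by (auto simp: J_def)
  have m: "(\<lambda>x. x(i := h x + a * x i)) \<in> leb I \<rightarrow>\<^sub>M leb I"
    by (rule fun_upd_leb_measurable)
       (use assms(2) h(1) coordinate_measurable[of i I] in \<open>auto intro!: borel_measurable_add\<close>)
  have "(\<integral>\<^sup>+x. f (x(i := h x + a * x i)) \<partial>leb I)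
      = (\<integral>\<^sup>+w. \<integral>\<^sup>+z. f (w(i := h w + a * z)) \<partial>lborel \<partial>leb J)"
    using nn_integral_insert_leb(1)[OF J measurable_compose[OF m f, unfolded I]] unfolding I
    by (simp add: h(2))
  also have "\<dots> = (\<integral>\<^sup>+w. \<integral>\<^sup>+z. f (w(i := z)) \<partial>lborel \<partial>leb J)"
  proof (rule nn_integral_cong)
    fix w assume w: "w \<in> space (leb J)"
    have "(\<lambda>z. f (w(i := z))) \<in> borel_measurable borel"
      by (rule measurable_compose[OF insert_section_measurable[OF w] f[unfolded I]])
    from nn_integral_real_affine[OF this, of a "h w"] a
    show "(\<integral>\<^sup>+z. f (w(i := h w + a * z)) \<partial>lborel) = (\<integral>\<^sup>+z. f (w(i := z)) \<partial>lborel)"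
      by force
  qed
  also have "\<dots> = (\<integral>\<^sup>+x. f x \<partial>leb I)"
    using nn_integral_insert_leb(1)[OF J f[unfolded I]] unfolding I by simp
  finally show ?thesis .
qed

lemma nn_integral_leb_shear:
  assumes "finite I" "i \<in> I" "j \<in> I" "i \<noteq> j" and f: "f \<in> borel_measurable (leb I)"
  shows "(\<integral>\<^sup>+x. f (x(i := x i + c * x j)) \<partial>leb I) = (\<integral>\<^sup>+x. f x \<partial>leb I)"
  using nn_integral_leb_coordinate_affine[OF assms(1,2) f, of 1 "\<lambda>x. c * x j"]
    coordinate_measurable[OF assms(3)] assms(4)
  by (simp add: add.commute)

lemma nn_integral_leb_reflect:
  assumes "finite I" "i \<in> I" and f: "f \<in> borel_measurable (leb I)"
  shows "(\<integral>\<^sup>+x. f (x(i := - x i)) \<partial>leb I) = (\<integral>\<^sup>+x. f x \<partial>leb I)"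
  using nn_integral_leb_coordinate_affine[OF assms(1,2) f, of "-1" "\<lambda>_. 0"] by simp

text \<open>A plane rotation by an angle other than \<open>\<pi>\<close> is a product of three shears.\<close>

lemma nn_integral_leb_rotate:
  assumes "finite I" "i \<in> I" "j \<in> I" "i \<noteq> j" and f: "f \<in> borel_measurable (leb I)"
    and ab: "a\<^sup>2 + b\<^sup>2 = 1" "a \<noteq> -1"
  shows "(\<integral>\<^sup>+x. f (x(i := a * x i - b * x j, j := b * x i + a * x j)) \<partial>leb I) = (\<integral>\<^sup>+x. f x \<partial>leb I)"
proof -
  \<comment> \<open>With \<open>a\<close> the cosine and \<open>b\<close> the sine of the angle,
    this is the tangent of half the angle, infinite at \<pi>. The facts \<open>bt\<close> and
    \<open>ta\<close> are the half-angle identities that make the three shears compose to the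
    rotation.\<close>
  define t where "t = b / (1 + a)"
  have a1: "1 + a \<noteq> 0" using ab by linarith
  have bt: "b * t = 1 - a"
    using a1 ab unfolding t_def by (simp add: field_simps power2_eq_square)
  have ta: "t * (1 + a) = b" using a1 by (simp add: t_def)
  let ?S = "\<lambda>i j c (x::nat\<Rightarrow>real). x(i := x i + c * x j)"
  have m: "?S i j c \<in> leb I \<rightarrow>\<^sub>M leb I" if "i \<in> I" "j \<in> I" for i j c
    by (rule fun_upd_leb_measurable) (use that in auto)
  have "(\<integral>\<^sup>+x. f x \<partial>leb I) = (\<integral>\<^sup>+x. f (?S i j (-t) x) \<partial>leb I)"
    using nn_integral_leb_shear[OF assms(1-5), of "-t"] by simp
  also have "\<dots> = (\<integral>\<^sup>+x. f (?S i j (-t) (?S j i b x)) \<partial>leb I)"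
    by (rule nn_integral_leb_shear[OF assms(1,3,2), symmetric])
       (use assms(4) measurable_compose[OF m[OF assms(2,3), of "-t"] f] in simp_all)
  also have "\<dots> = (\<integral>\<^sup>+x. f (?S i j (-t) (?S j i b (?S i j (-t) x))) \<partial>leb I)"
    by (rule nn_integral_leb_shear[OF assms(1,2,3), symmetric])
       (use assms(4) measurable_compose[OF m[OF assms(3,2), of b]
          measurable_compose[OF m[OF assms(2,3), of "-t"] f]] in simp_all)
  also have "\<dots> = (\<integral>\<^sup>+x. f (x(i := a * x i - b * x j, j := b * x i + a * x j)) \<partial>leb I)"
  proof (intro nn_integral_cong arg_cong[where f=f] ext)
    fix x k
    have 1: "x j + b * (x i - t * x j) = b * x i + a * x j"
      using bt by (simp add: algebra_simps) (metis add.commute bt diff_add_cancel distrib_right mult.assoc mult_1)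
    have 2: "(x i - t * x j) - t * (b * x i + a * x j) = a * x i - b * x j"
    proof -
      have "(x i - t * x j) - t * (b * x i + a * x j) = (1 - b * t) * x i - (t * (1 + a)) * x j"
        by (simp add: algebra_simps)
      then show ?thesis unfolding bt ta by simp
    qed
    show "?S i j (-t) (?S j i b (?S i j (-t) x)) k = (x(i := a * x i - b * x j, j := b * x i + a * x j)) k"
      using 1 2 assms(4) by auto
  qed
  finally show ?thesis by simp
qed

definition inp :: "nat set \<Rightarrow> (nat \<Rightarrow> real) \<Rightarrow> (nat \<Rightarrow> real) \<Rightarrow> real" where
  "inp I x y = (\<Sum>i\<in>I. x i * y i)"

lemma inp_measurable [measurable]: "inp I u \<in> borel_measurable (leb I)"
  unfolding inp_def[abs_def]
  by (intro borel_measurable_sum borel_measurable_times borel_measurable_const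
      measurable_component_leb[where I=I]) auto

text \<open>By rotation invariance \<open>u\<close> may be replaced by |u| times the
  \<open>i\<close>-th coordinate vector. No orthogonal matrix is built: rotations in coordinate
  planes through the \<open>i\<close>-axis clear the entries of \<open>u\<close> one by one, as in
  Givens elimination, and preserve |y| and |u|.\<close>

lemma nn_integral_leb_rotate_radial:
  assumes I: "finite I" "i \<in> I" and g: "case_prod g \<in> borel_measurable (borel \<Otimes>\<^sub>M borel)"
  shows "(\<integral>\<^sup>+y. g (sqn I y) (inp I u y) \<partial>leb I) = (\<integral>\<^sup>+y. g (sqn I y) (sqrt (sqn I u) * y i) \<partial>leb I)"
proof -
  have gm: "(\<lambda>y. g (sqn I y) (h y)) \<in> borel_measurable (leb I)" if [measurable]: "h \<in> borel_measurable (leb I)" for h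
    using measurable_compose[OF _ g, of "\<lambda>y. (sqn I y, h y)" "leb I"] by simp
  \<comment> \<open>If no entry needs clearing, \<open>u i\<close> may still be negative; a
    reflection supplies the absolute value that \<open>sqrt (sqn I u)\<close> demands.\<close>
  have sing: "(\<integral>\<^sup>+y. g (sqn I y) (c * y i) \<partial>leb I) = (\<integral>\<^sup>+y. g (sqn I y) (\<bar>c\<bar> * y i) \<partial>leb I)" for c
  proof (cases "c \<ge> 0")
    case False
    have "(\<integral>\<^sup>+y. g (sqn I y) (c * y i) \<partial>leb I)
      = (\<integral>\<^sup>+y. (\<lambda>y. g (sqn I y) (c * y i)) (y(i := - y i)) \<partial>leb I)"
      by (rule nn_integral_leb_reflect[OF I, symmetric]) (intro gm, use I in measurable)
    also have "\<dots> = (\<integral>\<^sup>+y. g (sqn I y) (\<bar>c\<bar> * y i) \<partial>leb I)"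
    proof (intro nn_integral_cong)
      fix y
      have "sqn I (y(i := - y i)) = sqn I y" unfolding sqn_def by (rule sum.cong) auto
      with False show "g (sqn I (y(i := - y i))) (c * (y(i := - y i)) i) = g (sqn I y) (\<bar>c\<bar> * y i)" by simp
    qed
    finally show ?thesis .
  qed auto
  have "(\<integral>\<^sup>+y. g (sqn I y) (inp I u y) \<partial>leb I) = (\<integral>\<^sup>+y. g (sqn I y) (sqrt (sqn I u) * y i) \<partial>leb I)"
    if "finite J" "J \<subseteq> I - {i}" "\<forall>k\<in>I - insert i J. u k = 0" for J u
    using that
  \<comment> \<open>\<open>J\<close> collects the coordinates other than \<open>i\<close> at which
    \<open>u\<close> may be nonzero.\<close>
  proof (induction J arbitrary: u rule: finite_induct)
    case empty
    have "inp I u y = u i * y i" for y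
      unfolding inp_def using empty I by (subst sum.remove[of _ i]) (auto intro!: sum.neutral)
    moreover have "sqn I u = (u i)\<^sup>2"
      unfolding sqn_def using empty I by (subst sum.remove[of _ i]) (auto intro!: sum.neutral)
    ultimately show ?case using sing[of "u i"] by simp
  next
    case (insert j J)
    have j: "j \<in> I" "j \<noteq> i" using insert by auto
    show ?case
    proof (cases "u j = 0")
      case True
      then show ?thesis using insert.IH[of u] insert.prems by (metis Diff_iff insert_iff insert_subset)
    next
      case False
      define r where "r = sqrt ((u i)\<^sup>2 + (u j)\<^sup>2)"
      have r2: "r\<^sup>2 = (u i)\<^sup>2 + (u j)\<^sup>2" unfolding r_def by simp
      have rp: "r > 0" unfolding r_def using False by (simp add: sum_power2_gt_zero_iff)
      define a b where "a = u i / r" and "b = u j / r"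
      have ab: "a\<^sup>2 + b\<^sup>2 = 1" using rp unfolding a_def b_def power_divide add_divide_distrib[symmetric] r2[symmetric] by simp
      \<comment> \<open>A nonzero sine excludes the angle \<pi>, which the three shears cannot
        produce.\<close>
      have "b \<noteq> 0" using False rp by (simp add: b_def)
      then have an: "a \<noteq> -1" using ab by auto
      define v where "v = u(i := r, j := 0)"
      have split: "(\<Sum>k\<in>I. h k) = h i + h j + (\<Sum>k\<in>I - {i,j}. h k)" for h :: "nat \<Rightarrow> real"
      proof -
        have "(\<Sum>k\<in>I. h k) = h i + (\<Sum>k\<in>I-{i}. h k)" using I by (rule sum.remove)
        also have "(\<Sum>k\<in>I-{i}. h k) = h j + (\<Sum>k\<in>I-{i}-{j}. h k)" using I j by (intro sum.remove) auto
        also have "I-{i}-{j} = I - {i,j}" by auto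
        finally show ?thesis by simp
      qed
      have sv: "sqn I v = sqn I u"
        unfolding sqn_def split using j r2 by (auto simp: v_def intro!: sum.cong)
      let ?R = "\<lambda>y. y(i := a * y i - b * y j, j := b * y i + a * y j)"
      have "(\<integral>\<^sup>+y. g (sqn I y) (inp I u y) \<partial>leb I) = (\<integral>\<^sup>+y. g (sqn I (?R y)) (inp I u (?R y)) \<partial>leb I)"
        by (rule nn_integral_leb_rotate[OF I(1,2) j(1) _ _ ab an, symmetric]) (use j in \<open>auto intro: gm\<close>)
      also have "\<dots> = (\<integral>\<^sup>+y. g (sqn I y) (inp I v y) \<partial>leb I)"
      proof (intro nn_integral_cong)
        fix y :: "nat \<Rightarrow> real"
        have "(a * y i - b * y j)\<^sup>2 + (b * y i + a * y j)\<^sup>2 = (a\<^sup>2 + b\<^sup>2) * ((y i)\<^sup>2 + (y j)\<^sup>2)"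
          by (simp add: algebra_simps power2_eq_square)
        then have 1: "sqn I (?R y) = sqn I y"
          unfolding sqn_def split using j ab by (auto intro!: sum.cong)
        have "u i = a * r" "u j = b * r" using rp by (auto simp: a_def b_def)
        then have "u i * (a * y i - b * y j) + u j * (b * y i + a * y j) = (a\<^sup>2 + b\<^sup>2) * r * y i"
          by (simp add: algebra_simps power2_eq_square)
        then have 2: "inp I u (?R y) = inp I v y"
          unfolding inp_def split using j ab by (auto simp: v_def intro!: sum.cong)
        show "g (sqn I (?R y)) (inp I u (?R y)) = g (sqn I y) (inp I v y)" using 1 2 by simp
      qed
      also have "\<dots> = (\<integral>\<^sup>+y. g (sqn I y) (sqrt (sqn I v) * y i) \<partial>leb I)"
        by (rule insert.IH) (use insert.prems in \<open>auto simp: v_def\<close>)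
      finally show ?thesis unfolding sv .
    qed
  qed
  from this[of "I - {i}" u] I show ?thesis by auto
qed

lemma nn_integral_leb_scale:
  assumes "finite I" "c > 0" and "f \<in> borel_measurable (leb I)"
  shows "(\<integral>\<^sup>+x. f x \<partial>leb I) = ennreal (c ^ card I) * (\<integral>\<^sup>+x. f (\<lambda>i\<in>I. c * x i) \<partial>leb I)"
  using assms(1,3)
proof (induction I arbitrary: f rule: finite_induct)
  case empty
  show ?case
    by (simp add: PiM_empty nn_integral_count_space_finite restrict_def)
next
  case (insert i I)
  have m: "(\<lambda>x. \<lambda>k\<in>J. c * x k) \<in> leb J \<rightarrow>\<^sub>M leb J" for J :: "nat set"
  proof -
    have "(\<lambda>x. \<lambda>k\<in>J. c * x k) \<in> leb J \<rightarrow>\<^sub>M Pi\<^sub>M J (\<lambda>_. lborel)"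
      by (rule measurable_restrict) (simp, measurable)
    then show ?thesis .
  qed
  have F: "(\<lambda>w. \<integral>\<^sup>+z. f (w(i := z)) \<partial>lborel) \<in> borel_measurable (leb I)"
  proof -
    have "(\<lambda>(w,z). f (w(i := z))) \<in> borel_measurable (leb I \<Otimes>\<^sub>M lborel)"
      by (rule insert_pair_measurable[OF insert.prems])
    then show ?thesis by (intro lborel.borel_measurable_nn_integral) 
  qed
  have "(\<integral>\<^sup>+x. f x \<partial>leb (insert i I)) = (\<integral>\<^sup>+w. \<integral>\<^sup>+z. f (w(i := z)) \<partial>lborel \<partial>leb I)"
    by (rule nn_integral_insert_leb(1)[OF insert.hyps insert.prems])
  also have "\<dots> = ennreal (c ^ card I) * (\<integral>\<^sup>+w. \<integral>\<^sup>+z. f ((\<lambda>k\<in>I. c * w k)(i := z)) \<partial>lborel \<partial>leb I)"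
    by (rule insert.IH[OF F])
  also have "(\<integral>\<^sup>+w. \<integral>\<^sup>+z. f ((\<lambda>k\<in>I. c * w k)(i := z)) \<partial>lborel \<partial>leb I)
     = (\<integral>\<^sup>+w. ennreal c * (\<integral>\<^sup>+z. f (\<lambda>k\<in>insert i I. c * (w(i := z)) k) \<partial>lborel) \<partial>leb I)"
  proof (rule nn_integral_cong)
    fix w assume w: "w \<in> space (leb I)"
    have w': "(\<lambda>k\<in>I. c * w k) \<in> space (leb I)" by (auto simp: space_PiM)
    have "(\<lambda>z. f ((\<lambda>k\<in>I. c * w k)(i := z))) \<in> borel_measurable borel"
      by (rule measurable_compose[OF insert_section_measurable[OF w'] insert.prems])
    from nn_integral_real_affine[OF this, of c 0] assms(2)
    have "(\<integral>\<^sup>+z. f ((\<lambda>k\<in>I. c * w k)(i := z)) \<partial>lborel)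
      = ennreal c * (\<integral>\<^sup>+z. f ((\<lambda>k\<in>I. c * w k)(i := c * z)) \<partial>lborel)" by simp
    moreover have "(\<lambda>k\<in>I. c * w k)(i := c * z) = (\<lambda>k\<in>insert i I. c * (w(i := z)) k)" for z
      using insert.hyps by (auto simp: fun_eq_iff)
    ultimately show "(\<integral>\<^sup>+z. f ((\<lambda>k\<in>I. c * w k)(i := z)) \<partial>lborel)
      = ennreal c * (\<integral>\<^sup>+z. f (\<lambda>k\<in>insert i I. c * (w(i := z)) k) \<partial>lborel)" by simp
  qed
  also have "\<dots> = ennreal c * (\<integral>\<^sup>+w. (\<integral>\<^sup>+z. f (\<lambda>k\<in>insert i I. c * (w(i := z)) k) \<partial>lborel) \<partial>leb I)"
  proof (rule nn_integral_cmult)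
    have "(\<lambda>x. f (\<lambda>k\<in>insert i I. c * x k)) \<in> borel_measurable (leb (insert i I))"
      by (rule measurable_compose[OF m insert.prems])
    from insert_pair_measurable[OF this]
    have "(\<lambda>(w,z). f (\<lambda>k\<in>insert i I. c * (w(i := z)) k)) \<in> borel_measurable (leb I \<Otimes>\<^sub>M lborel)" .
    then show "(\<lambda>w. \<integral>\<^sup>+z. f (\<lambda>k\<in>insert i I. c * (w(i := z)) k) \<partial>lborel) \<in> borel_measurable (leb I)"
      by (intro lborel.borel_measurable_nn_integral) 
  qed
  also have "(\<integral>\<^sup>+w. (\<integral>\<^sup>+z. f (\<lambda>k\<in>insert i I. c * (w(i := z)) k) \<partial>lborel) \<partial>leb I)
     = (\<integral>\<^sup>+x. f (\<lambda>k\<in>insert i I. c * x k) \<partial>leb (insert i I))"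
    by (rule nn_integral_insert_leb(1)[OF insert.hyps measurable_compose[OF m insert.prems], symmetric])
  finally have "(\<integral>\<^sup>+x. f x \<partial>leb (insert i I)) = (ennreal (c ^ card I) * ennreal c)
      * (\<integral>\<^sup>+x. f (\<lambda>k\<in>insert i I. c * x k) \<partial>leb (insert i I))"
    by (simp only: mult.assoc)
  also have "ennreal (c ^ card I) * ennreal c = ennreal (c ^ card (insert i I))"
    using insert.hyps assms(2) by (simp add: ennreal_mult' mult.commute)
  finally show ?case .
qed

text \<open>Radius 0 is included, by squeezing, because the origin is discarded as a null set
  several times below. In dimension 0 the only point has measure 1 = \<open>0 ^ 0\<close>, so that
  case is separate.\<close>

lemma emeasure_ball_leb:
  assumes "finite I" "r \<ge> 0"
  shows "emeasure (leb I) {x \<in> space (leb I). sqn I x \<le> r\<^sup>2} = ennreal (unit_ball_vol (card I) * r ^ card I)"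
proof (cases "r > 0")
  case True
  have "{x \<in> space (leb I). sqn I x \<le> r\<^sup>2} = {f. sqrt (\<Sum>i\<in>I. (f i)\<^sup>2) \<le> r} \<inter> space (leb I)"
    using True by (auto simp: sqn_def real_sqrt_le_iff' sum_nonneg)
  then show ?thesis using emeasure_cball_aux[OF assms(1) True] by simp
next
  case False
  then have r: "r = 0" using assms by simp
  show ?thesis
  proof (cases "I = {}")
    case True
    then show ?thesis using r by (simp add: sqn_def space_PiM emeasure_PiM_empty)
  next
    case I: False
    have "emeasure (leb I) {x \<in> space (leb I). sqn I x \<le> r\<^sup>2} \<le> ennreal (unit_ball_vol (card I) * e ^ card I)"
      if "e > 0" for e
    proof -
      have "{f. sqrt (\<Sum>i\<in>I. (f i)\<^sup>2) \<le> e} \<inter> space (leb I) = {x \<in> space (leb I). sqn I x \<le> e\<^sup>2}"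
        using that by (auto simp: sqn_def real_sqrt_le_iff' sum_nonneg)
      then have "emeasure (leb I) {x \<in> space (leb I). sqn I x \<le> e\<^sup>2} = ennreal (unit_ball_vol (card I) * e ^ card I)"
        using emeasure_cball_aux[OF assms(1) that] by simp
      moreover have "emeasure (leb I) {x \<in> space (leb I). sqn I x \<le> r\<^sup>2} \<le> emeasure (leb I) {x \<in> space (leb I). sqn I x \<le> e\<^sup>2}"
        using r by (intro emeasure_mono) (auto intro: order_trans[of _ 0])
      ultimately show ?thesis by simp
    qed
    moreover have "((\<lambda>e. ennreal (unit_ball_vol (card I) * e ^ card I)) \<longlongrightarrow> ennreal (unit_ball_vol (card I) * 0 ^ card I)) (at_right 0)"
      by (intro tendsto_intros)
    moreover have "eventually (\<lambda>e::real. e > 0) (at_right 0)"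
      by (simp add: eventually_at_right_less)
    ultimately have "emeasure (leb I) {x \<in> space (leb I). sqn I x \<le> r\<^sup>2} \<le> ennreal (unit_ball_vol (card I) * 0 ^ card I)"
      by (intro tendsto_lowerbound[where F="at_right (0::real)"]) (auto elim: eventually_mono)
    then show ?thesis using I assms(1) r by (simp add: zero_power card_gt_0_iff)
  qed
qed

section \<open>Volumes of caps and cones\<close>

text \<open>Exhaustion by closed balls of radius \<open>e * r\<close> with \<open>e\<close> tending
  to 1. The condition \<open>I \<noteq> {}\<close> matters at \<open>r = 0\<close>, where the set is
  empty but \<open>0 ^ 0 = 1\<close>.\<close>

lemma emeasure_open_ball_leb_ge:
  assumes "finite I" "r \<ge> 0" "I \<noteq> {}"
  shows "emeasure (leb I) {x \<in> space (leb I). sqn I x < r\<^sup>2} \<ge> ennreal (unit_ball_vol (card I) * r ^ card I)"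
proof (cases "r = 0")
  case True
  then show ?thesis using assms by (simp add: zero_power card_gt_0_iff)
next
  case False
  have "ennreal (unit_ball_vol (card I) * (e * r) ^ card I) \<le> emeasure (leb I) {x \<in> space (leb I). sqn I x < r\<^sup>2}"
    if e: "e \<in> {0<..<1}" for e
  proof -
    have "(e * r)\<^sup>2 < r\<^sup>2" using e False assms(2) by (intro power_strict_mono) auto
    then have "emeasure (leb I) {x \<in> space (leb I). sqn I x \<le> (e * r)\<^sup>2}
        \<le> emeasure (leb I) {x \<in> space (leb I). sqn I x < r\<^sup>2}"
      by (intro emeasure_mono) auto
    then show ?thesis using emeasure_ball_leb[OF assms(1), of "e * r"] e assms(2) by simp
  qed
  moreover have "((\<lambda>e. ennreal (unit_ball_vol (card I) * (e * r) ^ card I)) \<longlongrightarrow> ennreal (unit_ball_vol (card I) * (1 * r) ^ card I)) (at_left 1)"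
    by (intro tendsto_intros)
  moreover have "eventually (\<lambda>e::real. e \<in> {0<..<1}) (at_left 1)"
    by (intro eventually_at_leftI[of 0]) auto
  ultimately have "ennreal (unit_ball_vol (card I) * (1 * r) ^ card I) \<le> emeasure (leb I) {x \<in> space (leb I). sqn I x < r\<^sup>2}"
    by (intro tendsto_upperbound[where F="at_left (1::real)"]) (auto elim: eventually_mono)
  then show ?thesis by simp
qed

text \<open>Caps and cones about \<open>u\<close> are both given by a condition \<open>S\<close> on
  the pair (|y|^2, u . y). Once \<open>u\<close> is rotated to the \<open>i\<close>-axis, Fubini
  cuts the set into slices orthogonal to it, on which \<open>S\<close> only restricts |w|.\<close>

lemma emeasure_leb_slice:
  fixes u :: "nat \<Rightarrow> real"
  assumes J: "finite J" "i \<notin> J" and S: "S \<in> sets (borel \<Otimes>\<^sub>M borel)"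
  defines "I \<equiv> insert i J"
  shows "emeasure (leb I) {y \<in> space (leb I). (sqn I y, inp I u y) \<in> S}
    = (\<integral>\<^sup>+z. emeasure (leb J) {w \<in> space (leb J). (sqn J w + z\<^sup>2, sqrt (sqn I u) * z) \<in> S} \<partial>lborel)"
proof -
  note [measurable] = S
  have I: "finite I" "i \<in> I" using J by (auto simp: I_def)
  have "emeasure (leb I) {y \<in> space (leb I). (sqn I y, inp I u y) \<in> S}
    = (\<integral>\<^sup>+y. indicator {y \<in> space (leb I). (sqn I y, inp I u y) \<in> S} y \<partial>leb I)"
    by (subst nn_integral_indicator) auto
  also have "\<dots> = (\<integral>\<^sup>+y. indicator S (sqn I y, inp I u y) \<partial>leb I)"
    by (intro nn_integral_cong) (auto simp: indicator_def)
  also have "\<dots> = (\<integral>\<^sup>+y. indicator S (sqn I y, sqrt (sqn I u) * y i) \<partial>leb I)"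
  proof (rule nn_integral_leb_rotate_radial[OF I, where g = "\<lambda>a b. indicator S (a, b)"])
    have "(indicator S :: _ \<Rightarrow> ennreal) \<in> borel_measurable (borel \<Otimes>\<^sub>M borel)" by measurable
    then show "(\<lambda>(a, b). indicator S (a, b) :: ennreal) \<in> borel_measurable (borel \<Otimes>\<^sub>M borel)"
      by (simp add: case_prod_unfold)
  qed
  also have "\<dots> = (\<integral>\<^sup>+z. \<integral>\<^sup>+w. indicator S (sqn I (w(i := z)), sqrt (sqn I u) * (w(i := z)) i) \<partial>leb J \<partial>lborel)"
  proof -
    have [measurable]: "(\<lambda>y. sqrt (sqn I u) * y i) \<in> borel_measurable (leb I)"
      by (intro borel_measurable_times borel_measurable_const measurable_component_leb[OF I(2)]) simp
    have "(\<lambda>y. indicator S (sqn I y, sqrt (sqn I u) * y i) :: ennreal) \<in> borel_measurable (leb I)"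
      by measurable
    then show ?thesis unfolding I_def by (rule nn_integral_insert_leb(2)[OF J])
  qed
  also have "\<dots> = (\<integral>\<^sup>+z. \<integral>\<^sup>+w. indicator {w \<in> space (leb J). (sqn J w + z\<^sup>2, sqrt (sqn I u) * z) \<in> S} w \<partial>leb J \<partial>lborel)"
    using J by (intro nn_integral_cong) (auto simp: I_def sqn_insert indicator_def add.commute)
  also have "\<dots> = (\<integral>\<^sup>+z. emeasure (leb J) {w \<in> space (leb J). (sqn J w + z\<^sup>2, sqrt (sqn I u) * z) \<in> S} \<partial>lborel)"
    by (intro nn_integral_cong) (subst nn_integral_indicator, auto)
  finally show ?thesis .
qed

lemma nn_integral_reflected_powr:
  assumes "s > 0" "a > 0"
  shows "(\<integral>\<^sup>+z. ennreal ((R - z) powr a) * indicator {R - s..R} z \<partial>lborel) = ennreal (s powr (a + 1) / (a + 1))"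
proof -
  have "(\<integral>\<^sup>+z. ennreal ((R - z) powr a) * indicator {R - s..R} z \<partial>lborel)
    = (\<integral>\<^sup>+z. ennreal (z powr a) * indicator {0..s} z \<partial>lborel)"
    by (subst nn_integral_real_affine[where c="-1" and t=R]) (auto intro!: nn_integral_cong simp: indicator_def)
  also have "\<dots> = ennreal (s powr (a + 1) / (a + 1))"
  proof (rule nn_integral_has_integral_lebesgue')
    show "((\<lambda>z. z powr a) has_integral s powr (a + 1) / (a + 1)) {0..s}"
      using has_integral_powr_from_0[of a s] assms by simp
  qed auto
  finally show ?thesis .
qed

lemma sqrt_power_eq_powr:
  assumes "x \<ge> 0" "d \<ge> 1"
  shows "sqrt x ^ d = x powr (real d / 2)"
proof (cases "x = 0")
  case False
  then have "sqrt x ^ d = (x powr (1 / 2)) powr real d"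
    using assms by (simp add: powr_half_sqrt powr_realpow)
  then show ?thesis by (simp add: powr_powr)
qed (use assms in \<open>simp add: zero_power\<close>)

text \<open>With \<open>R = 1 + s\<close>, the slice at height \<open>z\<close> is a
  \<open>d\<close>-ball of squared radius R^2 - z^2 = (R + z)(R - z) <= 2 R (R - z). So the cap lies
  in a paraboloid, whose volume is an explicit integral; the loss disappears as \<open>s\<close>
  tends to 0.\<close>

lemma cap_volume_le:
  fixes d :: nat
  defines "D \<equiv> {..<Suc d}"
  assumes d: "d \<ge> 1" and s: "s > 0" and u: "sqn D u = 1"
  shows "emeasure (leb D) {y \<in> space (leb D). sqn D y \<le> (1 + s)\<^sup>2 \<and> 1 < inp D u y}
    \<le> ennreal (unit_ball_vol d * (2 * (1 + s)) powr (d / 2) * (s powr (d / 2 + 1) / (d / 2 + 1)))"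
proof -
  define R where "R = 1 + s"
  have R: "R > 0" using s by (simp add: R_def)
  define S where "S = {p::real \<times> real. fst p \<le> R\<^sup>2 \<and> 1 < snd p}"
  have S: "S \<in> sets (borel \<Otimes>\<^sub>M borel)"
  proof -
    have "{p \<in> space (borel \<Otimes>\<^sub>M borel). fst p \<le> R\<^sup>2 \<and> (1::real) < snd p} \<in> sets (borel \<Otimes>\<^sub>M borel)"
      by measurable
    then show ?thesis by (simp add: S_def space_pair_measure)
  qed
  have D: "D = insert d {..<d}" by (auto simp: D_def)
  have "emeasure (leb D) {y \<in> space (leb D). sqn D y \<le> (1 + s)\<^sup>2 \<and> 1 < inp D u y}
    = emeasure (leb D) {y \<in> space (leb D). (sqn D y, inp D u y) \<in> S}"
    by (simp add: S_def R_def)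
  also have "\<dots> = (\<integral>\<^sup>+z. emeasure (leb {..<d}) {w \<in> space (leb {..<d}). (sqn {..<d} w + z\<^sup>2, z) \<in> S} \<partial>lborel)"
    using emeasure_leb_slice[of "{..<d}" d S u] S u unfolding D by simp
  also have "\<dots> \<le> (\<integral>\<^sup>+z. ennreal (unit_ball_vol d * (2 * R) powr (d / 2)) * (ennreal ((R - z) powr (d / 2)) * indicator {R - s..R} z) \<partial>lborel)"
  proof (rule nn_integral_mono)
    fix z :: real
    show "emeasure (leb {..<d}) {w \<in> space (leb {..<d}). (sqn {..<d} w + z\<^sup>2, z) \<in> S}
      \<le> ennreal (unit_ball_vol d * (2 * R) powr (d / 2)) * (ennreal ((R - z) powr (d / 2)) * indicator {R - s..R} z)"
    proof (cases "1 < z \<and> z \<le> R")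
      case False
      have "{w \<in> space (leb {..<d}). (sqn {..<d} w + z\<^sup>2, z) \<in> S} = {}"
      proof (rule ccontr)
        assume "\<not> ?thesis"
        then obtain w where "sqn {..<d} w + z\<^sup>2 \<le> R\<^sup>2" "1 < z" by (auto simp: S_def)
        then have "z\<^sup>2 \<le> R\<^sup>2" using sqn_nonneg[of "{..<d}" w] by linarith
        then have "z \<le> R" by (rule power2_le_imp_le) (use R in simp)
        with False \<open>1 < z\<close> show False by simp
      qed
      then show ?thesis by (simp only: emeasure_empty zero_le)
    next
      case True
      define r where "r = sqrt (R\<^sup>2 - z\<^sup>2)"
      have z2: "z\<^sup>2 \<le> R\<^sup>2" using True by (intro power_mono) auto
      have "{w \<in> space (leb {..<d}). (sqn {..<d} w + z\<^sup>2, z) \<in> S} = {w \<in> space (leb {..<d}). sqn {..<d} w \<le> r\<^sup>2}"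
        using True z2 by (simp add: S_def r_def le_diff_eq)
      then have "emeasure (leb {..<d}) {w \<in> space (leb {..<d}). (sqn {..<d} w + z\<^sup>2, z) \<in> S} = ennreal (unit_ball_vol d * r ^ d)"
        using emeasure_ball_leb[of "{..<d}" r] z2 by (simp add: r_def)
      also have "r ^ d \<le> (2 * R) powr (d / 2) * (R - z) powr (d / 2)"
      proof -
        have "R\<^sup>2 - z\<^sup>2 = (R + z) * (R - z)" by (simp add: algebra_simps power2_eq_square)
        also have "\<dots> \<le> (2 * R) * (R - z)" using True by (intro mult_right_mono) auto
        finally have "r \<le> sqrt ((2 * R) * (R - z))" by (simp add: r_def)
        then have "r ^ d \<le> sqrt ((2 * R) * (R - z)) ^ d" using z2 by (intro power_mono) (auto simp: r_def)
        also have "\<dots> = ((2 * R) * (R - z)) powr (d / 2)"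
          using True R d by (intro sqrt_power_eq_powr) auto
        also have "\<dots> = (2 * R) powr (d / 2) * (R - z) powr (d / 2)" using True R by (simp add: powr_mult)
        finally show ?thesis .
      qed
      then have "ennreal (unit_ball_vol d * r ^ d) \<le> ennreal (unit_ball_vol d * ((2 * R) powr (d / 2) * (R - z) powr (d / 2)))"
        by (intro ennreal_leI mult_left_mono) auto
      also have "\<dots> = ennreal (unit_ball_vol d * (2 * R) powr (d / 2)) * (ennreal ((R - z) powr (d / 2)) * indicator {R - s..R} z)"
        using True by (simp add: R_def ennreal_mult' mult.assoc)
      finally show ?thesis .
    qed
  qed
  also have "\<dots> = ennreal (unit_ball_vol d * (2 * R) powr (d / 2)) * ennreal (s powr (d / 2 + 1) / (d / 2 + 1))"
    using nn_integral_reflected_powr[of s "d / 2" R] s d by (subst nn_integral_cmult) auto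
  also have "\<dots> = ennreal (unit_ball_vol d * (2 * (1 + s)) powr (d / 2) * (s powr (d / 2 + 1) / (d / 2 + 1)))"
    by (simp add: R_def ennreal_mult'[symmetric])
  finally show ?thesis .
qed

text \<open>The inequality |y| < x . y says that the half-space tangent to the unit ball with normal
  y / |y| cuts off \<open>x\<close>. At height \<open>z \<le> 1 / R\<close> along \<open>x\<close>
  the slice contains the open ball of radius \<open>q * z\<close>, which stays inside the unit ball
  because (R z)^2 <= 1. The rounded top above height 1 / R is given away.\<close>

lemma cone_volume_ge:
  fixes d :: nat
  defines "D \<equiv> {..<Suc d}"
  assumes d: "d \<ge> 1" and R: "R > 1" and x: "sqn D x = R\<^sup>2"
  shows "emeasure (leb D) {y \<in> space (leb D). sqn D y \<le> 1 \<and> sqrt (sqn D y) < inp D x y}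
    \<ge> ennreal (unit_ball_vol d * sqrt (R\<^sup>2 - 1) ^ d / (R ^ Suc d * Suc d))"
proof -
  define S where "S = {p::real \<times> real. fst p \<le> 1 \<and> sqrt (fst p) < snd p}"
  have S: "S \<in> sets (borel \<Otimes>\<^sub>M borel)"
  proof -
    have "{p \<in> space (borel \<Otimes>\<^sub>M borel). fst p \<le> 1 \<and> sqrt (fst p) < snd p} \<in> sets (borel \<Otimes>\<^sub>M borel)"
      by measurable
    then show ?thesis by (simp add: S_def space_pair_measure)
  qed
  have D: "D = insert d {..<d}" by (auto simp: D_def)
  define q where "q = sqrt (R\<^sup>2 - 1)"
  have R1: "R\<^sup>2 > 1" using R by (simp add: one_less_power)
  have q: "q \<ge> 0" "q\<^sup>2 = R\<^sup>2 - 1" using R1 by (auto simp: q_def)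
  have "ennreal (unit_ball_vol d * q ^ d / (R ^ Suc d * Suc d))
    = ennreal (unit_ball_vol d * q ^ d) * ennreal ((1 / R) ^ Suc d / Suc d - 0 ^ Suc d / Suc d)"
    by (simp add: ennreal_mult'[symmetric] q field_simps)
  also have "ennreal ((1 / R) ^ Suc d / Suc d - 0 ^ Suc d / Suc d) = (\<integral>\<^sup>+z. ennreal (z ^ d) * indicator {0..1 / R} z \<partial>lborel)"
  proof (rule nn_integral_FTC_Icc[symmetric])
    show "((\<lambda>z. z ^ Suc d / Suc d) has_real_derivative z ^ d) (at z)" for z :: real
      using DERIV_cdivide[OF DERIV_pow[of "Suc d" z UNIV], of "Suc d"] by simp
  qed (use R in auto)
  also have "ennreal (unit_ball_vol d * q ^ d) * \<dots> = (\<integral>\<^sup>+z. ennreal (unit_ball_vol d * q ^ d) * (ennreal (z ^ d) * indicator {0..1 / R} z) \<partial>lborel)"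
    by (rule nn_integral_cmult[symmetric]) auto
  also have "\<dots> \<le> (\<integral>\<^sup>+z. emeasure (leb {..<d}) {w \<in> space (leb {..<d}). (sqn {..<d} w + z\<^sup>2, R * z) \<in> S} \<partial>lborel)"
  proof (rule nn_integral_mono)
    fix z :: real
    show "ennreal (unit_ball_vol d * q ^ d) * (ennreal (z ^ d) * indicator {0..1 / R} z)
      \<le> emeasure (leb {..<d}) {w \<in> space (leb {..<d}). (sqn {..<d} w + z\<^sup>2, R * z) \<in> S}"
    proof (cases "0 < z \<and> z \<le> 1 / R")
      case False
      then show ?thesis using d by (cases "z = 0") (auto simp: zero_power)
    next
      case True
      then have Rz: "0 < R * z" "R * z \<le> 1" using R by (auto simp: field_simps)
      then have Rz2: "(R * z)\<^sup>2 \<le> 1" by (simp add: power_le_one)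
      have "{w \<in> space (leb {..<d}). sqn {..<d} w < (q * z)\<^sup>2} \<subseteq> {w \<in> space (leb {..<d}). (sqn {..<d} w + z\<^sup>2, R * z) \<in> S}"
      proof safe
        fix w assume "sqn {..<d} w < (q * z)\<^sup>2"
        then have "sqn {..<d} w + z\<^sup>2 < (R * z)\<^sup>2" using q by (simp add: power_mult_distrib algebra_simps)
        then show "(sqn {..<d} w + z\<^sup>2, R * z) \<in> S"
          using Rz Rz2 by (auto simp: S_def intro!: real_less_lsqrt add_nonneg_nonneg)
      qed
      moreover have "{w \<in> space (leb {..<d}). (sqn {..<d} w + z\<^sup>2, R * z) \<in> S} \<in> sets (leb {..<d})"
        using S by measurable
      ultimately have "emeasure (leb {..<d}) {w \<in> space (leb {..<d}). sqn {..<d} w < (q * z)\<^sup>2}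
         \<le> emeasure (leb {..<d}) {w \<in> space (leb {..<d}). (sqn {..<d} w + z\<^sup>2, R * z) \<in> S}"
        by (rule emeasure_mono)
      moreover have "ennreal (unit_ball_vol d * (q * z) ^ d) \<le> emeasure (leb {..<d}) {w \<in> space (leb {..<d}). sqn {..<d} w < (q * z)\<^sup>2}"
        using emeasure_open_ball_leb_ge[of "{..<d}" "q * z"] q True d by (simp add: lessThan_empty_iff)
      ultimately show ?thesis
        using True q by (simp add: ennreal_mult'[symmetric] power_mult_distrib mult.assoc)
    qed
  qed
  also have "\<dots> = emeasure (leb D) {y \<in> space (leb D). (sqn D y, inp D x y) \<in> S}"
    using emeasure_leb_slice[of "{..<d}" d S x] S x R unfolding D by simp
  finally show ?thesis by (simp add: S_def q_def)
qed

section \<open>Facets and half-spaces\<close>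

text \<open>Gaussian elimination: the unknown \<open>k0\<close>, with nonzero coefficient in
  equation \<open>e\<close>, is eliminated from the other equations, and \<open>M'\<close> is the
  reduced system. An equation without coefficients is dropped.\<close>

lemma underdetermined_system:
  fixes M :: "'e \<Rightarrow> 'k \<Rightarrow> real"
  assumes "finite E" "finite K" "card E < card K"
  shows "\<exists>c. (\<exists>k\<in>K. c k \<noteq> 0) \<and> (\<forall>e\<in>E. (\<Sum>k\<in>K. M e k * c k) = 0)"
  using assms
proof (induction E arbitrary: K M rule: finite_induct)
  case empty
  then obtain k where "k \<in> K" by (auto simp: card_gt_0_iff)
  then show ?case by (intro exI[of _ "\<lambda>_. 1"]) auto
next
  case (insert e E)
  show ?case
  proof (cases "\<forall>k\<in>K. M e k = 0")
    case True
    obtain c where "\<exists>k\<in>K. c k \<noteq> 0" "\<forall>e\<in>E. (\<Sum>k\<in>K. M e k * c k) = 0"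
      using insert.IH[of K M] insert.prems insert.hyps by auto
    with True show ?thesis by (intro exI[of _ c]) auto
  next
    case False
    then obtain k0 where k0: "k0 \<in> K" "M e k0 \<noteq> 0" by auto
    define K' where "K' = K - {k0}"
    define M' where "M' = (\<lambda>e' k. M e' k - M e' k0 * M e k / M e k0)"
    have "card E < card K'" using insert.prems insert.hyps k0 by (simp add: K'_def)
    then obtain c where c: "\<exists>k\<in>K'. c k \<noteq> 0" "\<forall>e'\<in>E. (\<Sum>k\<in>K'. M' e' k * c k) = 0"
      using insert.IH[of K' M'] insert.prems by (auto simp: K'_def)
    define c' where "c' = c(k0 := - (\<Sum>k\<in>K'. M e k * c k) / M e k0)"
    have split: "(\<Sum>k\<in>K. M e' k * c' k) = M e' k0 * c' k0 + (\<Sum>k\<in>K'. M e' k * c k)" for e'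
    proof -
      have "(\<Sum>k\<in>K. M e' k * c' k) = M e' k0 * c' k0 + (\<Sum>k\<in>K'. M e' k * c' k)"
        unfolding K'_def using insert.prems k0 by (intro sum.remove) auto
      also have "(\<Sum>k\<in>K'. M e' k * c' k) = (\<Sum>k\<in>K'. M e' k * c k)"
        by (intro sum.cong) (auto simp: c'_def K'_def)
      finally show ?thesis .
    qed
 
    have c'k0: "c' k0 = - (\<Sum>k\<in>K'. M e k * c k) / M e k0" by (simp add: c'_def)
    have "(\<Sum>k\<in>K. M e' k * c' k) = 0" if "e' \<in> insert e E" for e'
    proof (cases "e' = e")
      case True
      then show ?thesis using k0 by (simp add: split c'k0)
    next
      case False
      with that c have "(\<Sum>k\<in>K'. M' e' k * c k) = 0" by auto
      also have "(\<Sum>k\<in>K'. M' e' k * c k) = (\<Sum>k\<in>K'. M e' k * c k) - M e' k0 / M e k0 * (\<Sum>k\<in>K'. M e k * c k)"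
        by (simp add: M'_def left_diff_distrib sum_subtractf sum_distrib_left mult.assoc)
      finally show ?thesis by (simp add: split c'k0)
    qed
    moreover have "\<exists>k\<in>K. c' k \<noteq> 0" using c(1) by (auto simp: c'_def K'_def)
    ultimately show ?thesis by blast
  qed
qed

section \<open>Dot products, hyperplanes and facets\<close>

lemma dotp_eq_inp: "dotp n = inp {..<n}"
  by (simp add: dotp_def inp_def fun_eq_iff)

lemma dotp_restrict [simp]: "dotp n a (\<lambda>i\<in>{..<n}. f i) = dotp n a f"
  by (simp add: dotp_def)

lemma dotp_add_scale: "dotp n a (\<lambda>i. x i + e * y i) = dotp n a x + e * dotp n a y"
  by (simp add: dotp_def sum.distrib sum_distrib_left algebra_simps)

lemma dotp_scale: "dotp n a (\<lambda>i. e * y i) = e * dotp n a y"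
  by (simp add: dotp_def sum_distrib_left algebra_simps)

lemma dotp_self_pos: "\<exists>i<n. a i \<noteq> 0 \<Longrightarrow> dotp n a a > 0"
  unfolding dotp_def by (auto intro!: sum_pos2 simp: zero_less_mult_iff)

lemma dotp_self_nonneg [simp]: "dotp n a a \<ge> 0"
  unfolding dotp_def by (auto intro!: sum_nonneg)

text \<open>Let \<open>r\<close> be a' - m a, with \<open>m\<close> chosen so that
  \<open>r i0 = 0\<close>. If \<open>r i1\<close> were nonzero, one could choose nontrivial
  coefficients \<open>c\<close> of sum 0 whose combination \<open>s\<close> of the points vanishes
  in all coordinates except \<open>i0\<close> and \<open>i1\<close>. Both \<open>a\<close> and
  \<open>r\<close> have constant product with the points, hence product 0 with \<open>s\<close>;
  this triangular system forces \<open>s = 0\<close>, against affine independence.\<close>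

lemma hyperplane_unique:
  assumes ai: "affinely_independent n n p"
    and a: "\<exists>i<n. a i \<noteq> 0" "\<And>k. k < n \<Longrightarrow> dotp n a (p k) = b"
    and a': "\<exists>i<n. a' i \<noteq> 0" "\<And>k. k < n \<Longrightarrow> dotp n a' (p k) = b'"
  shows "\<exists>m. m \<noteq> 0 \<and> (\<forall>i<n. a' i = m * a i) \<and> b' = m * b"
proof -
  obtain i0 where i0: "i0 < n" "a i0 \<noteq> 0" using a by auto
  define m where "m = a' i0 / a i0"
  define r where "r = (\<lambda>i. a' i + (- m) * a i)"
  have rp: "dotp n r (p k) = b' - m * b" if "k < n" for k
  proof -
    have "dotp n r (p k) = dotp n a' (p k) - m * dotp n a (p k)"
      by (simp add: dotp_def r_def sum_subtractf sum_distrib_left algebra_simps)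
    then show ?thesis using a a' that by simp
  qed
  have ri0: "r i0 = 0" using i0 by (simp add: r_def m_def)
  have r0: "r i1 = 0" if i1: "i1 < n" for i1
  proof (rule ccontr)
    assume ne: "r i1 \<noteq> 0"
    then have "i1 \<noteq> i0" using ri0 by auto
    \<comment> \<open>The extra index \<open>n\<close> encodes the equation
      \<open>(\<Sum>k<n. c k) = 0\<close>; in total there are n - 1 equations for n
      unknowns.\<close>
    define E where "E = {..n} - {i0, i1}"
    define M where "M = (\<lambda>e k. if e = n then 1 else p k e)"
    have "card E < card {..<n}" using i0 i1 \<open>i1 \<noteq> i0\<close> by (auto simp: E_def card_Diff_subset)
    then obtain c where c: "\<exists>k\<in>{..<n}. c k \<noteq> 0" "\<forall>e\<in>E. (\<Sum>k<n. M e k * c k) = 0"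
      using underdetermined_system[of E "{..<n}" M] by (auto simp: E_def)
    have c0: "(\<Sum>k<n. c k) = 0" using c(2) i0 i1 by (auto simp: E_def M_def dest: bspec[of _ _ n])
    define s where "s = (\<lambda>i. \<Sum>k<n. c k * p k i)"
    have s0: "s i = 0" if "i < n" "i \<noteq> i0" "i \<noteq> i1" for i
    proof -
      have "i \<in> E" using that by (auto simp: E_def)
      with c(2) have "(\<Sum>k<n. M i k * c k) = 0" by blast
      with that show ?thesis by (simp add: s_def M_def mult.commute)
    qed
    have lin: "(\<Sum>i<n. f i * s i) = 0" if "\<And>k. k < n \<Longrightarrow> dotp n f (p k) = t" for f t
    proof -
      have "(\<Sum>i<n. f i * s i) = (\<Sum>k<n. c k * dotp n f (p k))"
        unfolding s_def dotp_def sum_distrib_left by (subst sum.swap) (simp add: algebra_simps)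
      also have "\<dots> = (\<Sum>k<n. c k * t)" using that by (intro sum.cong) auto
      also have "\<dots> = 0" using c0 by (simp add: sum_distrib_right[symmetric])
      finally show ?thesis .
    qed
    have two: "(\<Sum>i<n. f i * s i) = f i0 * s i0 + f i1 * s i1" for f
    proof -
      have "(\<Sum>i<n. f i * s i) = (\<Sum>i\<in>{i0, i1}. f i * s i)"
        using i0 i1 s0 by (intro sum.mono_neutral_right) auto
      then show ?thesis using \<open>i1 \<noteq> i0\<close> by simp
    qed
    have "s i1 = 0" using lin[OF rp] two[of r] ri0 ne by simp
    moreover then have "s i0 = 0" using lin[OF a(2)] two[of a] i0 by simp
    ultimately have "\<forall>i<n. s i = 0" using s0 by metis
    with ai c0 have "\<forall>k<n. c k = 0" unfolding affinely_independent_def s_def by blast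
    with c(1) show False by auto
  qed
  then have am: "\<forall>i<n. a' i = m * a i" by (auto simp: r_def)
  moreover have "m \<noteq> 0" using a'(1) am by auto
  moreover have "b' = m * b"
  proof -
    have "dotp n r (p i0) = 0" using r0 by (simp add: dotp_def)
    with rp[OF i0(1)] show ?thesis by simp
  qed
  ultimately show ?thesis by blast
qed

lemma eventually_halfspaces:
  assumes "finite H" "finite K" "\<And>a b. (a, b) \<in> H \<Longrightarrow> dotp n a z < b"
  shows "eventually (\<lambda>e. \<forall>(a, b)\<in>H. \<forall>k\<in>K. dotp n a z + e * dotp n a (v k) \<le> b) (at_right (0::real))"
proof -
  have "eventually (\<lambda>e. dotp n a z + e * dotp n a (v k) \<le> b) (at_right (0::real))" if "(a, b) \<in> H" for a b k
  proof -
    have "((\<lambda>e. dotp n a z + e * dotp n a (v k)) \<longlongrightarrow> dotp n a z + 0 * dotp n a (v k)) (at_right (0::real))"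
      by (intro tendsto_intros)
    then have "eventually (\<lambda>e. dotp n a z + e * dotp n a (v k) < b) (at_right (0::real))"
      by (rule order_tendstoD) (use assms(3)[OF that] in simp)
    then show ?thesis by (rule eventually_mono) simp
  qed
  then show ?thesis
    using assms(1,2) by (auto intro!: eventually_ball_finite simp: case_prod_unfold)
qed

text \<open>The centroid of \<open>n\<close> affinely independent points of a facet lies on the boundary of some half-space of
  \<open>H\<close>, and then so do all these points.\<close>

lemma facets_subset_image:
  assumes n: "n \<ge> 1" and H: "finite H" "\<forall>(a, b)\<in>H. \<exists>i<n. a i \<noteq> 0"
    and P: "P = {x \<in> points n. \<forall>(a, b)\<in>H. dotp n a x \<le> b}"
  shows "facets n P \<subseteq> (\<lambda>(a, b). {x \<in> P. dotp n a x = b}) ` H"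
proof
  fix F assume "F \<in> facets n P"
  then obtain a b p where a: "\<exists>i<n. a i \<noteq> 0" and sup: "\<And>x. x \<in> P \<Longrightarrow> dotp n a x \<le> b"
    and F: "F = {x \<in> P. dotp n a x = b}" and pF: "\<And>k. k < n \<Longrightarrow> p k \<in> F"
    and ai: "affinely_independent n n p"
    unfolding facets_def by blast
  define c where "c = (\<lambda>i\<in>{..<n}. (1 / n) * (\<Sum>k<n. p k i))"
  have dc: "dotp n f c = (1 / n) * (\<Sum>k<n. dotp n f (p k))" for f
  proof -
    have "dotp n f (\<lambda>i. \<Sum>k<n. p k i) = (\<Sum>k<n. dotp n f (p k))"
      unfolding dotp_def sum_distrib_left by (rule sum.swap)
    then show ?thesis by (simp only: c_def dotp_restrict dotp_scale)
  qed
  \<comment> \<open>Otherwise \<open>c\<close> satisfies every inequality strictly, and a small step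
    along \<open>a\<close> stays in \<open>P\<close> although it pushes the product with
    \<open>a\<close> above \<open>b\<close>. The index set \<open>{0}\<close> is a dummy, since
    there is only one direction.\<close>
  have "\<exists>(a', b')\<in>H. dotp n a' c \<ge> b'"
  proof (rule ccontr)
    assume "\<not> ?thesis"
    then have st: "\<And>a' b'. (a', b') \<in> H \<Longrightarrow> dotp n a' c < b'" by force
    have "eventually (\<lambda>e. \<forall>(a', b')\<in>H. \<forall>k\<in>{0::nat}. dotp n a' c + e * dotp n a' a \<le> b') (at_right (0::real))"
      by (rule eventually_halfspaces[OF H(1)]) (use st in auto)
    moreover have "eventually (\<lambda>e::real. e > 0) (at_right 0)" by (simp add: eventually_at_right_less)
    ultimately have "eventually (\<lambda>e. e > 0 \<and> (\<forall>(a', b')\<in>H. dotp n a' c + e * dotp n a' a \<le> b')) (at_right (0::real))"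
      by eventually_elim auto
    then obtain e :: real where e: "e > 0" "\<forall>(a', b')\<in>H. dotp n a' c + e * dotp n a' a \<le> b'"
      using eventually_happens'[OF trivial_limit_at_right_real] by blast
    have "(\<lambda>i\<in>{..<n}. c i + e * a i) \<in> P"
      unfolding P using e(2) by (auto simp: dotp_add_scale)
    from sup[OF this] have "dotp n a c + e * dotp n a a \<le> b" by (simp add: dotp_add_scale)
    moreover have "dotp n a c = b" using pF n by (simp add: dc F)
    ultimately show False using e(1) dotp_self_pos[OF a] by (simp add: mult_le_0_iff)
  qed
  then obtain a' b' where ab: "(a', b') \<in> H" "dotp n a' c \<ge> b'" by auto
  have le: "dotp n a' (p k) \<le> b'" if "k < n" for k
    using pF[OF that] ab(1) by (auto simp: F P)
  \<comment> \<open>The slacks are nonnegative and their sum is not positive, so each of them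
    vanishes.\<close>
  have "(\<Sum>k<n. b' - dotp n a' (p k)) = n * (b' - dotp n a' c)"
    using n by (simp add: dc sum_subtractf algebra_simps)
  also have "\<dots> \<le> 0" using ab(2) by (simp add: mult_le_0_iff)
  finally have "(\<Sum>k<n. b' - dotp n a' (p k)) = 0"
    using le by (intro antisym sum_nonneg) auto
  then have "\<And>k. k < n \<Longrightarrow> dotp n a' (p k) = b'"
    using le by (subst (asm) sum_nonneg_eq_0_iff) auto
  moreover have "\<exists>i<n. a' i \<noteq> 0" using H(2) ab(1) by auto
  moreover have "\<And>k. k < n \<Longrightarrow> dotp n a (p k) = b" using pF by (auto simp: F)
  ultimately obtain m where m: "m \<noteq> 0" "\<forall>i<n. a' i = m * a i" "b' = m * b"
    using hyperplane_unique[OF ai a] by blast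
  have "dotp n a' x = m * dotp n a x" for x
    using m(2) by (simp add: dotp_def sum_distrib_left mult.assoc)
  then have "F = {x \<in> P. dotp n a' x = b'}" using m(1,3) by (auto simp: F)
  with ab(1) show "F \<in> (\<lambda>(a, b). {x \<in> P. dotp n a x = b}) ` H" by force
qed

text \<open>Test the inclusion at the unit vector a / |a|.\<close>

lemma unit_ball_subset_halfspace:
  assumes a: "\<exists>i<n. a i \<noteq> 0" and ball: "\<And>x. x \<in> points n \<Longrightarrow> dotp n x x \<le> 1 \<Longrightarrow> dotp n a x \<le> b"
  shows "sqrt (dotp n a a) \<le> b"
proof -
  define r where "r = sqrt (dotp n a a)"
  have r: "r > 0" "r\<^sup>2 = dotp n a a" using dotp_self_pos[OF a] by (auto simp: r_def)
  define x where "x = (\<lambda>i\<in>{..<n}. (1 / r) * a i)"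
  have "dotp n x x = (1 / r)\<^sup>2 * dotp n a a"
    unfolding dotp_def x_def sum_distrib_left by (intro sum.cong) (auto simp: power2_eq_square)
  then have "dotp n x x \<le> 1" using r by (simp add: power_divide)
  moreover have "x \<in> points n" by (simp add: x_def)
  ultimately have "dotp n a x \<le> b" by (rule ball[rotated])
  then show ?thesis unfolding x_def dotp_restrict dotp_scale using r
    by (simp add: r(2)[symmetric] power2_eq_square r_def[symmetric])
qed

text \<open>Near \<open>z\<close> only the constraint \<open>(a, b)\<close> is active, so small
  moves inside its hyperplane stay in \<open>P\<close>. The n - 1 moves \<open>v k\<close> with k
  different from \<open>i0\<close>, together with no move at all (\<open>v i0 = 0\<close>), produce
  n affinely independent points.\<close>

lemma facet_of_strict_point:
  assumes a: "\<exists>i<n. a i \<noteq> 0" and H: "finite H" "(a, b) \<in> H"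
    and P: "P = {x \<in> points n. \<forall>(a, b)\<in>H. dotp n a x \<le> b}"
    and z: "z \<in> points n" "dotp n a z = b" "\<And>a' b'. (a', b') \<in> H - {(a, b)} \<Longrightarrow> dotp n a' z < b'"
  shows "{x \<in> P. dotp n a x = b} \<in> facets n P"
proof -
  obtain i0 where i0: "i0 < n" "a i0 \<noteq> 0" using a by auto
  \<comment> \<open>The \<open>k\<close>-th coordinate vector, corrected in coordinate
    \<open>i0\<close> so as to be orthogonal to \<open>a\<close>.\<close>
  define v where "v = (\<lambda>k i. if k = i0 then 0 else (if i = k then 1 else 0) + (- a k / a i0) * (if i = i0 then 1 else (0::real)))"
  have unit: "dotp n f (\<lambda>i. if i = k then 1 else 0) = f k" if "k < n" for f k
    using that by (simp add: dotp_def if_distrib cong: if_cong)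
  have av: "dotp n a (v k) = 0" if "k < n" for k
  proof (cases "k = i0")
    case True
    then show ?thesis by (simp add: v_def dotp_def)
  next
    case False
    then have "dotp n a (v k) = a k + (- a k / a i0) * a i0"
      using that i0 by (simp only: v_def if_False dotp_add_scale unit)
    then show ?thesis using i0 by simp
  qed
  have "eventually (\<lambda>e. \<forall>(a', b')\<in>H - {(a, b)}. \<forall>k\<in>{..<n}. dotp n a' z + e * dotp n a' (v k) \<le> b') (at_right (0::real))"
    by (rule eventually_halfspaces) (use H z in auto)
  moreover have "eventually (\<lambda>e::real. e > 0) (at_right 0)" by (simp add: eventually_at_right_less)
  ultimately have "eventually (\<lambda>e. e > 0 \<and> (\<forall>(a', b')\<in>H - {(a, b)}. \<forall>k\<in>{..<n}. dotp n a' z + e * dotp n a' (v k) \<le> b')) (at_right (0::real))"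
    by eventually_elim auto
  then obtain e :: real where e0: "e > 0"
      "\<forall>(a', b')\<in>H - {(a, b)}. \<forall>k\<in>{..<n}. dotp n a' z + e * dotp n a' (v k) \<le> b'"
    using eventually_happens'[OF trivial_limit_at_right_real] by blast
  have e: "e > 0" "\<And>a' b' k. (a', b') \<in> H - {(a, b)} \<Longrightarrow> k < n \<Longrightarrow> dotp n a' z + e * dotp n a' (v k) \<le> b'"
    using e0 by blast+
  define p where "p = (\<lambda>k. \<lambda>i\<in>{..<n}. z i + e * v k i)"
  have dp: "dotp n f (p k) = dotp n f z + e * dotp n f (v k)" for f k
    unfolding p_def dotp_restrict dotp_add_scale ..
  have pF: "p k \<in> {x \<in> P. dotp n a x = b}" if "k < n" for k
  proof -
    have ap: "dotp n a (p k) = b" using av[OF that] z(2) by (simp add: dp)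
    have "dotp n a' (p k) \<le> b'" if "(a', b') \<in> H" for a' b'
    proof (cases "(a', b') = (a, b)")
      case True
      then show ?thesis using ap by simp
    next
      case False
      then show ?thesis using e(2)[of a' b' k] that \<open>k < n\<close> by (simp add: dp)
    qed
    moreover have "p k \<in> points n" by (simp add: p_def)
    ultimately show ?thesis using ap by (auto simp: P)
  qed
  have "affinely_independent n n p"
    unfolding affinely_independent_def
  proof (intro allI impI)
    fix c k
    assume c: "(\<Sum>k<n. c k) = 0 \<and> (\<forall>i<n. (\<Sum>k<n. c k * p k i) = 0)" and k: "k < n"
    have *: "c i = 0" if i: "i < n" "i \<noteq> i0" for i
    proof -
      have "(\<Sum>k<n. c k * p k i) = (\<Sum>k<n. c k * z i) + e * (\<Sum>k<n. c k * v k i)"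
        using i by (simp add: p_def sum.distrib sum_distrib_left algebra_simps)
      also have "(\<Sum>k<n. c k * z i) = 0" using c by (simp add: sum_distrib_right[symmetric])
      also have "(\<Sum>k<n. c k * v k i) = (\<Sum>k<n. if k = i then c k else 0)"
        using i by (intro sum.cong) (auto simp: v_def)
      finally have "e * c i = 0" using c i by simp
      with e(1) show ?thesis by simp
    qed
    have "(\<Sum>k<n. c k) = c i0 + (\<Sum>k\<in>{..<n} - {i0}. c k)" using i0 by (intro sum.remove) auto
    also have "(\<Sum>k\<in>{..<n} - {i0}. c k) = 0" using * by (intro sum.neutral) auto
    finally have "c i0 = 0" using c by simp
    with * k show "c k = 0" by metis
  qed
  moreover have "\<forall>x\<in>P. dotp n a x \<le> b" using H(2) by (auto simp: P)
  ultimately show ?thesis unfolding facets_def using a pF by blast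
qed

text \<open>In a representation by as few half-spaces as possible, different half-spaces define different facets.\<close>

lemma polytope_irredundant_halfspaces:
  assumes P: "is_polytope n P" and ball: "{x \<in> points n. dotp n x x \<le> 1} \<subseteq> P" and fin: "finite (facets n P)"
  shows "\<exists>H. finite H \<and> card H \<le> card (facets n P) \<and> (\<forall>(a, b)\<in>H. \<exists>i<n. a i \<noteq> 0) \<and>
    P = {x \<in> points n. \<forall>(a, b)\<in>H. dotp n a x \<le> b}"
proof -
  define Q where "Q = (\<lambda>H. finite H \<and> (\<forall>(a, b)\<in>H. \<exists>i<n. a i \<noteq> 0) \<and>
    P = {x \<in> points n. \<forall>(a, b)\<in>H. dotp n a x \<le> b})"
  obtain H0 where "Q H0" using P unfolding is_polytope_def Q_def by blast
  from ex_has_least_nat[of Q, OF this, of card] obtain H where QH: "Q H" and least: "\<And>H'. Q H' \<Longrightarrow> card H \<le> card H'"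
    by blast
  have H: "finite H" "\<And>a b. (a, b) \<in> H \<Longrightarrow> \<exists>i<n. a i \<noteq> 0" and PH: "P = {x \<in> points n. \<forall>(a, b)\<in>H. dotp n a x \<le> b}"
    using QH unfolding Q_def by auto
  have bpos: "b > 0" if "(a, b) \<in> H" for a b
  proof -
    have "sqrt (dotp n a a) \<le> b"
      by (rule unit_ball_subset_halfspace[OF H(2)[OF that]]) (use ball that PH in auto)
    moreover have "sqrt (dotp n a a) > 0" using dotp_self_pos[OF H(2)[OF that]] by simp
    ultimately show ?thesis by linarith
  qed
  have "\<exists>z. z \<in> points n \<and> dotp n a z = b \<and> (\<forall>a' b'. (a', b') \<in> H - {(a, b)} \<longrightarrow> dotp n a' z < b')"
    if h: "(a, b) \<in> H" for a b
  proof -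
    have "card (H - {(a, b)}) < card H" using h H(1) by (rule card_Diff1_less[rotated])
    with least have "\<not> Q (H - {(a, b)})" by (meson not_less)
    then have "P \<noteq> {x \<in> points n. \<forall>(a', b')\<in>H - {(a, b)}. dotp n a' x \<le> b'}" using H unfolding Q_def by blast
    moreover have "P \<subseteq> {x \<in> points n. \<forall>(a', b')\<in>H - {(a, b)}. dotp n a' x \<le> b'}" unfolding PH by blast
    ultimately obtain x where x0: "x \<in> {x \<in> points n. \<forall>(a', b')\<in>H - {(a, b)}. dotp n a' x \<le> b'}" and xP: "x \<notin> P"
      by (metis (no_types, lifting) subsetI subset_antisym)
    then have x: "x \<in> points n" "\<And>a' b'. (a', b') \<in> H - {(a, b)} \<Longrightarrow> dotp n a' x \<le> b'"
      by blast+
    have ax: "dotp n a x > b"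
    proof (rule ccontr)
      assume "\<not> ?thesis"
      then have "x \<in> P" unfolding PH using x(1,2) by fastforce
      with xP show False by simp
    qed
    \<comment> \<open>\<open>x\<close> violates \<open>(a, b)\<close> and no other constraint.
      Shrinking it towards the origin until it meets the hyperplane of \<open>(a, b)\<close> makes
      all the other inequalities strict, because every right-hand side is positive.\<close>
    define t where "t = b / dotp n a x"
    have t: "0 < t" "t < 1" using ax bpos[OF h] by (auto simp: t_def)
    define z where "z = (\<lambda>i\<in>{..<n}. t * x i)"
    have dz: "dotp n f z = t * dotp n f x" for f unfolding z_def dotp_restrict dotp_scale ..
    have "dotp n a' z < b'" if "(a', b') \<in> H - {(a, b)}" for a' b'
    proof -
      have "t * dotp n a' x \<le> t * b'" using x(2)[OF that] t by (intro mult_left_mono) auto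
      also have "\<dots> < 1 * b'" using t bpos[of a' b'] that by (intro mult_strict_right_mono) auto
      finally show ?thesis by (simp add: dz)
    qed
    moreover have "dotp n a z = b" using ax bpos[OF h] by (simp add: dz t_def)
    moreover have "z \<in> points n" by (simp add: z_def)
    ultimately show ?thesis by blast
  qed
  then have "\<forall>h\<in>H. \<exists>z. z \<in> points n \<and> dotp n (fst h) z = snd h \<and> (\<forall>a' b'. (a', b') \<in> H - {h} \<longrightarrow> dotp n a' z < b')"
    by auto
  then obtain z where "\<forall>h\<in>H. z h \<in> points n \<and> dotp n (fst h) (z h) = snd h \<and> (\<forall>a' b'. (a', b') \<in> H - {h} \<longrightarrow> dotp n a' (z h) < b')"
    unfolding bchoice_iff by blast
  then have z: "\<And>a b. (a, b) \<in> H \<Longrightarrow> z (a, b) \<in> points n"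
      "\<And>a b. (a, b) \<in> H \<Longrightarrow> dotp n a (z (a, b)) = b"
      "\<And>a b a' b'. (a, b) \<in> H \<Longrightarrow> (a', b') \<in> H - {(a, b)} \<Longrightarrow> dotp n a' (z (a, b)) < b'"
    by fastforce+
  define F where "F = (\<lambda>(a, b). {x \<in> P. dotp n a x = b})"
  have "F h \<in> facets n P" if "h \<in> H" for h
  proof -
    obtain a b where h: "h = (a, b)" by (cases h)
    show ?thesis unfolding h F_def prod.case
      by (rule facet_of_strict_point[OF H(2) H(1) _ PH, where z = "z (a, b)"]) (use that h z in auto)
  qed
  moreover have "inj_on F H"
  proof (rule inj_onI, rule ccontr)
    fix h h' assume hh: "h \<in> H" "h' \<in> H" "F h = F h'" "h \<noteq> h'"
    obtain a b a' b' where h: "h = (a, b)" "h' = (a', b')" by (cases h, cases h')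
    have lt: "dotp n a' (z h) < b'" using z(3)[of a b a' b'] hh h by auto
    have "z h \<in> points n" using z(1)[of a b] hh h by simp
    moreover have "dotp n a2 (z h) \<le> b2" if "(a2, b2) \<in> H" for a2 b2
      using z(2)[of a b] z(3)[of a b a2 b2] hh h that by (cases "(a2, b2) = (a, b)") auto
    ultimately have "z h \<in> P" unfolding PH by blast
    moreover have "dotp n a (z h) = b" using z(2)[of a b] hh h by simp
    ultimately have "z h \<in> F h" by (simp add: F_def h)
    then have "z h \<in> F h'" using hh(3) by simp
    with lt show False by (simp add: F_def h)
  qed
  ultimately have "card H \<le> card (facets n P)"
    using fin by (intro card_inj_on_le[of F]) auto
  then show ?thesis using QH unfolding Q_def by blast
qed

text \<open>Each half-space of an irredundant description is moved in parallel until it touches the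
  ball. Since |a| <= b, this only shrinks the intersection, and its excess volume bounds that of
  \<open>P\<close> from below.\<close>

lemma circumscribed_polytope_contains_tangential:
  assumes P: "is_polytope n P" and ball: "{x \<in> points n. dotp n x x \<le> 1} \<subseteq> P" and fin: "finite (facets n P)"
  shows "\<exists>U. finite U \<and> card U \<le> card (facets n P) \<and> (\<forall>u\<in>U. dotp n u u = 1) \<and>
    {x \<in> points n. \<forall>u\<in>U. dotp n u x \<le> 1} \<subseteq> P"
proof -
  obtain H where H: "finite H" "card H \<le> card (facets n P)" "\<And>a b. (a, b) \<in> H \<Longrightarrow> \<exists>i<n. a i \<noteq> 0"
    and PH: "P = {x \<in> points n. \<forall>(a, b)\<in>H. dotp n a x \<le> b}"
    using polytope_irredundant_halfspaces[OF assms] by fast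
  define N where "N = (\<lambda>(a, b::real) i. (1 / sqrt (dotp n a a)) * a i)"
  define U where "U = N ` H"
  have Ndot: "dotp n (N (a, b)) x = (1 / sqrt (dotp n a a)) * dotp n a x" for a b x
    by (simp add: N_def dotp_def sum_distrib_left mult.assoc sum_divide_distrib)
  have "dotp n u u = 1" if "u \<in> U" for u
  proof -
    obtain a b where ab: "(a, b) \<in> H" "u = N (a, b)" using \<open>u \<in> U\<close> by (auto simp: U_def)
    have p: "dotp n a a > 0" using H(3)[OF ab(1)] by (rule dotp_self_pos)
    have "dotp n u u = (1 / sqrt (dotp n a a)) * ((1 / sqrt (dotp n a a)) * dotp n a a)"
      unfolding ab(2) Ndot by (simp only: N_def prod.case dotp_scale)
    also have "\<dots> = 1" using p by (simp add: field_simps)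
    finally show ?thesis .
  qed
  moreover have "{x \<in> points n. \<forall>u\<in>U. dotp n u x \<le> 1} \<subseteq> P"
  proof safe
    fix x assume x: "x \<in> points n" "\<forall>u\<in>U. dotp n u x \<le> 1"
    have "dotp n a x \<le> b" if "(a, b) \<in> H" for a b
    proof -
      have p: "dotp n a a > 0" using H(3)[OF that] by (rule dotp_self_pos)
      have "dotp n (N (a, b)) x \<le> 1" using x that by (auto simp: U_def)
      then have "dotp n a x \<le> sqrt (dotp n a a)" using p unfolding Ndot by (simp add: field_simps)
      also have "\<dots> \<le> b"
        by (rule unit_ball_subset_halfspace[OF H(3)[OF that]]) (use ball that PH in auto)
      finally show ?thesis .
    qed
    with x show "x \<in> P" by (auto simp: PH)
  qed
  moreover have "finite U" "card U \<le> card (facets n P)"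
    using H card_image_le[of H N] by (auto simp: U_def)
  ultimately show ?thesis by blast
qed

section \<open>Circumscribed polytopes with few facets have large volume\<close>

definition unit_ball :: "nat \<Rightarrow> (nat \<Rightarrow> real) set" where
  "unit_ball n = {x \<in> points n. dotp n x x \<le> 1}"

lemma space_leb: "space (leb I) = Pi\<^sub>E I (\<lambda>_. UNIV)"
  by (simp add: space_PiM)

lemma sqn_eq_dotp: "sqn {..<n} x = dotp n x x"
  by (simp add: sqn_def dotp_def power2_eq_square)

lemma dotp_measurable [measurable]: "dotp n a \<in> borel_measurable (leb {..<n})"
  unfolding dotp_eq_inp by measurable

lemma unit_ball_eq: "unit_ball n = {x \<in> space (leb {..<n}). sqn {..<n} x \<le> 1\<^sup>2}"
  by (simp add: unit_ball_def sqn_eq_dotp space_leb)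

lemma emeasure_unit_ball: "emeasure (leb {..<n}) (unit_ball n) = ennreal (unit_ball_vol n)"
  unfolding unit_ball_eq by (subst emeasure_ball_leb) auto

lemma unit_ball_sets [measurable]: "unit_ball n \<in> sets (leb {..<n})"
  unfolding unit_ball_eq by measurable

lemma dotp_le_one:
  assumes "dotp n u u \<le> 1" "dotp n x x \<le> 1"
  shows "dotp n u x \<le> 1"
proof -
  have "0 \<le> (\<Sum>i<n. (u i - x i)\<^sup>2)" by (intro sum_nonneg) auto
  also have "\<dots> = dotp n u u + dotp n x x - 2 * dotp n u x"
    by (simp add: dotp_def power2_eq_square algebra_simps sum.distrib sum_subtractf sum_distrib_left)
  finally show ?thesis using assms by simp
qed

lemma polytope_sets:
  assumes "is_polytope n P"
  shows "P \<in> sets (leb {..<n})"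
proof -
  obtain H where H: "finite H" "P = {x \<in> points n. \<forall>(a, b)\<in>H. dotp n a x \<le> b}"
    using assms unfolding is_polytope_def by blast
  have "P = {x \<in> space (leb {..<n}). \<forall>h\<in>H. dotp n (fst h) x \<le> snd h}"
    using H by (auto simp: case_prod_unfold space_leb)
  also have "\<dots> \<in> sets (leb {..<n})"
    by (rule sets.sets_Collect_finite_All[OF _ H(1)]) measurable
  finally show ?thesis .
qed

lemma polytope_emeasure_finite:
  assumes "is_polytope n P"
  shows "emeasure (leb {..<n}) P < \<infinity>"
proof -
  obtain R where R: "\<forall>x\<in>P. L2_set x {..<n} \<le> R" and sub: "P \<subseteq> points n"
    using assms unfolding is_polytope_def by blast
  have "P \<subseteq> {x \<in> space (leb {..<n}). sqn {..<n} x \<le> (max R 0)\<^sup>2}"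
  proof
    fix x assume x: "x \<in> P"
    have "sqn {..<n} x = (L2_set x {..<n})\<^sup>2" by (simp add: sqn_def L2_set_def sum_nonneg)
    also have "\<dots> \<le> (max R 0)\<^sup>2" using R x by (intro power_mono) (auto simp: le_max_iff_disj)
    finally show "x \<in> {x \<in> space (leb {..<n}). sqn {..<n} x \<le> (max R 0)\<^sup>2}" using sub x by (auto simp: space_leb)
  qed
  then have "emeasure (leb {..<n}) P \<le> emeasure (leb {..<n}) {x \<in> space (leb {..<n}). sqn {..<n} x \<le> (max R 0)\<^sup>2}"
    by (intro emeasure_mono) measurable
  also have "\<dots> < \<infinity>" by (subst emeasure_ball_leb) auto
  finally show ?thesis .
qed

text \<open>The ball of radius \<open>1 + s\<close> is covered by \<open>P - unit_ball n\<close>,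
  the unit ball and one cap for each tangential half-space. Parts of \<open>P\<close> outside the
  larger ball only help.\<close>

lemma circumscribed_volume_ge:
  fixes d :: nat
  defines "n \<equiv> Suc d"
  assumes d: "d \<ge> 1" and s: "s > 0" and P: "is_polytope n P" "unit_ball n \<subseteq> P" "finite (facets n P)"
    and N: "card (facets n P) \<le> N"
  shows "measure (leb {..<n}) (P - unit_ball n) \<ge> unit_ball_vol n * ((1 + s) ^ n - 1)
    - N * (unit_ball_vol d * (2 * (1 + s)) powr (d / 2) * (s powr (d / 2 + 1) / (d / 2 + 1)))"
proof -
  define cap where "cap = unit_ball_vol d * (2 * (1 + s)) powr (d / 2) * (s powr (d / 2 + 1) / (d / 2 + 1))"
  have cap0: "cap \<ge> 0" by (simp add: cap_def)
  obtain U where U: "finite U" "card U \<le> card (facets n P)" "\<And>u. u \<in> U \<Longrightarrow> dotp n u u = 1"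
    and sub: "{x \<in> points n. \<forall>u\<in>U. dotp n u x \<le> 1} \<subseteq> P"
    using circumscribed_polytope_contains_tangential[OF P(1) P(2)[unfolded unit_ball_def] P(3)] by blast
  let ?M = "leb {..<n}"
  let ?C = "\<lambda>u. {x \<in> space ?M. sqn {..<n} x \<le> (1 + s)\<^sup>2 \<and> 1 < inp {..<n} u x}"
  have [measurable]: "P \<in> sets ?M" by (rule polytope_sets[OF P(1)])
  have C: "?C u \<in> sets ?M" for u by measurable
  have CU[measurable]: "(\<Union>u\<in>U. ?C u) \<in> sets ?M" using C U(1) by (intro sets.finite_UN)
  have "ennreal (unit_ball_vol n * (1 + s) ^ n) = emeasure ?M {x \<in> space ?M. sqn {..<n} x \<le> (1 + s)\<^sup>2}"
    using emeasure_ball_leb[of "{..<n}" "1 + s"] s by simp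
  also have "\<dots> \<le> emeasure ?M ((P - unit_ball n) \<union> (unit_ball n \<union> (\<Union>u\<in>U. ?C u)))"
  proof (rule emeasure_mono)
    show "{x \<in> space ?M. sqn {..<n} x \<le> (1 + s)\<^sup>2} \<subseteq> (P - unit_ball n) \<union> (unit_ball n \<union> (\<Union>u\<in>U. ?C u))"
      using sub by (auto simp: dotp_eq_inp not_le[symmetric] space_leb)
  qed (use CU in measurable)
  also have "\<dots> \<le> emeasure ?M (P - unit_ball n) + emeasure ?M (unit_ball n \<union> (\<Union>u\<in>U. ?C u))"
    by (intro emeasure_subadditive) measurable
  also have "emeasure ?M (unit_ball n \<union> (\<Union>u\<in>U. ?C u)) \<le> emeasure ?M (unit_ball n) + emeasure ?M (\<Union>u\<in>U. ?C u)"
    by (intro emeasure_subadditive) measurable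
  also have "emeasure ?M (\<Union>u\<in>U. ?C u) \<le> (\<Sum>u\<in>U. emeasure ?M (?C u))"
    using U(1) C by (intro emeasure_subadditive_finite) auto
  also have "\<dots> \<le> (\<Sum>u\<in>U. ennreal cap)"
    unfolding cap_def n_def
    by (intro sum_mono cap_volume_le d s) (use U(3) in \<open>auto simp: sqn_eq_dotp n_def\<close>)
  also have "\<dots> = ennreal (card U * cap)" by (simp add: ennreal_mult' ennreal_of_nat_eq_real_of_nat)
  also have "\<dots> \<le> ennreal (N * cap)" using U(2) N cap0 by (intro ennreal_leI mult_right_mono) auto
  also have "emeasure ?M (unit_ball n) = ennreal (unit_ball_vol n)" by (rule emeasure_unit_ball)
  also have "emeasure ?M (P - unit_ball n) = ennreal (measure ?M (P - unit_ball n))"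
  proof (rule emeasure_eq_ennreal_measure)
    have "emeasure ?M (P - unit_ball n) \<le> emeasure ?M P" by (intro emeasure_mono) auto
    also have "\<dots> < \<infinity>" by (rule polytope_emeasure_finite[OF P(1)])
    finally show "emeasure ?M (P - unit_ball n) \<noteq> top" by simp
  qed
  finally have "ennreal (unit_ball_vol n * (1 + s) ^ n) \<le> ennreal (measure ?M (P - unit_ball n) + (unit_ball_vol n + N * cap))"
    using cap0 by (simp add: add_mono)
  then have "unit_ball_vol n * (1 + s) ^ n \<le> measure ?M (P - unit_ball n) + (unit_ball_vol n + N * cap)"
    using cap0 by (subst (asm) ennreal_le_iff) auto
  then show ?thesis by (simp add: cap_def algebra_simps)
qed

lemma tangential_polytope:
  assumes n: "n \<ge> 1" and U: "finite U" "\<And>u. u \<in> U \<Longrightarrow> dotp n u u = 1"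
  defines "P \<equiv> {x \<in> points n. (\<forall>i<n. \<bar>x i\<bar> \<le> 1) \<and> (\<forall>u\<in>U. dotp n u x \<le> 1)}"
  shows "is_polytope n P" "unit_ball n \<subseteq> P" "finite (facets n P)" "card (facets n P) \<le> card U + 2 * n"
proof -
  define e where "e = (\<lambda>(c::real) (i::nat) j. if j = i then c else 0)"
  have de: "dotp n (e c i) x = c * x i" if "i < n" for c i x
    using that by (simp add: dotp_def e_def if_distrib if_distribR cong: if_cong)
  define H where "H = (\<lambda>u. (u, 1::real)) ` U \<union> ((\<lambda>i. (e 1 i, 1)) ` {..<n} \<union> (\<lambda>i. (e (-1) i, 1)) ` {..<n})"
  have finH: "finite H" using U(1) by (simp add: H_def)
  have cardH: "card H \<le> card U + (n + n)"
    unfolding H_def using U(1)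
    by (intro card_Un_le[THEN order_trans] add_mono card_image_le[THEN order_trans]) auto
  have nz: "\<forall>(a, b)\<in>H. \<exists>i<n. a i \<noteq> 0"
  proof -
    have "\<exists>i<n. u i \<noteq> 0" if "u \<in> U" for u
    proof (rule ccontr)
      assume "\<not> ?thesis"
      then have "dotp n u u = 0" by (simp add: dotp_def)
      with U(2)[OF that] show False by simp
    qed
    then show ?thesis by (auto simp: H_def e_def)
  qed
  have PH: "P = {x \<in> points n. \<forall>(a, b)\<in>H. dotp n a x \<le> b}"
  proof -
    have "(\<forall>(a, b)\<in>H. dotp n a x \<le> b) \<longleftrightarrow>
        (\<forall>u\<in>U. dotp n u x \<le> 1) \<and> (\<forall>i<n. x i \<le> 1) \<and> (\<forall>i<n. - x i \<le> 1)" for x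
      unfolding H_def ball_Un by (simp add: de) blast
    then show ?thesis unfolding P_def by (simp only: abs_le_iff) blast
  qed
  have bd: "\<forall>x\<in>P. L2_set x {..<n} \<le> n"
  proof
    fix x assume "x \<in> P"
    then have "L2_set x {..<n} \<le> (\<Sum>i<n. 1)"
      by (intro order_trans[OF L2_set_le_sum_abs] sum_mono) (auto simp: P_def)
    then show "L2_set x {..<n} \<le> n" by simp
  qed
  show "is_polytope n P" unfolding is_polytope_def using finH nz PH bd by blast
  note sub = facets_subset_image[OF n finH nz PH]
  then show "finite (facets n P)" using finH finite_surj by blast
  have "card (facets n P) \<le> card H" using sub finH by (rule surj_card_le[rotated])
  with cardH show "card (facets n P) \<le> card U + 2 * n" by simp
  show "unit_ball n \<subseteq> P"
  proof
    fix x assume x: "x \<in> unit_ball n"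
    have "c * x i \<le> 1" if "i < n" "c\<^sup>2 \<le> 1" for c i
    proof -
      have "dotp n (e c i) (e c i) = c\<^sup>2"
        unfolding de[OF that(1)] by (simp add: e_def power2_eq_square)
      then have "dotp n (e c i) x \<le> 1"
        using x that by (rule_tac dotp_le_one) (simp_all add: unit_ball_def)
      then show ?thesis using that by (simp add: de)
    qed
    from this[of _ 1] this[of _ "-1"] have "\<forall>i<n. \<bar>x i\<bar> \<le> 1" by (auto simp: abs_le_iff)
    moreover have "\<forall>u\<in>U. dotp n u x \<le> 1" using x U(2) by (metis (mono_tags, lifting) dotp_le_one mem_Collect_eq order_refl unit_ball_def)
    ultimately show "x \<in> P" using x by (auto simp: P_def unit_ball_def)
  qed
qed

lemma min_volume_diff_ge:
  fixes d :: nat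
  defines "n \<equiv> Suc d"
  assumes d: "d \<ge> 1" and s: "s > 0" and N: "N \<ge> 2 * n"
  shows "min_volume_diff n (unit_ball n) N \<ge> unit_ball_vol n * ((1 + s) ^ n - 1)
    - N * (unit_ball_vol d * (2 * (1 + s)) powr (d / 2) * (s powr (d / 2 + 1) / (d / 2 + 1)))"
  unfolding min_volume_diff_def
proof (rule cInf_greatest)
  show "{measure (leb {..<n}) (P - unit_ball n) |P. is_polytope n P \<and> unit_ball n \<subseteq> P \<and>
      finite (facets n P) \<and> card (facets n P) \<le> N} \<noteq> {}"
    \<comment> \<open>Without extra directions this polytope is the cube: it shows that the infimum
      is over a nonempty set, and this is where \<open>N \<ge> 2 * n\<close> enters.\<close>
    using tangential_polytope[of n "{}"] N by (auto simp: n_def)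
qed (use circumscribed_volume_ge[OF d s] in \<open>auto simp: n_def\<close>)

lemma min_volume_diff_le:
  assumes "is_polytope n P" "unit_ball n \<subseteq> P" "finite (facets n P)" "card (facets n P) \<le> N"
  shows "min_volume_diff n (unit_ball n) N \<le> measure (leb {..<n}) (P - unit_ball n)"
  unfolding min_volume_diff_def by (rule cInf_lower) (use assms in \<open>auto intro!: bdd_belowI[of _ 0]\<close>)

section \<open>Random directions\<close>

text \<open>A random direction is modelled as y / |y| with \<open>y\<close> uniform in the unit
  ball, which keeps everything in Lebesgue measure. The point \<open>x\<close> survives the
  half-space of that direction iff x . y <= |y|; division by \<open>unit_ball_vol n\<close> would
  turn the value into the survival probability.\<close>

definition uncovered_volume :: "nat \<Rightarrow> (nat \<Rightarrow> real) \<Rightarrow> ennreal" where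
  "uncovered_volume n x = emeasure (leb {..<n}) {y \<in> unit_ball n. dotp n x y \<le> sqrt (dotp n y y)}"

lemma dotp_pair_measurable [measurable]:
  "(\<lambda>(x, y). dotp n x y) \<in> borel_measurable (leb {..<n} \<Otimes>\<^sub>M leb {..<n})"
proof -
  have "(\<lambda>p. \<Sum>i<n. fst p i * snd p i) \<in> borel_measurable (leb {..<n} \<Otimes>\<^sub>M leb {..<n})"
    by (intro borel_measurable_sum borel_measurable_times measurable_component_leb[where I="{..<n}"]) auto
  then show ?thesis by (simp add: dotp_def case_prod_unfold)
qed

lemma dotp_self_measurable [measurable]: "(\<lambda>y. dotp n y y) \<in> borel_measurable (leb {..<n})"
  unfolding sqn_eq_dotp[symmetric] by measurable

lemma sigma_finite_leb: "finite I \<Longrightarrow> sigma_finite_measure (leb I)"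
  by (rule psf.sigma_finite)

lemma uncovered_indicator_measurable [measurable]:
  "(\<lambda>(x, y). indicator {y \<in> unit_ball n. dotp n x y \<le> sqrt (dotp n y y)} y :: ennreal)
     \<in> borel_measurable (leb {..<n} \<Otimes>\<^sub>M leb {..<n})"
proof -
  have [measurable]: "(\<lambda>p. dotp n (fst p) (snd p)) \<in> borel_measurable (leb {..<n} \<Otimes>\<^sub>M leb {..<n})"
    using dotp_pair_measurable by (simp add: case_prod_unfold)
  have "(\<lambda>p. if snd p \<in> unit_ball n \<and> dotp n (fst p) (snd p) \<le> sqrt (dotp n (snd p) (snd p)) then 1 else 0 :: ennreal)
    \<in> borel_measurable (leb {..<n} \<Otimes>\<^sub>M leb {..<n})"
    by measurable
  then show ?thesis by (simp add: case_prod_unfold indicator_def)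
qed

lemma uncovered_volume_alt:
  "uncovered_volume n x = (\<integral>\<^sup>+y. indicator {y \<in> unit_ball n. dotp n x y \<le> sqrt (dotp n y y)} y \<partial>leb {..<n})"
proof -
  have "{y \<in> unit_ball n. dotp n x y \<le> sqrt (dotp n y y)} = unit_ball n \<inter> {y \<in> space (leb {..<n}). dotp n x y \<le> sqrt (dotp n y y)}"
    by (auto simp: unit_ball_def space_leb)
  also have "\<dots> \<in> sets (leb {..<n})" by measurable
  finally show ?thesis unfolding uncovered_volume_def by simp
qed

lemma uncovered_volume_measurable [measurable]: "uncovered_volume n \<in> borel_measurable (leb {..<n})"
proof -
  interpret sigma_finite_measure "leb {..<n}" by (rule sigma_finite_leb) simp
  show ?thesis unfolding uncovered_volume_alt[abs_def] by measurable
qed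

lemma uncovered_volume_le: "uncovered_volume n x \<le> ennreal (unit_ball_vol n)"
  unfolding uncovered_volume_def emeasure_unit_ball[symmetric] by (intro emeasure_mono) auto

text \<open>First moment argument: let \<open>h y\<close> be the mass that survives the direction y
  / |y|. By Tonelli its integral over the ball is \<open>T\<close>. If every direction left more
  than the average, integration over the ball would give \<open>T * w < w * T\<close>.\<close>

lemma exists_good_direction:
  assumes n: "n \<ge> 1" and g[measurable]: "g \<in> borel_measurable (leb {..<n})"
    and fin: "(\<integral>\<^sup>+x. g x \<partial>leb {..<n}) < \<infinity>"
  shows "\<exists>u. dotp n u u = 1 \<and> ennreal (unit_ball_vol n) * (\<integral>\<^sup>+x. g x * indicator {x. dotp n u x \<le> 1} x \<partial>leb {..<n})
     \<le> (\<integral>\<^sup>+x. g x * uncovered_volume n x \<partial>leb {..<n})"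
proof (rule ccontr)
  let ?M = "leb {..<n}"
  let ?I = "\<lambda>x y. indicator {y \<in> unit_ball n. dotp n x y \<le> sqrt (dotp n y y)} y :: ennreal"
  define w where "w = ennreal (unit_ball_vol n)"
  have w: "w > 0" "w < \<infinity>" by (auto simp: w_def)
  define T where "T = (\<integral>\<^sup>+x. g x * uncovered_volume n x \<partial>?M)"
  assume "\<not> ?thesis"
  then have neg: "\<And>u. dotp n u u = 1 \<Longrightarrow> T < w * (\<integral>\<^sup>+x. g x * indicator {x. dotp n u x \<le> 1} x \<partial>?M)"
    by (auto simp: T_def w_def not_le)
  interpret M: sigma_finite_measure ?M by (rule sigma_finite_leb) simp
  interpret P: pair_sigma_finite ?M ?M ..
  have "T \<le> (\<integral>\<^sup>+x. g x * w \<partial>?M)"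
    unfolding T_def w_def by (intro nn_integral_mono mult_left_mono uncovered_volume_le) auto
  also have "\<dots> = (\<integral>\<^sup>+x. g x \<partial>?M) * w" by (rule nn_integral_multc) measurable
  also have "\<dots> < \<infinity>" using fin w by (simp add: ennreal_mult_less_top)
  finally have T: "T < \<infinity>" .
  define h where "h = (\<lambda>y. \<integral>\<^sup>+x. g x * ?I x y \<partial>?M)"
  have mI: "(\<lambda>(x, y). g x * ?I x y) \<in> borel_measurable (?M \<Otimes>\<^sub>M ?M)"
  proof -
    have "(\<lambda>p. g (fst p)) \<in> borel_measurable (?M \<Otimes>\<^sub>M ?M)"
      by (rule measurable_compose[OF measurable_fst g])
    from borel_measurable_times_ennreal[OF this uncovered_indicator_measurable[of n]]
    show ?thesis by (simp add: case_prod_unfold)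
  qed
  have "(\<lambda>(y, x). g x * ?I x y) \<in> borel_measurable (?M \<Otimes>\<^sub>M ?M)"
    using measurable_compose[OF measurable_pair_swap' mI] by (simp add: case_prod_unfold)
  then have hm[measurable]: "h \<in> borel_measurable ?M"
    unfolding h_def by (rule M.borel_measurable_nn_integral)
  have "(\<integral>\<^sup>+y. h y \<partial>?M) = (\<integral>\<^sup>+x. \<integral>\<^sup>+y. g x * ?I x y \<partial>?M \<partial>?M)"
    unfolding h_def by (rule P.Fubini'[OF mI])
  also have "\<dots> = T" unfolding T_def uncovered_volume_alt
  proof (rule nn_integral_cong)
    fix x assume x: "x \<in> space ?M"
    have "(\<lambda>y. ?I x y) \<in> borel_measurable ?M"
      using measurable_compose[OF measurable_Pair1'[OF x] uncovered_indicator_measurable] by simp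
    then show "(\<integral>\<^sup>+y. g x * ?I x y \<partial>?M) = g x * (\<integral>\<^sup>+y. ?I x y \<partial>?M)" by (rule nn_integral_cmult)
  qed
  finally have hT: "(\<integral>\<^sup>+y. h y \<partial>?M) = T" .
  \<comment> \<open>The origin defines no direction; it is a null set because
    \<open>n \<ge> 1\<close>.\<close>
  define B0 where "B0 = {x \<in> space ?M. sqn {..<n} x \<le> 0\<^sup>2}"
  have B0: "B0 \<in> sets ?M" "emeasure ?M B0 = 0"
  proof -
    show "B0 \<in> sets ?M" unfolding B0_def by measurable
    have "emeasure ?M B0 = ennreal (unit_ball_vol n * 0 ^ n)"
      unfolding B0_def by (subst emeasure_ball_leb) simp_all
    then show "emeasure ?M B0 = 0" using n by (simp add: zero_power)
  qed
  have lt: "T < w * h y" if y: "y \<in> unit_ball n - B0" for y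
  proof -
    define r where "r = sqrt (dotp n y y)"
    have "\<not> dotp n y y \<le> 0" using y by (simp add: B0_def unit_ball_def space_leb sqn_eq_dotp)
    then have r: "r > 0" by (simp add: r_def)
    define u where "u = (\<lambda>i. (1 / r) * y i)"
    have ux: "dotp n u x = (1 / r) * dotp n x y" for x
      by (simp add: u_def dotp_def sum_distrib_left mult_ac sum_divide_distrib)
    have "dotp n u u = (1 / r) * ((1 / r) * dotp n y y)"
      by (simp only: ux)
    also have "dotp n y y = r * r" by (simp add: r_def)
    finally have "dotp n u u = 1" using r by simp
    from neg[OF this] have "T < w * (\<integral>\<^sup>+x. g x * indicator {x. dotp n u x \<le> 1} x \<partial>?M)" .
    also have "(\<integral>\<^sup>+x. g x * indicator {x. dotp n u x \<le> 1} x \<partial>?M) = h y"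
      unfolding h_def using r y by (intro nn_integral_cong) (auto simp: ux indicator_def r_def[symmetric] field_simps)
    finally show ?thesis .
  qed
  have "(\<integral>\<^sup>+y. T * indicator (unit_ball n) y \<partial>?M) < (\<integral>\<^sup>+y. w * h y \<partial>?M)"
  \<comment> \<open>Strictness survives integration because \<open>T\<close> is finite and the ball
    has positive measure.\<close>
  proof (rule nn_integral_less)
    have AEB: "AE y in ?M. y \<notin> B0" using B0 by (intro AE_not_in) (auto simp: null_sets_def)
    then show "AE y in ?M. T * indicator (unit_ball n) y \<le> w * h y"
      by eventually_elim (use lt in \<open>auto simp: indicator_def intro: less_imp_le\<close>)
    show "\<not> (AE y in ?M. w * h y \<le> T * indicator (unit_ball n) y)"
    proof
      assume "AE y in ?M. w * h y \<le> T * indicator (unit_ball n) y"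
      with AEB have "AE y in ?M. y \<notin> unit_ball n"
        by eventually_elim (use lt in \<open>force simp: not_le[symmetric]\<close>)
      then have "unit_ball n \<in> null_sets ?M" by (subst AE_iff_null_sets) auto
      then have "emeasure ?M (unit_ball n) = 0" by auto
      with w show False unfolding emeasure_unit_ball w_def by simp
    qed
    show "(\<integral>\<^sup>+y. T * indicator (unit_ball n) y \<partial>?M) \<noteq> \<infinity>"
      using T by (simp add: nn_integral_cmult_indicator emeasure_unit_ball ennreal_mult_eq_top_iff)
  qed measurable
  also have "(\<integral>\<^sup>+y. T * indicator (unit_ball n) y \<partial>?M) = T * w"
    by (simp add: nn_integral_cmult_indicator emeasure_unit_ball w_def)
  also have "(\<integral>\<^sup>+y. w * h y \<partial>?M) = w * T" by (subst nn_integral_cmult) (auto simp: hT)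
  finally show False by (simp add: mult.commute)
qed

text \<open>Derandomization: the directions are chosen one at a time, each so that the expected volume left by
  the remaining random directions does not exceed its average.\<close>

lemma exists_good_directions:
  assumes n: "n \<ge> 1"
  shows "g \<in> borel_measurable (leb {..<n}) \<Longrightarrow> (\<integral>\<^sup>+x. g x \<partial>leb {..<n}) < \<infinity> \<Longrightarrow>
    \<exists>U. finite U \<and> card U \<le> k \<and> (\<forall>u\<in>U. dotp n u u = 1) \<and>
     ennreal (unit_ball_vol n) ^ k * (\<integral>\<^sup>+x. g x * indicator {x. \<forall>u\<in>U. dotp n u x \<le> 1} x \<partial>leb {..<n})
     \<le> (\<integral>\<^sup>+x. g x * uncovered_volume n x ^ k \<partial>leb {..<n})"
proof (induction k arbitrary: g)
  case 0
  show ?case by (intro exI[of _ "{}"]) simp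
next
  case (Suc k)
  note [measurable] = Suc.prems(1)
  let ?M = "leb {..<n}"
  let ?w = "ennreal (unit_ball_vol n)"
  have "(\<integral>\<^sup>+x. g x * uncovered_volume n x ^ k \<partial>?M) \<le> (\<integral>\<^sup>+x. g x * ?w ^ k \<partial>?M)"
    by (intro nn_integral_mono mult_left_mono power_mono uncovered_volume_le) auto
  also have "\<dots> = (\<integral>\<^sup>+x. g x \<partial>?M) * ?w ^ k" by (rule nn_integral_multc) measurable
  also have "\<dots> < \<infinity>" using Suc.prems(2) by (simp add: ennreal_mult_less_top ennreal_power)
  finally have "(\<integral>\<^sup>+x. g x * uncovered_volume n x ^ k \<partial>?M) < \<infinity>" .
  then obtain u where u: "dotp n u u = 1"
    "?w * (\<integral>\<^sup>+x. (g x * uncovered_volume n x ^ k) * indicator {x. dotp n u x \<le> 1} x \<partial>?M)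
       \<le> (\<integral>\<^sup>+x. (g x * uncovered_volume n x ^ k) * uncovered_volume n x \<partial>?M)"
    using exists_good_direction[OF n, of "\<lambda>x. g x * uncovered_volume n x ^ k"] by auto
  \<comment> \<open>The direction \<open>u\<close> was chosen for the weight that already averages
    over the \<open>k\<close> later directions; the induction hypothesis now treats the mass that
    survives \<open>u\<close>.\<close>
  define g' where "g' = (\<lambda>x. g x * indicator {x. dotp n u x \<le> 1} x)"
  have "(\<lambda>x. if dotp n u x \<le> 1 then g x else 0) \<in> borel_measurable ?M" by measurable
  also have "(\<lambda>x. if dotp n u x \<le> 1 then g x else 0) = g'" by (auto simp: g'_def)
  finally have g': "g' \<in> borel_measurable ?M" .
  have "(\<integral>\<^sup>+x. g' x \<partial>?M) \<le> (\<integral>\<^sup>+x. g x \<partial>?M)" by (intro nn_integral_mono) (auto simp: g'_def indicator_def)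
  also have "\<dots> < \<infinity>" by fact
  finally obtain U where U: "finite U" "card U \<le> k" "\<forall>u\<in>U. dotp n u u = 1"
    "?w ^ k * (\<integral>\<^sup>+x. g' x * indicator {x. \<forall>u\<in>U. dotp n u x \<le> 1} x \<partial>?M) \<le> (\<integral>\<^sup>+x. g' x * uncovered_volume n x ^ k \<partial>?M)"
    using Suc.IH[OF g'] by blast
  have "?w ^ Suc k * (\<integral>\<^sup>+x. g x * indicator {x. \<forall>u\<in>insert u U. dotp n u x \<le> 1} x \<partial>?M)
    = ?w * (?w ^ k * (\<integral>\<^sup>+x. g' x * indicator {x. \<forall>u\<in>U. dotp n u x \<le> 1} x \<partial>?M))"
  proof -
    have "(\<integral>\<^sup>+x. g x * indicator {x. \<forall>u\<in>insert u U. dotp n u x \<le> 1} x \<partial>?M)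
      = (\<integral>\<^sup>+x. g' x * indicator {x. \<forall>u\<in>U. dotp n u x \<le> 1} x \<partial>?M)"
      by (intro nn_integral_cong) (auto simp: g'_def indicator_def)
    then show ?thesis by (simp add: mult.assoc)
  qed
  also have "\<dots> \<le> ?w * (\<integral>\<^sup>+x. g' x * uncovered_volume n x ^ k \<partial>?M)"
    by (intro mult_left_mono U(4)) auto
  also have "\<dots> = ?w * (\<integral>\<^sup>+x. (g x * uncovered_volume n x ^ k) * indicator {x. dotp n u x \<le> 1} x \<partial>?M)"
    by (simp add: g'_def mult_ac)
  also have "\<dots> \<le> (\<integral>\<^sup>+x. g x * uncovered_volume n x ^ Suc k \<partial>?M)"
    using u(2) by (simp add: mult_ac)
  finally show ?case using U u(1)
    by (intro exI[of _ "insert u U"]) (auto simp: card_insert_if)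
qed

section \<open>Survival probabilities and radial integrals\<close>

lemma uncovered_volume_le_cone:
  fixes d :: nat
  defines "n \<equiv> Suc d"
  assumes d: "d \<ge> 1" and R: "R > 1" and x: "dotp n x x = R\<^sup>2"
  shows "uncovered_volume n x \<le> ennreal (unit_ball_vol n - unit_ball_vol d * sqrt (R\<^sup>2 - 1) ^ d / (R ^ n * n))"
proof -
  let ?M = "leb {..<n}"
  let ?A = "{y \<in> unit_ball n. dotp n x y \<le> sqrt (dotp n y y)}"
  let ?B = "{y \<in> unit_ball n. sqrt (dotp n y y) < dotp n x y}"
  have A: "?A = unit_ball n \<inter> {y \<in> space ?M. dotp n x y \<le> sqrt (dotp n y y)}"
    and B: "?B = unit_ball n \<inter> {y \<in> space ?M. sqrt (dotp n y y) < dotp n x y}"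
    by (auto simp: unit_ball_def space_leb)
  have m: "?A \<in> sets ?M" "?B \<in> sets ?M" unfolding A B by measurable
  have "emeasure ?M ?A + emeasure ?M ?B = emeasure ?M (?A \<union> ?B)"
    using m by (intro plus_emeasure) auto
  also have "?A \<union> ?B = unit_ball n" by auto
  finally have sum: "uncovered_volume n x + emeasure ?M ?B = ennreal (unit_ball_vol n)"
    by (simp add: emeasure_unit_ball uncovered_volume_def)
  define q where "q = unit_ball_vol d * sqrt (R\<^sup>2 - 1) ^ d / (R ^ n * n)"
  have R1: "R\<^sup>2 > 1" using R by (simp add: one_less_power)
  have q0: "q \<ge> 0" using R R1 by (simp add: q_def)
  have "ennreal q \<le> emeasure ?M {y \<in> space ?M. sqn {..<n} y \<le> 1 \<and> sqrt (sqn {..<n} y) < inp {..<n} x y}"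
    unfolding q_def n_def by (rule cone_volume_ge[OF d R]) (use x in \<open>simp add: sqn_eq_dotp n_def\<close>)
  also have "{y \<in> space ?M. sqn {..<n} y \<le> 1 \<and> sqrt (sqn {..<n} y) < inp {..<n} x y} = ?B"
    by (auto simp: unit_ball_def space_leb sqn_eq_dotp dotp_eq_inp)
  finally have "uncovered_volume n x + ennreal q \<le> ennreal (unit_ball_vol n)"
    unfolding sum[symmetric] by (intro add_mono) auto
  moreover obtain v where v: "uncovered_volume n x = ennreal v" "v \<ge> 0"
    using uncovered_volume_le[of n x] by (cases "uncovered_volume n x") (auto simp: top_unique)
  ultimately have "v + q \<le> unit_ball_vol n" using q0 by (simp add: ennreal_plus[symmetric] del: ennreal_plus)
  then show ?thesis unfolding v q_def[symmetric] by (intro ennreal_leI) simp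
qed

text \<open>Bernoulli's inequality for a real exponent: the derivative of the difference is
  nonnegative beyond 1 as soon as \<open>a \<ge> 1\<close>. It is used with
  \<open>a = d / 2\<close>, whence \<open>d \<ge> 2\<close> in the upper bound.\<close>

lemma powr_ge_affine:
  fixes v a :: real
  assumes "v \<ge> 1" "a \<ge> 1"
  shows "1 + a * (v - 1) \<le> v powr a"
proof -
  have "(\<lambda>v. v powr a - a * (v - 1)) 1 \<le> (\<lambda>v. v powr a - a * (v - 1)) v"
  proof (rule DERIV_nonneg_imp_nondecreasing[OF assms(1)])
    fix x :: real assume x: "1 \<le> x" "x \<le> v"
    have "((\<lambda>v. v powr a - a * (v - 1)) has_real_derivative a * x powr (a - 1) - a) (at x)"
      using x by (auto intro!: derivative_eq_intros)
    moreover have "x powr (a - 1) \<ge> 1" using x assms by (intro ge_one_powr_ge_zero) auto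
    then have "a * x powr (a - 1) - a \<ge> 0" using assms by (simp add: mult_left_le)
    ultimately show "\<exists>y. ((\<lambda>v. v powr a - a * (v - 1)) has_real_derivative y) (at x) \<and> 0 \<le> y" by blast
  qed
  then show ?thesis by simp
qed

text \<open>The exact value is s Gamma(1 + 1/a). After rescaling, the integrand is at most 1 on
  [0, 1], and Bernoulli's inequality leaves a tail of exp(-1) / a beyond 1. With
  \<open>a = d / 2\<close> this is the factor \<open>1 + 2 / d\<close> of the upper bound.\<close>

lemma nn_integral_exp_powr_le:
  assumes a: "a \<ge> 1" and s: "s > 0"
  shows "(\<integral>\<^sup>+r. ennreal (exp (- ((r / s) powr a))) * indicator {0..} r \<partial>lborel) \<le> ennreal (s * (1 + 1 / a))"
proof -
  have m[measurable]: "(\<lambda>r. ennreal (exp (- (r powr a)))) \<in> borel_measurable borel" by measurable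
  have "(\<integral>\<^sup>+r. ennreal (exp (- ((r / s) powr a))) * indicator {0..} r \<partial>lborel)
    = ennreal s * (\<integral>\<^sup>+v. ennreal (exp (- (v powr a))) * indicator {0..} v \<partial>lborel)"
    using s by (subst nn_integral_real_affine[where c=s and t=0])
      (auto intro!: arg_cong2[where f="(*)"] nn_integral_cong simp: indicator_def zero_le_mult_iff)
  also have "(\<integral>\<^sup>+v. ennreal (exp (- (v powr a))) * indicator {0..} v \<partial>lborel)
    \<le> (\<integral>\<^sup>+v. indicator {0..1} v + ennreal (exp (- 1 - a * (v - 1))) * indicator {1..} v \<partial>lborel)"
  proof (rule nn_integral_mono)
    fix v :: real
    show "ennreal (exp (- (v powr a))) * indicator {0..} v
      \<le> indicator {0..1} v + ennreal (exp (- 1 - a * (v - 1))) * indicator {1..} v"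
    proof (cases "v \<ge> 1")
      case True
      then have "ennreal (exp (- (v powr a))) \<le> ennreal (exp (- 1 - a * (v - 1)))"
        using powr_ge_affine[OF True a] by (intro ennreal_leI) simp
      with True show ?thesis by (simp add: add_increasing)
    qed (auto simp: indicator_def)
  qed
  also have "\<dots> = (\<integral>\<^sup>+v. indicator {0..1::real} v \<partial>lborel) + (\<integral>\<^sup>+v. ennreal (exp (- 1 - a * (v - 1))) * indicator {1..} v \<partial>lborel)"
    by (rule nn_integral_add) measurable
  also have "(\<integral>\<^sup>+v. ennreal (exp (- 1 - a * (v - 1))) * indicator {1..} v \<partial>lborel) = ennreal (0 - (- (1 / a) * exp (- 1 - a * (1 - 1))))"
  proof (rule nn_integral_FTC_atLeast[where F = "\<lambda>v. - (1 / a) * exp (- 1 - a * (v - 1))"])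
    show "((\<lambda>v. - (1 / a) * exp (- 1 - a * (v - 1))) has_real_derivative exp (- 1 - a * (v - 1))) (at v)" for v
      using a by (auto intro!: derivative_eq_intros)
    show "((\<lambda>v. - (1 / a) * exp (- 1 - a * (v - 1))) \<longlongrightarrow> 0) at_top"
    proof -
      have "filterlim (\<lambda>v::real. (1 - a) + a * v) at_top at_top"
        using a by (intro filterlim_tendsto_add_at_top[OF tendsto_const]
            filterlim_tendsto_pos_mult_at_top[OF tendsto_const _ filterlim_ident]) auto
      then have "filterlim (\<lambda>v::real. - ((1 - a) + a * v)) at_bot at_top"
        by (simp only: filterlim_uminus_at_bot minus_minus)
      then have "filterlim (\<lambda>v. - 1 - a * (v - 1)) at_bot at_top"
        by (simp add: algebra_simps)
      from filterlim_compose[OF exp_at_bot this] show ?thesis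
        by (intro tendsto_mult_right_zero)
    qed
  qed auto
  also have "\<dots> \<le> ennreal (1 / a)" using a by (intro ennreal_leI) (simp add: divide_right_mono)
  also have "(\<integral>\<^sup>+v. indicator {0..1::real} v \<partial>lborel) = ennreal 1" by simp
  finally show ?thesis using a s by (simp add: ennreal_mult' mult_left_mono)
qed

text \<open>Polar coordinates without a measure on the sphere: the distribution \<open>M1\<close> of
  |x| on the annulus and the measure \<open>M2\<close> of density n omega_n r^d agree on all
  half-lines, hence coincide. The bound r^d <= (1 + \<eta>)^d costs nothing once \<eta> tends to
  0.\<close>

lemma nn_integral_annulus_le:
  fixes d :: nat
  defines "n \<equiv> Suc d"
  assumes eta: "\<eta> > 0" and f[measurable]: "f \<in> borel_measurable borel"
  shows "(\<integral>\<^sup>+x. f (sqrt (dotp n x x) - 1) * indicator {1<..1 + \<eta>} (sqrt (dotp n x x)) \<partial>leb {..<n})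
    \<le> ennreal (n * unit_ball_vol n * (1 + \<eta>) ^ d) * (\<integral>\<^sup>+r. f r * indicator {0..} r \<partial>lborel)"
proof -
  let ?M = "leb {..<n}"
  let ?r = "\<lambda>x. sqrt (dotp n x x)"
  have [measurable]: "?r \<in> borel_measurable ?M" by measurable
  define M1 where "M1 = distr (density ?M (\<lambda>x. indicator {1<..1 + \<eta>} (?r x))) borel ?r"
  define M2 where "M2 = density lborel (\<lambda>r. ennreal (n * unit_ball_vol n * r ^ d) * indicator {1<..1 + \<eta>} r)"
  have ball: "emeasure ?M {x \<in> space ?M. ?r x \<le> t} = ennreal (unit_ball_vol n * t ^ n)" if "t \<ge> 0" for t
  proof -
    have "{x \<in> space ?M. ?r x \<le> t} = {x \<in> space ?M. sqn {..<n} x \<le> t\<^sup>2}"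
      using that by (auto simp: sqn_eq_dotp real_sqrt_le_iff')
    then show ?thesis using emeasure_ball_leb[of "{..<n}" t] that by simp
  qed
  have ann: "emeasure M1 {t<..} = ennreal (unit_ball_vol n * (1 + \<eta>) ^ n - unit_ball_vol n * max 1 (min t (1 + \<eta>)) ^ n)" for t
  proof -
    \<comment> \<open>\<open>t\<close> clamped to the annulus, so that one formula covers every
      half-line.\<close>
    define m where "m = max 1 (min t (1 + \<eta>))"
    have "emeasure M1 {t<..} = (\<integral>\<^sup>+x. indicator {1<..1 + \<eta>} (?r x) * indicator (?r -` {t<..} \<inter> space ?M) x \<partial>?M)"
      unfolding M1_def by (subst emeasure_distr) (auto simp: emeasure_density)
    also have "\<dots> = (\<integral>\<^sup>+x. indicator ({x \<in> space ?M. ?r x \<le> 1 + \<eta>} - {x \<in> space ?M. ?r x \<le> m}) x \<partial>?M)"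
    proof (rule nn_integral_cong)
      fix x assume x: "x \<in> space ?M"
      have "(1 < r \<and> r \<le> 1 + \<eta>) \<and> t < r \<longleftrightarrow> r \<le> 1 + \<eta> \<and> \<not> r \<le> m" for r
        using eta by (auto simp: m_def)
      from this[of "?r x"] x
      show "indicator {1<..1 + \<eta>} (?r x) * indicator (?r -` {t<..} \<inter> space ?M) x
        = (indicator ({x \<in> space ?M. ?r x \<le> 1 + \<eta>} - {x \<in> space ?M. ?r x \<le> m}) x :: ennreal)"
        unfolding indicator_inter_arith[symmetric] indicator_def
        by (auto simp del: real_sqrt_gt_1_iff real_sqrt_le_1_iff)
    qed
    also have "\<dots> = emeasure ?M ({x \<in> space ?M. ?r x \<le> 1 + \<eta>} - {x \<in> space ?M. ?r x \<le> m})"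
      by (rule nn_integral_indicator) measurable
    also have "\<dots> = emeasure ?M {x \<in> space ?M. ?r x \<le> 1 + \<eta>} - emeasure ?M {x \<in> space ?M. ?r x \<le> m}"
      using ball[of m] eta by (intro emeasure_Diff) (auto simp: m_def)
    also have "\<dots> = ennreal (unit_ball_vol n * (1 + \<eta>) ^ n - unit_ball_vol n * m ^ n)"
      using ball[of m] ball[of "1 + \<eta>"] eta by (simp add: m_def ennreal_minus)
    finally show ?thesis by (simp add: m_def)
  qed
  have "M1 = M2"
  proof (rule measure_eqI_lessThan)
    fix t :: real
    show "emeasure M1 {t<..} < \<infinity>" unfolding ann by simp
    define m where "m = max 1 (min t (1 + \<eta>))"
    have m: "1 \<le> m" "m \<le> 1 + \<eta>" using eta by (auto simp: m_def)
    have "emeasure M2 {t<..} = (\<integral>\<^sup>+r. ennreal (n * unit_ball_vol n * r ^ d) * indicator {1<..1 + \<eta>} r * indicator {t<..} r \<partial>lborel)"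
      unfolding M2_def by (subst emeasure_density) auto
    also have "\<dots> = (\<integral>\<^sup>+r. ennreal (n * unit_ball_vol n * r ^ d) * indicator {m..1 + \<eta>} r \<partial>lborel)"
      by (intro nn_integral_cong_AE AE_I[of _ _ "{m}"]) (auto simp: indicator_def m_def split: if_splits)
    also have "\<dots> = ennreal (unit_ball_vol n * (1 + \<eta>) ^ n - unit_ball_vol n * m ^ n)"
    proof (rule nn_integral_FTC_Icc)
      show "((\<lambda>r. unit_ball_vol n * r ^ n) has_real_derivative n * unit_ball_vol n * r ^ d) (at r)" for r
        unfolding n_def by (auto intro!: derivative_eq_intros simp del: power_Suc) 
    qed (use m in auto)
    finally show "emeasure M1 {t<..} = emeasure M2 {t<..}" by (simp add: ann m_def)
  qed (auto simp: M1_def M2_def)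
  have "(\<integral>\<^sup>+x. f (?r x - 1) * indicator {1<..1 + \<eta>} (?r x) \<partial>?M) = (\<integral>\<^sup>+r. f (r - 1) \<partial>M1)"
    unfolding M1_def by (subst nn_integral_distr) (auto simp: nn_integral_density mult.commute)
  also have "\<dots> = (\<integral>\<^sup>+r. (ennreal (n * unit_ball_vol n * r ^ d) * indicator {1<..1 + \<eta>} r) * f (r - 1) \<partial>lborel)"
    unfolding \<open>M1 = M2\<close> M2_def by (subst nn_integral_density) auto
  also have "\<dots> \<le> (\<integral>\<^sup>+r. ennreal (n * unit_ball_vol n * (1 + \<eta>) ^ d) * (f (r - 1) * indicator {0..} (r - 1)) \<partial>lborel)"
  proof (rule nn_integral_mono)
    fix r :: real
    show "(ennreal (n * unit_ball_vol n * r ^ d) * indicator {1<..1 + \<eta>} r) * f (r - 1)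
      \<le> ennreal (n * unit_ball_vol n * (1 + \<eta>) ^ d) * (f (r - 1) * indicator {0..} (r - 1))"
    proof (cases "1 < r \<and> r \<le> 1 + \<eta>")
      case True
      then have "ennreal (n * unit_ball_vol n * r ^ d) \<le> ennreal (n * unit_ball_vol n * (1 + \<eta>) ^ d)"
        by (intro ennreal_leI mult_left_mono power_mono) auto
      with True show ?thesis by (simp add: mult_right_mono)
    qed auto
  qed
  also have "\<dots> = ennreal (n * unit_ball_vol n * (1 + \<eta>) ^ d) * (\<integral>\<^sup>+r. f (r - 1) * indicator {0..} (r - 1) \<partial>lborel)"
    by (rule nn_integral_cmult) measurable
  also have "(\<integral>\<^sup>+r. f (r - 1) * indicator {0..} (r - 1) \<partial>lborel) = (\<integral>\<^sup>+r. f r * indicator {0..} r \<partial>lborel)"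
    by (subst (2) nn_integral_real_affine[where c=1 and t="-1"]) auto
  finally show ?thesis .
qed

text \<open>A point at distance R is cut off by one random direction with probability at least
  \<open>c\<close>. For R <= 1 + \<eta> this is at least
  \<open>\<beta> * (2 * (R - 1)) powr (d / 2)\<close>; elsewhere in the cube, which lies in the ball
  of radius sqrt n, it is at least the constant \<open>p\<close>. The near part gives the main term,
  the far part a term exponentially small in \<open>k\<close>.\<close>

lemma min_volume_diff_upper:
  fixes d :: nat and \<eta> :: real
  defines "n \<equiv> Suc d"
  assumes d: "d \<ge> 2" and eta: "\<eta> > 0" and k: "k \<ge> 1"
  defines "\<beta> \<equiv> unit_ball_vol d / ((1 + \<eta>) ^ n * n * unit_ball_vol n)"
  defines "p \<equiv> unit_ball_vol d * sqrt ((1 + \<eta>)\<^sup>2 - 1) ^ d / (sqrt n ^ n * n * unit_ball_vol n)"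
  shows "min_volume_diff n (unit_ball n) (k + 2 * n)
    \<le> n * unit_ball_vol n * (1 + \<eta>) ^ d * ((k * \<beta>) powr (- 2 / d) / 2 * (1 + 2 / d))
      + unit_ball_vol n * sqrt n ^ n * exp (- (k * p))"
proof -
  let ?M = "leb {..<n}"
  let ?r = "\<lambda>x. sqrt (dotp n x x)"
  define w where "w = unit_ball_vol n"
  have w: "w > 0" by (simp add: w_def)
  have n: "n \<ge> 1" "real n > 0" by (auto simp: n_def)
  have [measurable]: "?r \<in> borel_measurable ?M" by measurable
  define Q where "Q = {x \<in> points n. \<forall>i<n. \<bar>x i\<bar> \<le> 1}"
  have "Q = {x \<in> space ?M. \<forall>i\<in>{..<n}. \<bar>x i\<bar> \<le> 1}" by (auto simp: Q_def space_leb)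
  also have "\<dots> \<in> sets ?M"
  proof (rule sets.sets_Collect_finite_All)
    fix i assume "i \<in> {..<n}"
    then have [measurable]: "(\<lambda>x. x i) \<in> borel_measurable ?M"
      by (rule coordinate_measurable)
    show "{x \<in> space ?M. \<bar>x i\<bar> \<le> 1} \<in> sets ?M" by measurable
  qed simp
  finally have Qm[measurable]: "Q \<in> sets ?M" .
  have Qr: "?r x \<le> sqrt n" if "x \<in> Q" for x
  proof -
    have "dotp n x x \<le> (\<Sum>i<n. 1)" unfolding dotp_def
    proof (rule sum_mono)
      fix i assume "i \<in> {..<n}"
      with that have "\<bar>x i\<bar> \<le> 1" by (auto simp: Q_def)
      then have "(x i)\<^sup>2 \<le> 1" by (simp add: abs_square_le_1)
      then show "x i * x i \<le> 1" by (simp add: power2_eq_square)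
    qed
    then show ?thesis by simp
  qed
  have Qball: "emeasure ?M Q \<le> ennreal (w * sqrt n ^ n)"
  proof -
    have "Q \<subseteq> {x \<in> space ?M. sqn {..<n} x \<le> (sqrt n)\<^sup>2}"
      using Qr by (fastforce simp: Q_def sqn_eq_dotp space_leb)
    then have "emeasure ?M Q \<le> emeasure ?M {x \<in> space ?M. sqn {..<n} x \<le> (sqrt n)\<^sup>2}"
      by (rule emeasure_mono) measurable
    then show ?thesis by (subst (asm) emeasure_ball_leb) (auto simp: w_def)
  qed
  define g where "g = (indicator (Q - unit_ball n) :: _ \<Rightarrow> ennreal)"
  have g[measurable]: "g \<in> borel_measurable ?M" unfolding g_def by measurable
  have "(\<integral>\<^sup>+x. g x \<partial>?M) = emeasure ?M (Q - unit_ball n)" unfolding g_def by simp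
  also have "\<dots> \<le> emeasure ?M Q" by (intro emeasure_mono) auto
  also have "\<dots> < \<infinity>" using Qball by (simp add: order_le_less_trans)
  finally have "(\<integral>\<^sup>+x. g x \<partial>?M) < \<infinity>" .
  from exists_good_directions[OF n(1) g this, of k]
  obtain U where U: "finite U" "card U \<le> k" "\<And>u. u \<in> U \<Longrightarrow> dotp n u u = 1"
    and Uw: "ennreal w ^ k * (\<integral>\<^sup>+x. g x * indicator {x. \<forall>u\<in>U. dotp n u x \<le> 1} x \<partial>?M)
      \<le> (\<integral>\<^sup>+x. g x * uncovered_volume n x ^ k \<partial>?M)"
    unfolding w_def by blast
  define P where "P = {x \<in> points n. (\<forall>i<n. \<bar>x i\<bar> \<le> 1) \<and> (\<forall>u\<in>U. dotp n u x \<le> 1)}"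
  note tp = tangential_polytope[OF n(1) U(1,3), folded P_def]
  have Pm[measurable]: "P \<in> sets ?M" by (rule polytope_sets[OF tp(1)])
  have "(\<integral>\<^sup>+x. g x * indicator {x. \<forall>u\<in>U. dotp n u x \<le> 1} x \<partial>?M) = (\<integral>\<^sup>+x. indicator (P - unit_ball n) x \<partial>?M)"
    by (intro nn_integral_cong) (auto simp: g_def P_def Q_def indicator_def space_leb)
  also have "\<dots> = emeasure ?M (P - unit_ball n)" by simp
  finally have Pg: "(\<integral>\<^sup>+x. g x * indicator {x. \<forall>u\<in>U. dotp n u x \<le> 1} x \<partial>?M) = emeasure ?M (P - unit_ball n)" .
  \<comment> \<open>The distance from the ball at which the lower bound for \<open>k * c\<close>
    equals 1. In this unit the exponent becomes \<open>(r / s) powr (d / 2)\<close>.\<close>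
  define s where "s = (k * \<beta>) powr (- 2 / d) / 2"
  have beta: "\<beta> > 0" using eta n w by (simp add: \<beta>_def w_def)
  have s: "s > 0" using beta k by (simp add: s_def)
  have s2: "k * \<beta> * (2 * r) powr (d / 2) = (r / s) powr (d / 2)" if "r > 0" for r
  proof -
    have "(r / s) powr (d / 2) = (2 * r) powr (d / 2) * ((k * \<beta>) powr (2 / d)) powr (d / 2)"
      using that beta k by (simp add: s_def powr_minus powr_mult[symmetric] field_simps powr_minus_divide)
    also have "((k * \<beta>) powr (2 / d)) powr (d / 2) = k * \<beta>"
      using d beta k by (simp add: powr_powr)
    finally show ?thesis by simp
  qed
  let ?e = "\<lambda>x. ennreal (exp (- (((?r x - 1) / s) powr (d / 2)))) * indicator {1<..1 + \<eta>} (?r x)"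
  define E where "E = (\<lambda>x. ?e x
      + ennreal (exp (- (k * p))) * indicator Q x)"
  have pt: "g x * uncovered_volume n x ^ k \<le> ennreal (w ^ k) * E x" if xs: "x \<in> space ?M" for x
  proof (cases "x \<in> Q - unit_ball n")
    case False
    then show ?thesis by (simp add: g_def)
  next
    case True
    define R where "R = ?r x"
    have x2: "dotp n x x = R\<^sup>2" by (simp add: R_def)
    have "dotp n x x > 1" using True by (auto simp: unit_ball_def Q_def)
    then have R: "R > 1" by (simp add: R_def)
    have Rn: "R \<le> sqrt n" using Qr True by (simp add: R_def)
    have R21: "R\<^sup>2 > 1" using R by (simp add: one_less_power)
    let ?c = "unit_ball_vol d * sqrt (R\<^sup>2 - 1) ^ d / (R ^ n * n)"
    define c where "c = ?c / w"
    \<comment> \<open>From 1 - c <= exp(-c). The maximum with 0 permits taking \<open>k\<close>-th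
      powers without a proof of \<open>c \<le> 1\<close>.\<close>
    have cle: "exp (- (k * c)) \<ge> max 0 (1 - c) ^ k"
    proof -
      have "max 0 (1 - c) \<le> exp (- c)" using exp_ge_add_one_self[of "-c"] by auto
      then have "max 0 (1 - c) ^ k \<le> exp (- c) ^ k" by (intro power_mono) auto
      also have "\<dots> = exp (- (k * c))" by (simp add: exp_of_nat_mult[symmetric])
      finally show ?thesis .
    qed
    have "uncovered_volume n x \<le> ennreal (w - ?c)"
      unfolding n_def w_def by (rule uncovered_volume_le_cone) (use d R x2 in \<open>auto simp: n_def\<close>)
    also have "\<dots> \<le> ennreal (w * max 0 (1 - c))"
    proof (rule ennreal_leI)
      have "w - ?c = w * (1 - c)"
        using w by (simp add: c_def algebra_simps)
      also have "\<dots> \<le> w * max 0 (1 - c)" using w by (intro mult_left_mono) auto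
      finally show "w - ?c \<le> w * max 0 (1 - c)" .
    qed
    finally have "uncovered_volume n x ^ k \<le> ennreal (w * max 0 (1 - c)) ^ k" by (intro power_mono) auto
    also have "\<dots> = ennreal (w ^ k) * ennreal (max 0 (1 - c) ^ k)"
      using w by (simp add: ennreal_power power_mult_distrib ennreal_mult')
    also have "\<dots> \<le> ennreal (w ^ k) * ennreal (exp (- (k * c)))"
      using cle by (intro mult_left_mono ennreal_leI) auto
    also have "\<dots> \<le> ennreal (w ^ k) * E x"
    proof (rule mult_left_mono)
      show "ennreal (exp (- (k * c))) \<le> E x"
      proof (cases "R \<le> 1 + \<eta>")
        case True
        have "R\<^sup>2 - 1 = (R + 1) * (R - 1)" by (simp add: algebra_simps power2_eq_square)
        also have "\<dots> \<ge> 2 * (R - 1)" using R by (intro mult_right_mono) auto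
        finally have "(2 * (R - 1)) powr (d / 2) \<le> (R\<^sup>2 - 1) powr (d / 2)" using R by (intro powr_mono2) auto
        also have "\<dots> = sqrt (R\<^sup>2 - 1) ^ d" using R21 d by (subst sqrt_power_eq_powr) auto
        finally have "unit_ball_vol d * (2 * (R - 1)) powr (d / 2) / ((1 + \<eta>) ^ n * n) / w
            \<le> ?c / w"
          using R True w n R21 by (intro divide_right_mono frac_le mult_left_mono mult_right_mono power_mono) auto
        then have "\<beta> * (2 * (R - 1)) powr (d / 2) \<le> c" by (simp add: \<beta>_def c_def w_def mult_ac)
        then have "k * (\<beta> * (2 * (R - 1)) powr (d / 2)) \<le> k * c" by (intro mult_left_mono) auto
        then have "((R - 1) / s) powr (d / 2) \<le> k * c" using s2[of "R - 1"] R by (simp add: mult.assoc)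
        then have "ennreal (exp (- (k * c))) \<le> ennreal (exp (- (((?r x - 1) / s) powr (d / 2))))"
          by (intro ennreal_leI) (simp add: R_def)
        then show ?thesis using R True unfolding E_def by (simp add: R_def add_increasing2)
      next
        case False
        have "sqrt ((1 + \<eta>)\<^sup>2 - 1) \<le> sqrt (R\<^sup>2 - 1)" using False eta by (intro real_sqrt_le_mono diff_right_mono power_mono) auto
        then have "unit_ball_vol d * sqrt ((1 + \<eta>)\<^sup>2 - 1) ^ d / (sqrt n ^ n * n) / w
            \<le> ?c / w"
          using R Rn w n R21 eta by (intro divide_right_mono frac_le mult_left_mono mult_right_mono power_mono) auto
        then have "p \<le> c" by (simp add: p_def c_def w_def mult_ac)
        then have "ennreal (exp (- (k * c))) \<le> ennreal (exp (- (k * p)))"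
          by (intro ennreal_leI) (simp add: mult_left_mono)
        then show ?thesis using \<open>x \<in> Q - unit_ball n\<close> unfolding E_def by (simp add: add_increasing)
      qed
    qed auto
    finally show ?thesis using True by (simp add: g_def)
  qed
  have "ennreal (w ^ k) * emeasure ?M (P - unit_ball n) \<le> (\<integral>\<^sup>+x. ennreal (w ^ k) * E x \<partial>?M)"
    using Uw Pg w by (intro order_trans[OF _ nn_integral_mono[OF pt]]) (auto simp: ennreal_power)
  also have "\<dots> = ennreal (w ^ k) * (\<integral>\<^sup>+x. E x \<partial>?M)"
    unfolding E_def by (rule nn_integral_cmult) measurable
  finally have "emeasure ?M (P - unit_ball n) \<le> (\<integral>\<^sup>+x. E x \<partial>?M)"
    using w by (subst (asm) ennreal_mult_le_mult_iff) auto
  also have "\<dots> = (\<integral>\<^sup>+x. ?e x \<partial>?M)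
     + (\<integral>\<^sup>+x. ennreal (exp (- (k * p))) * indicator Q x \<partial>?M)"
    unfolding E_def by (rule nn_integral_add) measurable
  also have "\<dots> \<le> ennreal (n * w * (1 + \<eta>) ^ d * (s * (1 + 2 / d))) + ennreal (w * sqrt n ^ n * exp (- (k * p)))"
  proof (rule add_mono)
    have "(\<integral>\<^sup>+x. ?e x \<partial>?M)
      \<le> ennreal (n * w * (1 + \<eta>) ^ d) * (\<integral>\<^sup>+r. ennreal (exp (- ((r / s) powr (d / 2)))) * indicator {0..} r \<partial>lborel)"
      unfolding n_def w_def by (rule nn_integral_annulus_le[OF eta, of "\<lambda>r. ennreal (exp (- ((r / s) powr (d / 2))))"]) measurable
    also have "\<dots> \<le> ennreal (n * w * (1 + \<eta>) ^ d) * ennreal (s * (1 + 1 / (d / 2)))"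
      using d s by (intro mult_left_mono nn_integral_exp_powr_le) auto
    also have "\<dots> = ennreal (n * w * (1 + \<eta>) ^ d * (s * (1 + 2 / d)))"
      using s w eta by (simp add: ennreal_mult'[symmetric])
    finally show "(\<integral>\<^sup>+x. ?e x \<partial>?M)
      \<le> ennreal (n * w * (1 + \<eta>) ^ d * (s * (1 + 2 / d)))" .
    have "(\<integral>\<^sup>+x. ennreal (exp (- (k * p))) * indicator Q x \<partial>?M) = ennreal (exp (- (k * p))) * emeasure ?M Q"
      by (rule nn_integral_cmult_indicator) measurable
    also have "\<dots> \<le> ennreal (exp (- (k * p))) * ennreal (w * sqrt n ^ n)" by (intro mult_left_mono Qball) auto
    also have "\<dots> = ennreal (w * sqrt n ^ n * exp (- (k * p)))" by (simp add: ennreal_mult'[symmetric] mult.commute)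
    finally show "(\<integral>\<^sup>+x. ennreal (exp (- (k * p))) * indicator Q x \<partial>?M) \<le> ennreal (w * sqrt n ^ n * exp (- (k * p)))" .
  qed
  also have "\<dots> = ennreal (n * w * (1 + \<eta>) ^ d * (s * (1 + 2 / d)) + w * sqrt n ^ n * exp (- (k * p)))"
    using s w eta by (intro ennreal_plus[symmetric]) auto
  finally have "measure ?M (P - unit_ball n) \<le> n * w * (1 + \<eta>) ^ d * (s * (1 + 2 / d)) + w * sqrt n ^ n * exp (- (k * p))"
    using s w eta by (simp add: measure_def enn2real_leI)
  moreover have fc: "card (facets n P) \<le> card U + 2 * n" by (rule tp(4))
  have "card (facets n P) \<le> k + 2 * n" using fc U(2) by linarith
  from min_volume_diff_le[OF tp(1-3) this]
  have "min_volume_diff n (unit_ball n) (k + 2 * n) \<le> measure ?M (P - unit_ball n)" .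
  ultimately show ?thesis by (simp add: w_def s_def)
qed

section \<open>Limits\<close>

text \<open>Put s = l N^(-2/d) and let N grow. The limiting bound S l - w (2 l)^(d/2) l / (d/2 + 1)
  is largest where its derivative S - w (2 l)^(d/2) vanishes, which determines \<open>l\<close>. The
  fraction d / (d + 2) is what remains of 1 - 1 / (d/2 + 1).\<close>

lemma min_volume_limit_ge:
  fixes d :: nat and L :: real
  defines "n \<equiv> Suc d"
  assumes d: "d \<ge> 1"
    and lim: "(\<lambda>N. real N powr (2 / d) * min_volume_diff n (unit_ball n) N) \<longlonglongrightarrow> L"
  shows "L \<ge> (n * unit_ball_vol n) powr (1 + 2 / d) / 2 * unit_ball_vol d powr (- 2 / d) * (d / (d + 2))"
proof -
  define S where "S = n * unit_ball_vol n"
  define w where "w = unit_ball_vol d"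
  have S: "S > 0" by (simp add: S_def n_def)
  have w: "w > 0" by (simp add: w_def)
  define l where "l = (S / w) powr (2 / d) / 2"
  have l: "l > 0" using S w by (simp add: l_def)
  have l2: "w * (2 * l) powr (d / 2) = S" using S w d by (simp add: l_def powr_powr)
  define f where "f = (\<lambda>N. S * l - w * (2 * (1 + l * real N powr (- 2 / d))) powr (d / 2) * (l powr (d / 2 + 1) / (d / 2 + 1)))"
  have "f \<longlonglongrightarrow> S * l - w * (2 * (1 + l * 0)) powr (d / 2) * (l powr (d / 2 + 1) / (d / 2 + 1))"
    unfolding f_def using d by (intro tendsto_intros tendsto_neg_powr filterlim_real_sequentially) auto
  moreover have "eventually (\<lambda>N. f N \<le> real N powr (2 / d) * min_volume_diff n (unit_ball n) N) sequentially"
    using eventually_ge_at_top[of "2 * n"]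
  proof eventually_elim
    case (elim N)
    then have N: "N > 0" by (simp add: n_def)
    define s where "s = l * real N powr (- 2 / d)"
    have s: "s > 0" using l N by (simp add: s_def)
    have Ns: "real N powr (2 / d) * s = l" using N by (simp add: s_def powr_add[symmetric])
    have "s powr (d / 2 + 1) = l powr (d / 2 + 1) * real N powr (- 2 / d * (d / 2 + 1))"
      using l N by (simp add: s_def powr_mult powr_powr)
    also have "- 2 / d * (d / 2 + 1) = - 1 - 2 / d" using d by (simp add: field_simps)
    finally have "real N powr (2 / d) * N * s powr (d / 2 + 1)
        = l powr (d / 2 + 1) * (real N powr (2 / d) * real N powr 1 * real N powr (- 1 - 2 / d))"
      using N by simp
    also have "real N powr (2 / d) * real N powr 1 * real N powr (- 1 - 2 / d) = 1"
      using N unfolding powr_add[symmetric] by simp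
    finally have Nsp: "real N powr (2 / d) * N * s powr (d / 2 + 1) = l powr (d / 2 + 1)" by simp
    have "f N = S * (real N powr (2 / d) * s) - w * (2 * (1 + s)) powr (d / 2) * ((real N powr (2 / d) * N * s powr (d / 2 + 1)) / (d / 2 + 1))"
      unfolding Ns Nsp by (simp add: f_def s_def)
    also have "\<dots> = real N powr (2 / d) * (unit_ball_vol n * (n * s) - N * (w * (2 * (1 + s)) powr (d / 2) * (s powr (d / 2 + 1) / (d / 2 + 1))))"
      by (simp add: S_def algebra_simps)
    also have "\<dots> \<le> real N powr (2 / d) * (unit_ball_vol n * ((1 + s) ^ n - 1) - N * (w * (2 * (1 + s)) powr (d / 2) * (s powr (d / 2 + 1) / (d / 2 + 1))))"
      using Bernoulli_inequality[of s n] s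
      by (intro mult_left_mono diff_right_mono) auto
    also have "\<dots> \<le> real N powr (2 / d) * min_volume_diff n (unit_ball n) N"
      using min_volume_diff_ge[OF d s, of N] elim by (intro mult_left_mono) (auto simp: n_def w_def)
    finally show ?case .
  qed
  ultimately have "S * l - w * (2 * (1 + l * 0)) powr (d / 2) * (l powr (d / 2 + 1) / (d / 2 + 1)) \<le> L"
    using lim by (intro tendsto_le[OF sequentially_bot]) auto
  also have "w * (2 * (1 + l * 0)) powr (d / 2) * (l powr (d / 2 + 1) / (d / 2 + 1)) = (w * (2 * l) powr (d / 2)) * l / (d / 2 + 1)"
    using l by (simp add: powr_add powr_mult)
  also have "S * l - \<dots> = S * l * (d / (d + 2))" unfolding l2 by (simp add: field_simps)
  also have "S * l = S powr (1 + 2 / d) / 2 * w powr (- 2 / d)"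
    using S w by (simp add: l_def powr_divide powr_add powr_minus_divide)
  finally show ?thesis by (simp add: S_def w_def)
qed

text \<open>The order of the limits matters: for fixed \<eta> the number of facets k + 2 n tends to
  infinity and the far part vanishes; only afterwards does \<eta> tend to 0, which removes the
  powers of 1 + \<eta>.\<close>

lemma min_volume_limit_le:
  fixes d :: nat and L :: real
  defines "n \<equiv> Suc d"
  assumes d: "d \<ge> 2"
    and lim: "(\<lambda>N. real N powr (2 / d) * min_volume_diff n (unit_ball n) N) \<longlonglongrightarrow> L"
  shows "L \<le> (n * unit_ball_vol n) powr (1 + 2 / d) / 2 * unit_ball_vol d powr (- 2 / d) * (1 + 2 / d)"
proof -
  define S where "S = n * unit_ball_vol n"
  define w where "w = unit_ball_vol d"
  have S: "S > 0" by (simp add: S_def n_def)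
  have w: "w > 0" by (simp add: w_def)
  have n: "n \<ge> 1" by (simp add: n_def)
  have le: "L \<le> S * (1 + \<eta>) ^ d * ((w / ((1 + \<eta>) ^ n * S)) powr (- 2 / d) / 2 * (1 + 2 / d))" if eta: "\<eta> > 0" for \<eta> :: real
  proof -
    define b where "b = w / ((1 + \<eta>) ^ n * S)"
    have b: "b > 0" using w S eta by (simp add: b_def)
    define p where "p = w * sqrt ((1 + \<eta>)\<^sup>2 - 1) ^ d / (sqrt n ^ n * S)"
    have "(1 + \<eta>)\<^sup>2 > 1" using eta by (simp add: one_less_power)
    then have p: "p > 0" using w S n by (simp add: p_def)
    define A where "A = S * (1 + \<eta>) ^ d * (b powr (- 2 / d) / 2 * (1 + 2 / d))"
    define B where "B = unit_ball_vol n * sqrt n ^ n"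
    define c where "c = 2 / real d"
    have c: "0 < c" "c \<le> 1" using d by (auto simp: c_def)
    define m where "m = 2 * real n"
    have m: "m > 0" using n by (simp add: m_def)
    have l1: "(\<lambda>k::nat. (real k + m) powr c * (A * real k powr (- c) + B * exp (- (real k * p)))) \<longlonglongrightarrow> A"
      using c m p by real_asymp
    have l2: "(\<lambda>k. real (k + 2 * n) powr (2 / d) * min_volume_diff n (unit_ball n) (k + 2 * n)) \<longlonglongrightarrow> L"
      by (rule LIMSEQ_ignore_initial_segment[OF lim])
    have "eventually (\<lambda>k. real (k + 2 * n) powr (2 / d) * min_volume_diff n (unit_ball n) (k + 2 * n)
        \<le> (real k + m) powr c * (A * real k powr (- c) + B * exp (- (real k * p)))) sequentially"
      using eventually_ge_at_top[of 1]
    proof eventually_elim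
      case (elim k)
      have "(k * b) powr (- 2 / d) = b powr (- 2 / d) * real k powr (- c)"
        using b by (simp add: c_def powr_mult mult.commute)
      moreover have "b = unit_ball_vol d / ((1 + \<eta>) ^ n * n * unit_ball_vol n)"
        "p = unit_ball_vol d * sqrt ((1 + \<eta>)\<^sup>2 - 1) ^ d / (sqrt n ^ n * n * unit_ball_vol n)"
        by (simp_all add: b_def p_def S_def w_def mult.assoc)
      ultimately have "min_volume_diff n (unit_ball n) (k + 2 * n) \<le> A * real k powr (- c) + B * exp (- (real k * p))"
        using min_volume_diff_upper[OF d eta elim] unfolding A_def B_def n_def[symmetric]
        by (simp add: S_def mult_ac)
      then show ?case by (auto simp: m_def c_def intro!: mult_left_mono)
    qed
    then have "L \<le> A" by (rule tendsto_le[OF sequentially_bot l1 l2])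
    then show ?thesis by (simp add: A_def b_def)
  qed
  have "((\<lambda>\<eta>. S * (1 + \<eta>) ^ d * ((w / ((1 + \<eta>) ^ n * S)) powr (- 2 / d) / 2 * (1 + 2 / d)))
     \<longlongrightarrow> S * (1 + 0) ^ d * ((w / ((1 + 0) ^ n * S)) powr (- 2 / d) / 2 * (1 + 2 / d))) (at_right 0)"
    using S w by (intro tendsto_intros) auto
  moreover have "eventually (\<lambda>\<eta>::real. \<eta> > 0) (at_right 0)" by (simp add: eventually_at_right_less)
  then have "eventually (\<lambda>\<eta>. L \<le> S * (1 + \<eta>) ^ d * ((w / ((1 + \<eta>) ^ n * S)) powr (- 2 / d) / 2 * (1 + 2 / d))) (at_right 0)"
    by eventually_elim (rule le)
  ultimately have "L \<le> S * (1 + 0) ^ d * ((w / ((1 + 0) ^ n * S)) powr (- 2 / d) / 2 * (1 + 2 / d))"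
    by (rule tendsto_lowerbound) simp
  also have "\<dots> = S powr (1 + 2 / d) / 2 * w powr (- 2 / d) * (1 + 2 / d)"
    using S w by (simp add: powr_divide powr_add powr_minus_divide mult_ac)
  finally show ?thesis by (simp add: S_def w_def)
qed

section \<open>Stirling bounds\<close>

text \<open>The deviation of ln Gamma(x + 1) from Stirling's main term (x + 1/2) ln x - x. Its limit
  is ln(sqrt(2 pi)); only boundedness along multiples of 1/2 enters.\<close>

definition stirling_error :: "real \<Rightarrow> real" where
  "stirling_error x = ln (Gamma (x + 1)) - (x + 1 / 2) * ln x + x"

lemma stirling_error_diff:
  assumes "x > 0"
  shows "stirling_error x - stirling_error (x + 1) = (x + 1 / 2) * (ln (x + 1) - ln x) - 1"
proof -
  have "Gamma (x + 1 + 1) = (x + 1) * Gamma (x + 1)"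
    by (rule Gamma_plus1) (use assms in auto)
  then have "ln (Gamma (x + 1 + 1)) = ln (x + 1) + ln (Gamma (x + 1))"
    using assms Gamma_real_pos[of "x + 1"] by (subst ln_mult_pos[symmetric]) auto
  then show ?thesis by (simp add: stirling_error_def algebra_simps)
qed

text \<open>The decrement is (x + 1/2)(ln(x + 1) - ln x) - 1. For the integral of 1/t over
  [x, x + 1], the midpoint rule bounds it below by 0 and the trapezoidal rule bounds it above by
  1/(4 x) - 1/(4 (x + 1)), which telescopes.\<close>

lemma stirling_error_step:
  assumes x: "x > 0"
  shows "stirling_error (x + 1) \<le> stirling_error x"
    and "stirling_error x - 1 / (4 * x) \<le> stirling_error (x + 1) - 1 / (4 * (x + 1))"
proof -
  have "2 / (2 * x + 1) \<le> ln (x + 1) - ln x" using ln_inverse_approx_ge[of x "x + 1"] x by (simp add: add.commute)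
  then have "(x + 1 / 2) * (2 / (2 * x + 1)) \<le> (x + 1 / 2) * (ln (x + 1) - ln x)"
    using x by (intro mult_left_mono) auto
  also have "(x + 1 / 2) * (2 / (2 * x + 1)) = 1" using x by (simp add: field_simps)
  finally show "stirling_error (x + 1) \<le> stirling_error x" using stirling_error_diff[OF x] by simp
  have "ln (x + 1) - ln x \<le> (1 / x + 1 / (x + 1)) / 2" using ln_inverse_approx_le[of x 1] x by (simp add: field_simps)
  then have "(x + 1 / 2) * (ln (x + 1) - ln x) \<le> (x + 1 / 2) * ((1 / x + 1 / (x + 1)) / 2)"
    using x by (intro mult_left_mono) auto
  also have "\<dots> = 1 + (1 / (4 * x) - 1 / (4 * (x + 1)))"
    using x by (simp add: divide_simps) (simp add: algebra_simps)
  finally show "stirling_error x - 1 / (4 * x) \<le> stirling_error (x + 1) - 1 / (4 * (x + 1))"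
    using stirling_error_diff[OF x] by simp
qed

lemma stirling_error_bounds:
  assumes "x > 0"
  shows "stirling_error (x + real k) \<le> stirling_error x"
    "stirling_error x - 1 / (4 * x) \<le> stirling_error (x + real k) - 1 / (4 * (x + real k))"
proof (induction k)
  case (Suc k)
  have "x + real k > 0" "x + real (Suc k) = (x + real k) + 1" using assms by auto
  with Suc stirling_error_step[of "x + real k"]
  show "stirling_error (x + real (Suc k)) \<le> stirling_error x"
    "stirling_error x - 1 / (4 * x) \<le> stirling_error (x + real (Suc k)) - 1 / (4 * (x + real (Suc k)))"
    by (metis order_trans)+
qed simp_all

text \<open>Steps of length 1 reach d/2 from 1 or from 1/2, according to the parity of
  \<open>d\<close>.\<close>

lemma stirling_error_half_bounded:
  "\<exists>K. \<forall>d::nat. d \<ge> (1::nat) \<longrightarrow> \<bar>stirling_error (real d / 2)\<bar> \<le> K"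
proof (intro exI allI impI)
  fix d :: nat assume d: "d \<ge> 1"
  have *: "\<bar>stirling_error (x + real k)\<bar> \<le> \<bar>stirling_error x\<bar> + 1" if "x \<ge> 1 / 2" for x and k :: nat
  proof -
    have "0 \<le> 1 / (4 * (x + real k))" "1 / (4 * x) \<le> 1" using that by (auto simp: field_simps)
    with stirling_error_bounds[of x k] that show ?thesis by linarith
  qed
  show "\<bar>stirling_error (d / 2)\<bar> \<le> \<bar>stirling_error (1 / 2)\<bar> + \<bar>stirling_error 1\<bar> + 1"
  proof (cases "even d")
    case True
    then obtain k where "d = 2 * k" by (elim evenE)
    with d obtain m where "k = Suc m" by (cases k) auto
    with \<open>d = 2 * k\<close> have "d / 2 = 1 + real m" by simp
    then have "stirling_error (d / 2) = stirling_error (1 + real m)" by (rule arg_cong)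
    then show ?thesis using *[of 1 m] by simp
  next
    case False
    then obtain k where "d = 2 * k + 1" by (elim oddE)
    then have "d / 2 = 1 / 2 + real k" by (simp add: field_simps)
    then have "stirling_error (d / 2) = stirling_error (1 / 2 + real k)" by (rule arg_cong)
    then show ?thesis using *[of "1 / 2" k] by simp
  qed
qed

text \<open>By Stirling the power is d e^v / (2 pi e) with d v = ln d + O(1). As d v^2 tends to 0, d
  e^v = d + d v + O(1).\<close>

lemma unit_ball_vol_powr_asymp:
  "\<exists>C. \<forall>d::nat. d \<ge> (1::nat) \<longrightarrow> \<bar>unit_ball_vol d powr (- 2 / d) - (d + ln d) / (2 * pi * exp 1)\<bar> \<le> C"
proof -
  obtain K where K: "\<And>d::nat. (1::nat) \<le> d \<Longrightarrow> \<bar>stirling_error (real d / 2)\<bar> \<le> K"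
    using stirling_error_half_bounded by blast
  \<comment> \<open>Dominates |2 e - ln 2| below, because ln 2 < 1; then (ln d + c) / d is an upper
    bound for \<open>v\<close>, and the next limit bounds the resulting excess uniformly in
    \<open>d\<close>.\<close>
  define c where "c = 2 * \<bar>K\<bar> + 1"
  have "(\<lambda>d::nat. real d * exp ((ln d + c) / d) - d - ln d) \<longlonglongrightarrow> c" by real_asymp
  then have "Bseq (\<lambda>d::nat. real d * exp ((ln d + c) / d) - d - ln d)"
    by (intro convergent_imp_Bseq) (auto simp: convergent_def)
  then obtain B where B: "\<And>d::nat. \<bar>real d * exp ((ln d + c) / d) - d - ln d\<bar> \<le> B"
    by (auto simp: Bseq_def)
  have "\<bar>unit_ball_vol d powr (- 2 / d) - (d + ln d) / (2 * pi * exp 1)\<bar> \<le> (\<bar>B\<bar> + c) / (2 * pi * exp 1)"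
    if d: "d \<ge> (1::nat)" for d
  proof -
    define e where "e = stirling_error (d / 2)"
    define v where "v = (2 * e + ln (d / 2)) / d"
    have G: "Gamma (d / 2 + 1) > 0" by (intro Gamma_real_pos) auto
    have "ln (unit_ball_vol d) = (d / 2) * ln pi - ln (Gamma (d / 2 + 1))"
      using G by (simp add: unit_ball_vol_def ln_divide_pos ln_powr)
    also have "ln (Gamma (d / 2 + 1)) = e + (d / 2 + 1 / 2) * ln (d / 2) - d / 2"
      by (simp add: e_def stirling_error_def)
    finally have "- 2 / d * ln (unit_ball_vol d) = v + ln (d / 2) - ln pi - 1"
      using d by (simp add: v_def field_simps)
    then have "unit_ball_vol d powr (- 2 / d) = exp (v + ln (d / 2) - ln pi - 1)"
      by (simp add: powr_def less_imp_neq[OF unit_ball_vol_pos, symmetric])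
    also have "\<dots> = (d * exp v) / (2 * pi * exp 1)"
      using d by (simp add: exp_add exp_diff)
    finally have X: "unit_ball_vol d powr (- 2 / d) = (d * exp v) / (2 * pi * exp 1)" .
    have ec: "\<bar>2 * e - ln 2\<bar> \<le> c" using K[OF d] ln_2_less_1 ln_gt_zero[of 2] unfolding e_def c_def by linarith
    have dv: "d * v = ln d + (2 * e - ln 2)" using d by (simp add: v_def ln_div)
    have "d * (1 + v) \<le> d * exp v" by (intro mult_left_mono exp_ge_add_one_self) auto
    then have lo: "d + ln d - c \<le> d * exp v" using dv ec by (simp add: algebra_simps)
    have "v \<le> (ln d + c) / d" using dv ec d by (simp add: field_simps)
    then have "d * exp v \<le> d * exp ((ln d + c) / d)" by (intro mult_left_mono) auto
    then have hi: "d * exp v \<le> d + ln d + \<bar>B\<bar>" using B[of d] by linarith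
    have "\<bar>d * exp v - (d + ln d)\<bar> \<le> \<bar>B\<bar> + c" using lo hi abs_ge_zero[of B] abs_ge_zero[of K] unfolding c_def abs_le_iff by linarith
    then have "\<bar>(d * exp v - (d + ln d)) / (2 * pi * exp 1)\<bar> \<le> (\<bar>B\<bar> + c) / (2 * pi * exp 1)"
      unfolding abs_divide by (intro frac_le) auto
    then show ?thesis unfolding X by (simp add: diff_divide_distrib)
  qed
  then show ?thesis by blast
qed

section \<open>Geometry of the unit ball\<close>

lemma continuous_map_coordinate: "i \<in> I \<Longrightarrow> continuous_map (euclid I) euclideanreal (\<lambda>x. x i)"
  using continuous_map_product_projection[of i I "\<lambda>_. euclideanreal"] by simp

lemma continuous_map_dotp_self: "continuous_map (euclid {..<n}) euclideanreal (\<lambda>x. dotp n x x)"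
  unfolding dotp_def
  by (intro continuous_map_sum continuous_map_real_mult continuous_map_coordinate) auto

lemma open_ball_openin: "openin (euclid {..<n}) {x \<in> points n. dotp n x x < 1}"
  using openin_continuous_map_preimage[OF continuous_map_dotp_self[of n], of "{..<1}"]
  by simp

lemma unit_ball_closedin: "closedin (euclid {..<n}) (unit_ball n)"
  using closedin_continuous_map_preimage[OF continuous_map_dotp_self[of n], of "{..1}"]
  by (simp add: unit_ball_def)

lemma coordinate_le_one:
  assumes "dotp n x x \<le> 1" "i < n"
  shows "\<bar>x i\<bar> \<le> 1"
proof -
  have "x i * x i \<le> dotp n x x"
    unfolding dotp_def using assms(2) by (intro member_le_sum) auto
  then have "(x i)\<^sup>2 \<le> 1" using assms(1) by (simp add: power2_eq_square)
  then show ?thesis by (simp add: abs_square_le_1)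
qed

lemma unit_ball_compactin: "compactin (euclid {..<n}) (unit_ball n)"
proof (rule closed_compactin[OF _ _ unit_ball_closedin])
  show "compactin (euclid {..<n}) (Pi\<^sub>E {..<n} (\<lambda>_. {-1..1}))"
    by (simp add: compactin_PiE)
  show "unit_ball n \<subseteq> Pi\<^sub>E {..<n} (\<lambda>_. {-1..1})"
    using coordinate_le_one by (force simp: unit_ball_def PiE_def Pi_def abs_le_iff)
qed

lemma continuous_map_line:
  assumes "continuous_on UNIV f" "continuous_on UNIV g"
  shows "continuous_map euclideanreal (euclid I) (\<lambda>t. \<lambda>i\<in>I. f t * x i + g t * y i)"
  unfolding continuous_map_componentwise
proof (intro conjI ballI)
  fix k assume "k \<in> I"
  then show "continuous_map euclideanreal euclideanreal (\<lambda>t. (\<lambda>i\<in>I. f t * x i + g t * y i) k)"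
    using assms by (auto intro!: continuous_intros)
qed (auto simp: extensional_def)

lemma interior_of_unit_ball: "euclid {..<n} interior_of unit_ball n = {x \<in> points n. dotp n x x < 1}"
proof
  show "{x \<in> points n. dotp n x x < 1} \<subseteq> euclid {..<n} interior_of unit_ball n"
    by (rule interior_of_maximal[OF _ open_ball_openin], rule subsetI) (simp add: unit_ball_def)
  show "euclid {..<n} interior_of unit_ball n \<subseteq> {x \<in> points n. dotp n x x < 1}"
  proof
    fix x assume "x \<in> euclid {..<n} interior_of unit_ball n"
    then obtain T where T: "openin (euclid {..<n}) T" "x \<in> T" "T \<subseteq> unit_ball n"
      by (auto simp: interior_of_def)
    have x: "x \<in> points n" "dotp n x x \<le> 1" using T by (auto simp: unit_ball_def)
    \<comment> \<open>The ray through \<open>x\<close>, with a zero term to fit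
      \<open>continuous_map_line\<close>. A neighbourhood of \<open>x\<close> contains points
      slightly further out, so a point of norm 1 cannot be interior.\<close>
    define c where "c = (\<lambda>t. \<lambda>i\<in>{..<n}. t * x i + 0 * x i)"
    have cont: "continuous_map euclideanreal (euclid {..<n}) c"
      unfolding c_def by (intro continuous_map_line continuous_intros)
    have "openin euclideanreal {t \<in> topspace euclideanreal. c t \<in> T}"
      by (rule openin_continuous_map_preimage[OF cont T(1)])
    then have op: "open {t. c t \<in> T}" by simp
    have "c 1 = x" using PiE_restrict[OF x(1)] by (simp add: c_def)
    then have "1 \<in> {t. c t \<in> T}" using T(2) by simp
    then obtain e where e: "e > 0" "ball 1 e \<subseteq> {t. c t \<in> T}" using op open_contains_ball by blast
    define t where "t = 1 + e / 2"
    have "t \<in> ball 1 e" using e(1) by (simp add: t_def dist_real_def)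
    then have "c t \<in> unit_ball n" using e(2) T(3) by blast
    then have "dotp n (c t) (c t) \<le> 1" by (simp add: unit_ball_def)
    moreover have "dotp n (c t) (c t) = t\<^sup>2 * dotp n x x"
      by (simp add: c_def dotp_def sum_distrib_left power2_eq_square mult_ac)
    moreover have "t\<^sup>2 > 1" using e(1) by (simp add: t_def one_less_power)
    ultimately have "dotp n x x \<noteq> 1" by auto
    then show "x \<in> {x \<in> points n. dotp n x x < 1}" using x by simp
  qed
qed

lemma bdry_unit_ball: "bdry n (unit_ball n) = {x \<in> points n. dotp n x x = 1}"
  unfolding frontier_of_def interior_of_unit_ball closure_of_closedin[OF unit_ball_closedin]
  by (rule set_eqI) (simp add: unit_ball_def, linarith)

lemma convex_body_unit_ball: "convex_body n (unit_ball n)"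
  unfolding convex_body_def
proof (intro conjI ballI)
  show "compactin (euclid {..<n}) (unit_ball n)" by (rule unit_ball_compactin)
  have "(\<lambda>i\<in>{..<n}. 0) \<in> {x \<in> points n. dotp n x x < 1}" by (simp add: dotp_def)
  then show "euclid {..<n} interior_of unit_ball n \<noteq> {}" unfolding interior_of_unit_ball by blast
  fix x y :: "nat \<Rightarrow> real" and t :: real
  assume x: "x \<in> unit_ball n" and y: "y \<in> unit_ball n" and t: "t \<in> {0..1}"
  let ?z = "\<lambda>i\<in>{..<n}. (1 - t) * x i + t * y i"
  have "dotp n ?z ?z = (1 - t)\<^sup>2 * dotp n x x + 2 * t * (1 - t) * dotp n x y + t\<^sup>2 * dotp n y y"
    by (simp add: dotp_def sum_distrib_left power2_eq_square algebra_simps sum.distrib sum_subtractf)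
  also have "\<dots> \<le> (1 - t)\<^sup>2 * 1 + 2 * t * (1 - t) * 1 + t\<^sup>2 * 1"
    using x y t by (intro add_mono mult_left_mono dotp_le_one[of n x y]) (auto simp: unit_ball_def)
  also have "\<dots> = 1" by (simp add: power2_eq_square algebra_simps)
  finally show "?z \<in> unit_ball n" by (simp add: unit_ball_def)
qed

lemma has_deriv_dotp_self:
  assumes "i < n"
  shows "((\<lambda>t. dotp n (x(i := t)) (x(i := t)) - 1) has_field_derivative 2 * x i) (at (x i))"
proof -
  have "dotp n (x(i := t)) (x(i := t)) = t * t + (\<Sum>j\<in>{..<n} - {i}. x j * x j)" for t
    unfolding dotp_def using assms by (subst sum.remove[of _ i]) (auto intro!: sum.cong)
  then show ?thesis by (auto intro!: derivative_eq_intros)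
qed

lemma partial_dotp_self:
  assumes "i < n"
  shows "partial i (\<lambda>x. dotp n x x - 1) = (\<lambda>x. 2 * x i)"
  using DERIV_imp_deriv[OF has_deriv_dotp_self[OF assms]] by (simp add: partial_def fun_eq_iff)

lemma has_deriv_coordinate:
  "((\<lambda>t. 2 * (x(j := t)) i) has_field_derivative (if i = j then 2 else 0 :: real)) (at (x j))"
  by (auto intro!: derivative_eq_intros)

lemma C2_boundary_unit_ball: "C2_boundary n (unit_ball n)"
  unfolding C2_boundary_def
proof
  fix p assume p: "p \<in> bdry n (unit_ball n)"
  \<comment> \<open>The origin is left out because the gradient 2 x of \<open>g\<close> vanishes
    there.\<close>
  define U where "U = {x \<in> points n. dotp n x x > 0}"
  define g where "g = (\<lambda>x. dotp n x x - 1)"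
  have "openin (euclid {..<n}) {x \<in> topspace (euclid {..<n}). dotp n x x \<in> {0<..}}"
    by (rule openin_continuous_map_preimage[OF continuous_map_dotp_self]) simp
  then have U: "openin (euclid {..<n}) U" by (simp add: U_def)
  have "partial j (\<lambda>x. 2 * x i) = (\<lambda>x. if i = j then 2 else 0)" for i j
    using DERIV_imp_deriv[OF has_deriv_coordinate] by (simp add: partial_def fun_eq_iff)
  moreover have "continuous_map (subtopology (euclid {..<n}) U) euclideanreal g"
    unfolding g_def
    by (intro continuous_map_from_subtopology continuous_map_diff continuous_map_dotp_self) auto
  moreover have "continuous_map (subtopology (euclid {..<n}) U) euclideanreal (\<lambda>x. 2 * x i)" if "i < n" for i
    using that by (intro continuous_map_from_subtopology continuous_map_real_mult continuous_map_coordinate) auto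
  moreover have "(\<lambda>t. g (x(i := t))) field_differentiable at (x i)" if "i < n" for i x
    using has_deriv_dotp_self[OF that] unfolding field_differentiable_def g_def by blast
  moreover have "(\<lambda>t. 2 * (x(j := t)) i) field_differentiable at (x j)" for i j and x :: "nat \<Rightarrow> real"
    unfolding field_differentiable_def by (rule exI, rule has_deriv_coordinate)
  ultimately have "Ck_on {..<n} 2 U g"
    by (simp add: numeral_2_eq_2 g_def partial_dotp_self del: fun_upd_apply)
  moreover have "\<forall>x\<in>U. \<exists>i<n. partial i g x \<noteq> 0"
  proof (rule ballI, rule ccontr)
    fix x assume x: "x \<in> U" "\<not> (\<exists>i<n. partial i g x \<noteq> 0)"
    then have "\<forall>i<n. x i = 0" by (auto simp: g_def partial_dotp_self)
    then have "dotp n x x = 0" by (simp add: dotp_def)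
    with x(1) show False by (simp add: U_def)
  qed
  moreover have "p \<in> U" "U \<inter> bdry n (unit_ball n) = {x \<in> U. g x = 0}"
    using p unfolding bdry_unit_ball by (auto simp: U_def g_def)
  ultimately show "\<exists>U g. openin (euclid {..<n}) U \<and> p \<in> U \<and> Ck_on {..<n} 2 U g \<and>
        (\<forall>x\<in>U. \<exists>i<n. partial i g x \<noteq> 0) \<and> U \<inter> bdry n (unit_ball n) = {x \<in> U. g x = 0}"
    using U by blast
qed

section \<open>Outer normal, Gauss map and curvature of the unit sphere\<close>

lemma dotp_diff_self: "dotp n (\<lambda>i. x i - y i) (\<lambda>i. x i - y i) = dotp n x x + dotp n y y - 2 * dotp n x y"
  by (simp add: dotp_def algebra_simps sum.distrib sum_subtractf sum_distrib_left)

lemma dotp_lincomb_self: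
  "dotp n (\<lambda>i. a * x i + b * y i) (\<lambda>i. a * x i + b * y i)
    = a\<^sup>2 * dotp n x x + 2 * a * b * dotp n y x + b\<^sup>2 * dotp n y y"
  by (simp add: dotp_def sum_distrib_left power2_eq_square sum.distrib algebra_simps)

lemma dotp_restrict_left [simp]: "dotp n (\<lambda>i\<in>{..<n}. f i) a = dotp n f a"
  by (simp add: dotp_def)

lemma dotp_self_eq_0D: "dotp n x x = 0 \<Longrightarrow> i < n \<Longrightarrow> x i = 0"
  using dotp_self_pos[of n x] by force

lemma dotp_diff_right: "dotp n v (\<lambda>i. y i - x i) = dotp n v y - dotp n v x"
  by (simp add: dotp_def algebra_simps sum_subtractf)

lemma dotp_commute: "dotp n x y = dotp n y x"
  by (simp add: dotp_def mult.commute)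

lemma outer_normal_unit_ball:
  assumes x: "x \<in> bdry n (unit_ball n)"
  shows "outer_normal n (unit_ball n) x = x"
  unfolding outer_normal_def
proof (rule the_equality)
  have xp: "x \<in> points n" "dotp n x x = 1" using x unfolding bdry_unit_ball by auto
  have "dotp n x (\<lambda>i. y i - x i) \<le> 0" if "y \<in> unit_ball n" for y
    using dotp_le_one[of n x y] xp that by (simp add: dotp_diff_right unit_ball_def)
  then show "x \<in> points n \<and> dotp n x x = 1 \<and> (\<forall>y\<in>unit_ball n. dotp n x (\<lambda>i. y i - x i) \<le> 0)" using xp by blast
  fix v assume v: "v \<in> points n \<and> dotp n v v = 1 \<and> (\<forall>y\<in>unit_ball n. dotp n v (\<lambda>i. y i - x i) \<le> 0)"
  \<comment> \<open>Uniqueness: \<open>v\<close> is itself a point of the ball, so v . v <= v . x,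
    and |v - x|^2 = 2 - 2 v . x is not positive.\<close>
  then have "v \<in> unit_ball n" by (simp add: unit_ball_def)
  with v have "dotp n v (\<lambda>i. v i - x i) \<le> 0" by blast
  then have "dotp n (\<lambda>i. v i - x i) (\<lambda>i. v i - x i) \<le> 0"
    using v xp by (simp add: dotp_diff_self dotp_diff_right)
  then have "dotp n (\<lambda>i. v i - x i) (\<lambda>i. v i - x i) = 0" by (intro antisym) auto
  then have "\<forall>i<n. v i = x i" using dotp_self_eq_0D by fastforce
  then show "v = x" using v xp(1) by (intro PiE_ext[of v "{..<n}" "\<lambda>_. UNIV" x]) auto
qed

lemma sum_delta_mult:
  fixes f :: "nat \<Rightarrow> real"
  assumes "i < n"
  shows "(\<Sum>j<n. (if i = j then 1 else 0) * f j) = f i"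
proof -
  have "(\<Sum>j<n. (if i = j then 1 else 0) * f j) = (\<Sum>j<n. if j = i then f j else 0)"
    by (intro sum.cong) auto
  then show ?thesis using assms by simp
qed

text \<open>The Gauss map of the sphere is the identity, so the remainder vanishes
  identically.\<close>

lemma gauss_map_differential_unit_ball:
  assumes x: "x \<in> bdry n (unit_ball n)"
  shows "gauss_map_differential n (unit_ball n) x (\<lambda>i j. if i = j then 1 else 0)"
  unfolding gauss_map_differential_def
proof (rule tendsto_eventually)
  let ?W = "\<lambda>i j. if i = j then 1 else (0::real)"
  have "L2_set (\<lambda>i. outer_normal n (unit_ball n) y i - outer_normal n (unit_ball n) x i
      - (\<Sum>j<n. ?W i j * (y j - x j))) {..<n} = 0" if "y \<in> bdry n (unit_ball n)" for y
    using that x by (subst L2_set_eq_0_iff) (auto simp: outer_normal_unit_ball sum_delta_mult)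
  then show "\<forall>\<^sub>F y in atin_within (euclid {..<n}) x (bdry n (unit_ball n)).
      L2_set (\<lambda>i. outer_normal n (unit_ball n) y i - outer_normal n (unit_ball n) x i
      - (\<Sum>j<n. ?W i j * (y j - x j))) {..<n} / L2_set (\<lambda>i. y i - x i) {..<n} = 0"
    by (auto simp: eventually_atin_within intro!: exI[of _ "topspace (euclid {..<n})"])
qed

text \<open>The Householder reflection that exchanges \<open>x\<close> with the last coordinate vector carries the
  other coordinate vectors to an orthonormal basis of the tangent space.\<close>

lemma tangent_basis:
  assumes n: "n \<ge> 1" and x: "dotp n x x = 1"
  shows "\<exists>u. (\<forall>a<n - 1. dotp n (u a) x = 0) \<and>
    (\<forall>a<n - 1. \<forall>b<n - 1. dotp n (u a) (u b) = (if a = b then 1 else 0))"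
proof -
  define e where "e = (\<lambda>(k::nat) (i::nat). if i = k then 1 else (0::real))"
  have de: "dotp n (e k) y = y k" "dotp n y (e k) = y k" if "k < n" for k y
    using that by (simp_all add: dotp_def e_def if_distrib if_distribR cong: if_cong)
  have ee: "dotp n (e a) (e b) = (if a = b then 1 else 0)" if "a < n" for a b
    using de(1)[OF that, of "e b"] by (simp add: e_def)
  define m where "m = n - 1"
  have m: "m < n" using n by (simp add: m_def)
  define v where "v = (\<lambda>i. x i - e m i)"
  show ?thesis
  proof (cases "dotp n v v = 0")
    \<comment> \<open>Here \<open>x\<close> agrees with the last coordinate vector on
      \<open>{..<n}\<close>; the reflection would be undefined, and the coordinate vectors already
      serve.\<close>
    case True
    then have "\<forall>i<n. x i = e m i" using dotp_self_eq_0D by (fastforce simp: v_def)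
    then have "dotp n y x = dotp n y (e m)" for y by (simp add: dotp_def)
    then show ?thesis using m by (intro exI[of _ e]) (auto simp: ee m_def)
  next
    case False
    define c where "c = 2 / dotp n v v"
    have cv: "c * dotp n v v = 2" using False by (simp add: c_def)
    define R where "R = (\<lambda>z i. z i + (- c * dotp n v z) * v i)"
    have lin: "dotp n y (R z) = dotp n y z - c * dotp n v z * dotp n y v" for y z
      unfolding R_def dotp_add_scale by simp
    have iso: "dotp n (R y) (R z) = dotp n y z" for y z
    proof -
      have "dotp n (R y) (R z) = dotp n (R z) y - c * dotp n v y * dotp n (R z) v"
        by (metis dotp_commute lin)
      also have "dotp n (R z) y = dotp n y z - c * dotp n v z * dotp n y v" by (metis dotp_commute lin)
      also have "dotp n (R z) v = dotp n v (R z)" by (rule dotp_commute)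
      also have "dotp n v (R z) = dotp n v z - (c * dotp n v v) * dotp n v z" unfolding lin by simp
      also have "\<dots> = - dotp n v z" unfolding cv by simp
      finally show ?thesis by (simp add: dotp_commute[of n y v])
    qed
    have vv: "dotp n v v = 2 - 2 * x m"
      unfolding v_def dotp_diff_self de(2)[OF m] using x by (simp add: e_def)
    have "dotp n v (e m) = x m - 1" unfolding de(2)[OF m] by (simp add: v_def e_def)
    then have "- c * dotp n v (e m) = 1" using False unfolding c_def vv by (simp add: field_simps)
    then have "R (e m) = x" by (simp add: R_def v_def fun_eq_iff)
    then have "dotp n (R (e a)) x = dotp n (e a) (e m)" for a using iso[of "e a" "e m"] by simp
    then show ?thesis using m iso
      by (intro exI[of _ "\<lambda>a. R (e a)"]) (auto simp: ee m_def)
  qed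
qed

text \<open>The matrix \<open>W\<close> is arbitrary, so its action on tangent vectors has to be
  extracted from the limit. The limit is taken along the great circle that leaves \<open>x\<close>
  in the direction \<open>u\<close>.\<close>

lemma gauss_map_differential_tangent:
  assumes x: "x \<in> bdry n (unit_ball n)" and W: "gauss_map_differential n (unit_ball n) x W"
    and u: "dotp n u x = 0" "dotp n u u = 1" and i: "i < n"
  shows "(\<Sum>j<n. W i j * u j) = u i"
proof -
  have xp: "x \<in> points n" "dotp n x x = 1" using x unfolding bdry_unit_ball by auto
  \<comment> \<open>The rational parametrization of the circle. For t > 0 the difference y t - x is
    exactly a positive multiple of u - t x, so the multiple cancels in the quotient \<open>F\<close>
    and leaves \<open>G\<close>, which is continuous at 0.\<close>
  define y where "y = (\<lambda>t. \<lambda>i\<in>{..<n}. ((1 - t\<^sup>2) / (1 + t\<^sup>2)) * x i + (2 * t / (1 + t\<^sup>2)) * u i)"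
  have t1: "1 + t\<^sup>2 \<noteq> 0" for t :: real using zero_le_power2[of t] by linarith
  have cont: "continuous_map euclideanreal (euclid {..<n}) y"
    unfolding y_def by (intro continuous_map_line continuous_intros) (auto simp: t1)
  have y0: "y 0 = x" using PiE_restrict[OF xp(1)] by (simp add: y_def)
  have ys: "y t \<in> bdry n (unit_ball n)" for t
  proof -
    have "dotp n (y t) (y t) = ((1 - t\<^sup>2) / (1 + t\<^sup>2))\<^sup>2 * dotp n x x
        + 2 * ((1 - t\<^sup>2) / (1 + t\<^sup>2)) * (2 * t / (1 + t\<^sup>2)) * dotp n u x + (2 * t / (1 + t\<^sup>2))\<^sup>2 * dotp n u u"
      unfolding y_def by (simp only: dotp_restrict dotp_restrict_left dotp_lincomb_self)
    also have "\<dots> = ((1 - t\<^sup>2) / (1 + t\<^sup>2))\<^sup>2 + (2 * t / (1 + t\<^sup>2))\<^sup>2" using u xp by simp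
    also have "\<dots> = 1" using t1[of t] by (simp add: power_divide add_divide_distrib[symmetric] divide_eq_eq) (simp add: power2_eq_square algebra_simps)
    finally show ?thesis unfolding bdry_unit_ball by (simp add: y_def)
  qed
  have yx: "y t i - x i = (2 * t / (1 + t\<^sup>2)) * (u i - t * x i)" if "i < n" for t i
  proof -
    have eq: "(1 - t\<^sup>2) / (1 + t\<^sup>2) = 1 - t * (2 * t / (1 + t\<^sup>2))"
      using t1[of t] by (simp add: divide_simps) (simp add: power2_eq_square)
    have "y t i = ((1 - t\<^sup>2) / (1 + t\<^sup>2)) * x i + (2 * t / (1 + t\<^sup>2)) * u i"
      using that by (simp add: y_def)
    then have "y t i = (1 - t * (2 * t / (1 + t\<^sup>2))) * x i + (2 * t / (1 + t\<^sup>2)) * u i"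
      unfolding eq .
    then show ?thesis by (simp add: algebra_simps diff_divide_distrib)
  qed
  define q where "q = (\<lambda>t i. u i - t * x i)"
  have qq: "dotp n (q t) (q t) = 1 + t\<^sup>2" for t
    unfolding q_def dotp_diff_self using u xp
    by (simp add: dotp_scale dotp_commute[of n "\<lambda>i. t * x i"] power2_eq_square)
  have L2q: "L2_set (q t) {..<n} \<noteq> 0" for t
    using qq[of t] t1[of t] by (auto simp: L2_set_def dotp_def power2_eq_square)
  define F where "F = (\<lambda>y. L2_set (\<lambda>i. outer_normal n (unit_ball n) y i - outer_normal n (unit_ball n) x i
                         - (\<Sum>j<n. W i j * (y j - x j))) {..<n} / L2_set (\<lambda>i. y i - x i) {..<n})"
  define G where "G = (\<lambda>t. L2_set (\<lambda>i. q t i - (\<Sum>j<n. W i j * q t j)) {..<n} / L2_set (q t) {..<n})"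
  have FG: "F (y t) = G t" if "t > 0" for t
  proof -
    define c where "c = 2 * t / (1 + t\<^sup>2)"
    let ?N = "L2_set (\<lambda>i. outer_normal n (unit_ball n) (y t) i - outer_normal n (unit_ball n) x i - (\<Sum>j<n. W i j * (y t j - x j))) {..<n}"
    have c: "c > 0" using that by (simp add: c_def add_pos_nonneg)
    have "?N
       = L2_set (\<lambda>i. c * (q t i - (\<Sum>j<n. W i j * q t j))) {..<n}"
    proof (rule L2_set_cong[OF refl])
      fix i assume i: "i \<in> {..<n}"
      have "(\<Sum>j<n. W i j * (y t j - x j)) = (\<Sum>j<n. c * (W i j * q t j))"
        by (intro sum.cong) (auto simp: yx q_def c_def)
      also have "\<dots> = c * (\<Sum>j<n. W i j * q t j)" by (rule sum_distrib_left[symmetric])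
      finally have "(\<Sum>j<n. W i j * (y t j - x j)) = c * (\<Sum>j<n. W i j * q t j)" .
      moreover have "y t i - x i = c * q t i" using i by (simp add: yx q_def c_def)
      ultimately show "outer_normal n (unit_ball n) (y t) i - outer_normal n (unit_ball n) x i
                         - (\<Sum>j<n. W i j * (y t j - x j)) = c * (q t i - (\<Sum>j<n. W i j * q t j))"
        unfolding outer_normal_unit_ball[OF ys] outer_normal_unit_ball[OF x] by (simp add: right_diff_distrib)
    qed
    also have "\<dots> = c * L2_set (\<lambda>i. q t i - (\<Sum>j<n. W i j * q t j)) {..<n}"
      using c by (intro L2_set_right_distrib[symmetric]) simp
    finally have 1: "?N = c * L2_set (\<lambda>i. q t i - (\<Sum>j<n. W i j * q t j)) {..<n}" .
    have "L2_set (\<lambda>i. y t i - x i) {..<n} = L2_set (\<lambda>i. c * q t i) {..<n}"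
      by (rule L2_set_cong[OF refl]) (auto simp: yx q_def c_def)
    also have "\<dots> = c * L2_set (q t) {..<n}"
      using c L2_set_right_distrib[of c "q t" "{..<n}"] by simp
    finally show ?thesis unfolding F_def G_def 1 using c by simp
  qed
  \<comment> \<open>The punctured limit also requires \<open>y t \<noteq> x\<close> for t > 0; this
    holds because \<open>q t\<close> has norm at least 1.\<close>
  have "filterlim y (atin_within (euclid {..<n}) x (bdry n (unit_ball n))) (at_right 0)"
    unfolding filterlim_iff
  proof (intro allI impI)
    fix P assume "eventually P (atin_within (euclid {..<n}) x (bdry n (unit_ball n)))"
    then obtain T where T: "openin (euclid {..<n}) T" "x \<in> T" "\<And>z. z \<in> T \<Longrightarrow> z \<in> bdry n (unit_ball n) \<Longrightarrow> z \<noteq> x \<Longrightarrow> P z"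
      using xp(1) unfolding eventually_atin_within by auto
    have "openin euclideanreal {t \<in> topspace euclideanreal. y t \<in> T}"
      by (rule openin_continuous_map_preimage[OF cont T(1)])
    then have op: "open {t. y t \<in> T}" by simp
    have "0 \<in> {t. y t \<in> T}" using y0 T(2) by simp
    then have "eventually (\<lambda>t. t \<in> {t. y t \<in> T}) (nhds 0)" using op by (rule eventually_nhds_in_open[rotated])
    then have "eventually (\<lambda>t. t \<in> {t. y t \<in> T}) (at_right 0)" by (rule filter_leD[OF at_within_le_nhds])
    moreover have "eventually (\<lambda>t::real. t > 0) (at_right 0)" by (simp add: eventually_at_right_less)
    ultimately show "eventually (\<lambda>t. P (y t)) (at_right 0)"
    proof eventually_elim
      case (elim t)
      have "y t \<noteq> x"
      proof
        assume "y t = x"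
        then have "\<forall>i<n. (2 * t / (1 + t\<^sup>2)) * q t i = 0" using yx[of _ t] by (simp add: q_def)
        then have "\<forall>i<n. q t i = 0" using elim t1[of t] by simp
        then show False using qq[of t] t1[of t] by (simp add: dotp_def)
      qed
      with elim ys[of t] T(3) show "P (y t)" by blast
    qed
  qed
  from filterlim_compose[OF W[unfolded gauss_map_differential_def, folded F_def] this]
  have "((\<lambda>t. F (y t)) \<longlongrightarrow> 0) (at_right 0)" .
  then have "(G \<longlongrightarrow> 0) (at_right 0)"
    by (rule Lim_transform_eventually) (use FG in \<open>auto simp: eventually_at_filter\<close>)
  moreover have "(G \<longlongrightarrow> L2_set (\<lambda>i. q 0 i - (\<Sum>j<n. W i j * q 0 j)) {..<n} / L2_set (q 0) {..<n}) (at_right 0)"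
  proof -
    have q: "((\<lambda>t. q t i) \<longlongrightarrow> q 0 i) (at_right 0)" for i
      unfolding q_def by (intro tendsto_intros)
    show ?thesis using L2q[of 0] unfolding G_def L2_set_def by (intro tendsto_intros q)
  qed
  ultimately have "L2_set (\<lambda>i. q 0 i - (\<Sum>j<n. W i j * q 0 j)) {..<n} / L2_set (q 0) {..<n} = 0"
    using tendsto_unique[OF trivial_limit_at_right_real] by blast
  then have "L2_set (\<lambda>i. q 0 i - (\<Sum>j<n. W i j * q 0 j)) {..<n} = 0" using L2q[of 0] by simp
  then show ?thesis using i by (simp add: L2_set_eq_0_iff q_def)
qed

text \<open>Existence: the identity matrix and any orthonormal tangent basis have all curvatures 1.
  Uniqueness: every admissible \<open>W\<close> acts as the identity on tangent vectors, so each
  \<open>k a\<close> is 1.\<close>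

lemma gauss_curvature_unit_ball:
  assumes n: "n \<ge> 1" and x: "x \<in> bdry n (unit_ball n)"
  shows "gauss_curvature n (unit_ball n) x = 1"
  unfolding gauss_curvature_def
proof (rule the_equality)
  note on = outer_normal_unit_ball[OF x]
  have "dotp n x x = 1" using x unfolding bdry_unit_ball by simp
  from tangent_basis[OF n this] obtain u where
    "\<forall>a<n - 1. dotp n (u a) x = 0" "\<forall>a<n - 1. \<forall>b<n - 1. dotp n (u a) (u b) = (if a = b then 1 else 0)"
    by blast
  then have "principal_curvatures n (unit_ball n) x (\<lambda>_. 1)"
    unfolding principal_curvatures_def on using gauss_map_differential_unit_ball[OF x]
    by (rule_tac exI[of _ "\<lambda>i j. if i = j then 1 else 0"], rule_tac exI[of _ u]) (auto simp: sum_delta_mult)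
  then show "\<exists>k. principal_curvatures n (unit_ball n) x k \<and> 1 = (\<Prod>a<n - 1. k a)" by force
  fix \<kappa> assume "\<exists>k. principal_curvatures n (unit_ball n) x k \<and> \<kappa> = (\<Prod>a<n - 1. k a)"
  then obtain k W u where k: "\<kappa> = (\<Prod>a<n - 1. k a)" and W: "gauss_map_differential n (unit_ball n) x W"
    and u: "\<And>a. a < n - 1 \<Longrightarrow> dotp n (u a) x = 0"
      "\<And>a b. a < n - 1 \<Longrightarrow> b < n - 1 \<Longrightarrow> dotp n (u a) (u b) = (if a = b then 1 else 0)"
      "\<And>a i. a < n - 1 \<Longrightarrow> i < n \<Longrightarrow> (\<Sum>j<n. W i j * u a j) = k a * u a i"
    unfolding principal_curvatures_def on by blast
  have "k a = 1" if a: "a < n - 1" for a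
  proof -
    have uu: "dotp n (u a) (u a) = 1" using u(2)[OF a a] by simp
    have "k a * u a i = u a i" if "i < n" for i
      using gauss_map_differential_tangent[OF x W u(1)[OF a] uu that] u(3)[OF a that] by simp
    then have "dotp n (u a) (\<lambda>i. k a * u a i) = dotp n (u a) (u a)"
      unfolding dotp_def by (intro sum.cong) (simp_all only: lessThan_iff)
    then show ?thesis using uu by (simp add: dotp_scale)
  qed
  then show "\<kappa> = 1" using k by simp
qed

section \<open>Surface measure of the unit sphere\<close>

text \<open>Transfer from the full function space, where open sets are measurable for the product of
  Borel sets: \<open>V\<close> is pulled back along restriction to \<open>I\<close>. Points of
  \<open>leb I\<close> are constant outside \<open>I\<close>, so their inclusion into the full space
  is measurable.\<close>

lemma openin_euclid_sets:
  assumes V: "openin (euclid I) V"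
  shows "V \<in> sets (leb I)"
proof -
  have sub: "V \<subseteq> Pi\<^sub>E I (\<lambda>_. UNIV)" using openin_subset[OF V] by simp
  have "continuous_map (euclid UNIV) (euclid I) (\<lambda>x. restrict x I)"
    unfolding continuous_map_componentwise
    by (auto simp: extensional_def intro!: continuous_map_coordinate)
  from openin_continuous_map_preimage[OF this V]
  have "open {x :: nat \<Rightarrow> real. restrict x I \<in> V}"
    by (simp add: open_fun_def)
  then have "{x :: nat \<Rightarrow> real. restrict x I \<in> V} \<in> sets (Pi\<^sub>M UNIV (\<lambda>_. borel))"
    by (simp add: sets_PiM_equal_borel)
  moreover have "(\<lambda>x. x) \<in> leb I \<rightarrow>\<^sub>M Pi\<^sub>M UNIV (\<lambda>_. borel)"
  proof (rule measurable_PiM_single')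
    fix k show "(\<lambda>x. x k) \<in> borel_measurable (leb I)"
    proof (cases "k \<in> I")
      case True
      then show ?thesis by (rule coordinate_measurable)
    next
      case False
      then have "(\<lambda>x. x k) \<in> borel_measurable (leb I) \<longleftrightarrow> (\<lambda>x. undefined :: real) \<in> borel_measurable (leb I)"
        by (intro measurable_cong) (auto simp: space_leb PiE_def extensional_def)
      then show ?thesis by simp
    qed
  qed auto
  ultimately have "(\<lambda>x. x) -` {x. restrict x I \<in> V} \<inter> space (leb I) \<in> sets (leb I)"
    by (rule measurable_sets[rotated])
  also have "(\<lambda>x. x) -` {x. restrict x I \<in> V} \<inter> space (leb I) = V"
    using sub by (auto simp: space_leb)
  finally show ?thesis .
qed

text \<open>Substitution t = sqrt(c + z^2), dz = t / sqrt(t^2 - c) dt. Since \<open>F\<close>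
  vanishes beyond 1 and z > 1 implies t > 1, the compact interval [0, 1] of \<open>z\<close>
  suffices; the endpoints form null sets.\<close>

lemma nn_integral_hypotenuse_substitution:
  assumes c: "c > 0" and F[measurable]: "F \<in> borel_measurable borel" and F0: "\<And>t. t > 1 \<Longrightarrow> F t = (0::ennreal)"
  shows "(\<integral>\<^sup>+z. F (sqrt (c + z\<^sup>2)) * indicator {0<..} z \<partial>lborel)
    = (\<integral>\<^sup>+t. F t * ennreal (t / sqrt (t\<^sup>2 - c)) * indicator {sqrt c<..} t \<partial>lborel)"
proof -
  define f where "f = (\<lambda>t. F t * ennreal (t / sqrt (t\<^sup>2 - c)))"
  define g where "g = (\<lambda>z. sqrt (c + z\<^sup>2))"
  have cz: "c + z\<^sup>2 > 0" for z using c by (simp add: add_pos_nonneg)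
  have gp: "g z > 0" for z using cz by (simp add: g_def)
  have "(\<integral>\<^sup>+t. f t * indicator {g 0..g 1} t \<partial>lborel) = (\<integral>\<^sup>+z. f (g z) * ennreal (z / g z) * indicator {0..1} z \<partial>lborel)"
  proof (rule nn_integral_substitution_aux)
    show "f \<in> borel_measurable borel" unfolding f_def by measurable
    show "(g has_real_derivative z / g z) (at z)" for z
      unfolding g_def using cz[of z] by (auto intro!: derivative_eq_intros simp: field_simps)
    show "continuous_on {0..1} (\<lambda>z. z / g z)"
      unfolding g_def using cz by (auto intro!: continuous_intros simp: less_imp_neq[OF cz, symmetric])
    show "z \<in> {0..1} \<Longrightarrow> z / g z \<ge> 0" for z using gp[of z] by simp
  qed auto
  also have "(\<integral>\<^sup>+z. f (g z) * ennreal (z / g z) * indicator {0..1} z \<partial>lborel) = (\<integral>\<^sup>+z. F (g z) * indicator {0<..} z \<partial>lborel)"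
  proof (intro nn_integral_cong_AE AE_I[of _ _ "{0}"])
    show "{z \<in> space lborel. f (g z) * ennreal (z / g z) * indicator {0..1} z \<noteq> F (g z) * indicator {0<..} z} \<subseteq> {0}"
    proof safe
      fix z :: real assume ne: "f (g z) * ennreal (z / g z) * indicator {0..1} z \<noteq> F (g z) * indicator {0<..} z"
      show "z = 0"
      proof (rule ccontr)
        assume z0: "z \<noteq> 0"
        consider "z < 0" | "z > 0" "z \<le> 1" | "z > 1" using z0 by linarith
        then show False
        proof cases
          case 1
          then show ?thesis using ne by simp
        next
          case 2
          have "(g z)\<^sup>2 - c = z\<^sup>2" using cz[of z] by (simp add: g_def)
          then have "f (g z) * ennreal (z / g z) = F (g z) * (ennreal (g z / z) * ennreal (z / g z))"
            using 2 by (simp add: f_def mult.assoc)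
          also have "ennreal (g z / z) * ennreal (z / g z) = 1"
            using 2 gp[of z] by (simp add: ennreal_mult'[symmetric])
          finally show ?thesis using ne 2 by simp
        next
          case 3
          have "1 < z\<^sup>2" using 3 by (simp add: one_less_power)
          then have "g z > 1" using c by (simp add: g_def)
          then show ?thesis using ne 3 F0 by simp
        qed
      qed
    qed
  qed auto
  also have "(\<integral>\<^sup>+t. f t * indicator {g 0..g 1} t \<partial>lborel) = (\<integral>\<^sup>+t. f t * indicator {sqrt c<..} t \<partial>lborel)"
  proof (intro nn_integral_cong_AE AE_I[of _ _ "{sqrt c}"])
    show "{t \<in> space lborel. f t * indicator {g 0..g 1} t \<noteq> f t * indicator {sqrt c<..} t} \<subseteq> {sqrt c}"
    proof safe
      fix t assume ne: "f t * indicator {g 0..g 1} t \<noteq> f t * indicator {sqrt c<..} t"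
      show "t = sqrt c"
      proof (rule ccontr)
        assume t: "t \<noteq> sqrt c"
        have "g 1 > 1" using c by (simp add: g_def)
        then have "t > g 1 \<Longrightarrow> f t = 0" using F0[of t] by (simp add: f_def)
        then show False using ne t by (cases "sqrt c < t"; cases "t \<le> g 1") (auto simp: g_def)
      qed
    qed
  qed auto
  finally show ?thesis by (simp add: f_def g_def)
qed

text \<open>Writing points as \<open>(w, z)\<close>, substitute \<open>z\<close> by the norm \<open>t\<close> of \<open>(w, z)\<close> for fixed \<open>w\<close>, exchange the integrals
  and rescale \<open>w = t y\<close> for fixed \<open>t\<close>.\<close>

lemma cone_over_graph_volume:
  assumes I: "finite I" "i \<notin> I" "I \<noteq> {}" and A[measurable]: "A \<in> sets (leb I)"
    and sub: "\<And>y. y \<in> A \<Longrightarrow> sqn I y < 1"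
  defines "J \<equiv> insert i I"
  shows "of_nat (card J) * emeasure (leb J) {x \<in> space (leb J). 0 < x i \<and> sqn J x \<le> 1 \<and> (\<lambda>k\<in>I. x k / sqrt (sqn J x)) \<in> A}
    = (\<integral>\<^sup>+y\<in>A. ennreal (1 / sqrt (1 - sqn I y)) \<partial>leb I)"
proof -
  define d where "d = card I"
  have cJ: "card J = Suc d" using I by (simp add: J_def d_def)
  let ?C = "{x \<in> space (leb J). 0 < x i \<and> sqn J x \<le> 1 \<and> (\<lambda>k\<in>I. x k / sqrt (sqn J x)) \<in> A}"
  define h where "h = (indicator A :: _ \<Rightarrow> ennreal)"
  have h[measurable]: "h \<in> borel_measurable (leb I)" unfolding h_def by measurable
  let ?X = "\<integral>\<^sup>+y. h y * ennreal (1 / sqrt (1 - sqn I y)) \<partial>leb I"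
  let ?P = "\<lambda>w t. ennreal (t / sqrt (t\<^sup>2 - sqn I w))"
  have scale_m: "(\<lambda>x. \<lambda>k\<in>I. x k / r x) \<in> M \<rightarrow>\<^sub>M leb I"
    if "r \<in> borel_measurable M" "\<And>k. k \<in> I \<Longrightarrow> (\<lambda>x. x k) \<in> borel_measurable M" for r :: "(nat \<Rightarrow> real) \<Rightarrow> real" and M
    by (rule measurable_restrict) (use that in simp)
  have [measurable]: "(\<lambda>x. \<lambda>k\<in>I. x k / sqrt (sqn J x)) \<in> leb J \<rightarrow>\<^sub>M leb I"
    by (rule scale_m) (auto simp: J_def intro!: coordinate_measurable)
  have [measurable]: "(\<lambda>x. x i) \<in> borel_measurable (leb J)" by (rule coordinate_measurable) (simp add: J_def)
  have C: "?C \<in> sets (leb J)" by measurable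
  have mE: "(\<lambda>x. h (\<lambda>k\<in>I. x k / sqrt (sqn J x)) * indicator {..1} (sqrt (sqn J x)) * indicator {0<..} (x i)) \<in> borel_measurable (leb J)"
    by measurable
  \<comment> \<open>The integrand as a function of \<open>w\<close> and the norm \<open>t\<close>,
    prepared for the substitution.\<close>
  define G where "G = (\<lambda>w t. h (\<lambda>k\<in>I. w k / t) * indicator {..1} t)"
  have "emeasure (leb J) ?C = (\<integral>\<^sup>+x. indicator ?C x \<partial>leb J)" using C by simp
  also have "\<dots> = (\<integral>\<^sup>+x. h (\<lambda>k\<in>I. x k / sqrt (sqn J x)) * indicator {..1} (sqrt (sqn J x)) * indicator {0<..} (x i) \<partial>leb J)"
    by (intro nn_integral_cong) (auto simp: indicator_def h_def)
  also have "\<dots> = (\<integral>\<^sup>+w. \<integral>\<^sup>+z. G w (sqrt (sqn I w + z\<^sup>2)) * indicator {0<..} z \<partial>lborel \<partial>leb I)"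
  proof -
    have e1: "(\<lambda>k\<in>I. (w(i := z)) k / t) = (\<lambda>k\<in>I. w k / t)" for w z t using I(2) by (auto simp: fun_eq_iff)
    have e2: "sqn J (w(i := z)) = sqn I w + z\<^sup>2" for w z
      unfolding J_def using I by (simp add: sqn_insert add.commute)
    have "h (\<lambda>k\<in>I. (w(i := z)) k / sqrt (sqn J (w(i := z)))) * indicator {..1} (sqrt (sqn J (w(i := z)))) * indicator {0<..} ((w(i := z)) i)
      = G w (sqrt (sqn I w + z\<^sup>2)) * indicator {0<..} z" for w z
      by (simp only: e1 e2 G_def fun_upd_same)
    then show ?thesis
      using nn_integral_insert_leb(1)[OF I(1,2) mE[unfolded J_def], folded J_def] by (simp only:)
  qed
  also have "\<dots> = (\<integral>\<^sup>+w. \<integral>\<^sup>+t. G w t * ?P w t * indicator {sqrt (sqn I w)<..} t \<partial>lborel \<partial>leb I)"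
  proof (rule nn_integral_cong_AE)
    \<comment> \<open>The substitution requires \<open>w\<close> to be nonzero;
      \<open>I \<noteq> {}\<close> makes the excluded point a null set.\<close>
    define Z where "Z = {x \<in> space (leb I). sqn I x \<le> 0\<^sup>2}"
    have "Z \<in> null_sets (leb I)"
      using emeasure_ball_leb[OF I(1), of 0] I by (auto simp: Z_def null_sets_def zero_power card_gt_0_iff)
    then have "AE w in leb I. w \<notin> Z" by (rule AE_not_in)
    then show "AE w in leb I. (\<integral>\<^sup>+z. G w (sqrt (sqn I w + z\<^sup>2)) * indicator {0<..} z \<partial>lborel)
      = (\<integral>\<^sup>+t. G w t * ?P w t * indicator {sqrt (sqn I w)<..} t \<partial>lborel)"
      using AE_space
    proof eventually_elim
      case (elim w)
      show ?case
      proof (rule nn_integral_hypotenuse_substitution)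
        show "sqn I w > 0" using elim by (auto simp: Z_def)
        have "(\<lambda>t. \<lambda>k\<in>I. w k / t) \<in> borel \<rightarrow>\<^sub>M leb I" by (rule measurable_restrict) simp
        then show "G w \<in> borel_measurable borel" unfolding G_def by measurable
      qed (auto simp: G_def)
    qed
  qed
  also have "\<dots> = (\<integral>\<^sup>+t. \<integral>\<^sup>+w. G w t * ?P w t * indicator {sqrt (sqn I w)<..} t \<partial>leb I \<partial>lborel)"
  proof -
    interpret M: sigma_finite_measure "leb I" by (rule sigma_finite_leb[OF I(1)])
    interpret P: pair_sigma_finite lborel "leb I" ..
    have [measurable]: "(\<lambda>(t, w). \<lambda>k\<in>I. w k / t) \<in> (borel :: real measure) \<Otimes>\<^sub>M leb I \<rightarrow>\<^sub>M leb I"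
      unfolding case_prod_unfold
      by (rule measurable_restrict) (use measurable_compose[OF measurable_snd coordinate_measurable] in simp)
    have "(\<lambda>(t, w). G w t * ?P w t * (if sqrt (sqn I w) < t then 1 else 0))
        \<in> borel_measurable (lborel \<Otimes>\<^sub>M leb I)"
      unfolding G_def by measurable
    then have "(\<lambda>(t, w). G w t * ?P w t * indicator {sqrt (sqn I w)<..} t)
        \<in> borel_measurable (lborel \<Otimes>\<^sub>M leb I)" by (simp add: indicator_def of_bool_def)
    from P.Fubini'[OF this] show ?thesis by simp
  qed
  \<comment> \<open>For fixed \<open>t\<close> the rescaling w = t y contributes t^d times an
    integral over \<open>y\<close> that is free of \<open>t\<close>. The remaining integral of t^d
    is 1 / (d + 1), which cancels \<open>card J\<close>.\<close>
  also have "\<dots> = (\<integral>\<^sup>+t. ennreal (t ^ d) * indicator {0..1} t * ?X \<partial>lborel)"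
  proof (intro nn_integral_cong_AE AE_I[of _ _ "{0}"])
    show "{t \<in> space lborel. (\<integral>\<^sup>+w. G w t * ?P w t * indicator {sqrt (sqn I w)<..} t \<partial>leb I)
       \<noteq> ennreal (t ^ d) * indicator {0..1} t * ?X} \<subseteq> {0}"
    proof (rule subsetI, rule ccontr)
      fix t :: real assume ne: "t \<in> {t \<in> space lborel. (\<integral>\<^sup>+w. G w t * ?P w t * indicator {sqrt (sqn I w)<..} t \<partial>leb I)
       \<noteq> ennreal (t ^ d) * indicator {0..1} t * ?X}" and t0: "t \<notin> {0}"
      consider "t < 0" | "t > 1" | "0 < t" "t \<le> 1" using t0 by fastforce
      then show False
      proof cases
        case 1
        then have "indicator {sqrt (sqn I w)<..} t = (0 :: ennreal)" for w
        proof -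
          have "\<not> sqrt (sqn I w) < t" using 1 real_sqrt_ge_zero[OF sqn_nonneg[of I w]] by linarith
          then show ?thesis by simp
        qed
        then show ?thesis using ne 1 by simp
      next
        case 2
        then show ?thesis using ne by (simp add: G_def)
      next
        case 3
        have [measurable]: "(\<lambda>w. \<lambda>k\<in>I. w k / t) \<in> leb I \<rightarrow>\<^sub>M leb I" by (rule scale_m[OF _ coordinate_measurable]) auto
        have "(\<lambda>w. h (\<lambda>k\<in>I. w k / t) * ?P w t * (if sqrt (sqn I w) < t then 1 else 0)) \<in> borel_measurable (leb I)"
          by measurable
        from nn_integral_leb_scale[OF I(1) 3(1) this]
        have "(\<integral>\<^sup>+w. h (\<lambda>k\<in>I. w k / t) * ?P w t * (if sqrt (sqn I w) < t then 1 else 0) \<partial>leb I)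
          = ennreal (t ^ d) * (\<integral>\<^sup>+y. h (\<lambda>k\<in>I. (\<lambda>k\<in>I. t * y k) k / t) * ?P (\<lambda>k\<in>I. t * y k) t
             * (if sqrt (sqn I (\<lambda>k\<in>I. t * y k)) < t then 1 else 0) \<partial>leb I)" by (simp add: d_def)
        also have "(\<integral>\<^sup>+y. h (\<lambda>k\<in>I. (\<lambda>k\<in>I. t * y k) k / t) * ?P (\<lambda>k\<in>I. t * y k) t
             * (if sqrt (sqn I (\<lambda>k\<in>I. t * y k)) < t then 1 else 0) \<partial>leb I)
           = ?X"
        proof (rule nn_integral_cong)
          fix y assume y: "y \<in> space (leb I)"
          have r: "(\<lambda>k\<in>I. (\<lambda>k\<in>I. t * y k) k / t) = y"
            using 3 y by (intro PiE_ext[of _ I "\<lambda>_. UNIV"]) (auto simp: space_leb)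
          have s: "sqn I (\<lambda>k\<in>I. t * y k) = t\<^sup>2 * sqn I y"
            by (simp add: sqn_def sum_distrib_left power_mult_distrib)
          have s2: "sqrt (t\<^sup>2 * sqn I y) = t * sqrt (sqn I y)" using 3 by (simp add: real_sqrt_mult)
          have "sqrt (t\<^sup>2 - t\<^sup>2 * sqn I y) = t * sqrt (1 - sqn I y)"
            using 3 by (simp add: real_sqrt_mult right_diff_distrib[of "t\<^sup>2" 1, symmetric, simplified])
          then have s3: "t / sqrt (t\<^sup>2 - t\<^sup>2 * sqn I y) = 1 / sqrt (1 - sqn I y)" using 3 by simp
          show "h (\<lambda>k\<in>I. (\<lambda>k\<in>I. t * y k) k / t) * ?P (\<lambda>k\<in>I. t * y k) t
             * (if sqrt (sqn I (\<lambda>k\<in>I. t * y k)) < t then 1 else 0) = h y * ennreal (1 / sqrt (1 - sqn I y))"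
            unfolding r s s2 s3 using sub[of y] 3 by (cases "y \<in> A") (auto simp: h_def)
        qed
        finally have fin: "(\<integral>\<^sup>+w. h (\<lambda>k\<in>I. w k / t) * ?P w t * (if sqrt (sqn I w) < t then 1 else 0) \<partial>leb I)
          = ennreal (t ^ d) * ?X" .
        have e1: "(\<integral>\<^sup>+w. G w t * ?P w t * indicator {sqrt (sqn I w)<..} t \<partial>leb I)
          = (\<integral>\<^sup>+w. h (\<lambda>k\<in>I. w k / t) * ?P w t * (if sqrt (sqn I w) < t then 1 else 0) \<partial>leb I)"
          using 3 by (intro nn_integral_cong) (simp add: G_def)
        have e2: "ennreal (t ^ d) * indicator {0..1} t = ennreal (t ^ d)" using 3 by simp
        from ne[unfolded mem_Collect_eq] show ?thesis unfolding e1 e2 fin by blast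
      qed
    qed
  qed auto
  also have "\<dots> = (\<integral>\<^sup>+t. ennreal (t ^ d) * indicator {0..1} t \<partial>lborel) * ?X"
    by (rule nn_integral_multc) (auto intro!: borel_measurable_times_ennreal borel_measurable_indicator)
  also have "(\<integral>\<^sup>+t. ennreal (t ^ d) * indicator {0..1} t \<partial>lborel) = ennreal (1 ^ Suc d / Suc d - 0 ^ Suc d / Suc d)"
  proof (rule nn_integral_FTC_Icc)
    show "((\<lambda>z. z ^ Suc d / Suc d) has_real_derivative z ^ d) (at z)" for z :: real
      using DERIV_cdivide[OF DERIV_pow[of "Suc d" z UNIV], of "Suc d"] by simp
  qed auto
  also have "ennreal (1 ^ Suc d / Suc d - 0 ^ Suc d / Suc d) = ennreal (1 / Suc d)" by simp
  finally have e: "emeasure (leb J) ?C = ennreal (1 / Suc d) * ?X" .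
  have "of_nat (card J) * emeasure (leb J) ?C = (ennreal (Suc d) * ennreal (1 / Suc d)) * ?X"
    unfolding cJ e by (simp only: mult.assoc ennreal_of_nat_eq_real_of_nat)
  also have "ennreal (Suc d) * ennreal (1 / Suc d) = 1"
    by (subst ennreal_mult'[symmetric]) (simp_all del: of_nat_Suc)
  also have "1 * ?X = (\<integral>\<^sup>+y\<in>A. ennreal (1 / sqrt (1 - sqn I y)) \<partial>leb I)"
    by (simp add: h_def mult.commute)
  finally show ?thesis .
qed

section \<open>The area of the sphere as a cone measure\<close>

definition direction :: "nat \<Rightarrow> (nat \<Rightarrow> real) \<Rightarrow> nat \<Rightarrow> real" where
  "direction n y = (\<lambda>k\<in>{..<n}. y k / sqrt (dotp n y y))"

definition punctured_ball :: "nat \<Rightarrow> (nat \<Rightarrow> real) set" where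
  "punctured_ball n = {y \<in> unit_ball n. dotp n y y > 0}"

text \<open>A part of the unit sphere has area \<open>n\<close> times the volume of the cone over it
  in the unit ball; this makes the surface measure a scaled image of Lebesgue measure. The ball is
  punctured because \<open>direction\<close> sends the origin to 0, off the sphere.\<close>

definition cone_measure :: "nat \<Rightarrow> (nat \<Rightarrow> real) measure" where
  "cone_measure n = scale_measure (of_nat n)
     (distr (restrict_space (leb {..<n}) (punctured_ball n)) (restrict_space (leb {..<n}) (bdry n (unit_ball n))) (direction n))"

lemma punctured_ball_eq: "punctured_ball n = {y \<in> space (leb {..<n}). sqn {..<n} y \<le> 1 \<and> sqn {..<n} y > 0}"
  by (simp add: punctured_ball_def unit_ball_def sqn_eq_dotp space_leb conj_assoc)

lemma punctured_ball_sets [measurable]: "punctured_ball n \<in> sets (leb {..<n})"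
  unfolding punctured_ball_eq by measurable

lemma bdry_eq: "bdry n (unit_ball n) = {x \<in> space (leb {..<n}). sqn {..<n} x = 1}"
  unfolding bdry_unit_ball by (simp add: sqn_eq_dotp space_leb)

lemma bdry_sets: "bdry n (unit_ball n) \<in> sets (leb {..<n})"
  unfolding bdry_eq by measurable

lemma direction_measurable:
  "direction n \<in> restrict_space (leb {..<n}) (punctured_ball n) \<rightarrow>\<^sub>M restrict_space (leb {..<n}) (bdry n (unit_ball n))"
proof (rule measurable_restrict_space2)
  show "direction n \<in> space (restrict_space (leb {..<n}) (punctured_ball n)) \<rightarrow> bdry n (unit_ball n)"
  proof
    fix y assume "y \<in> space (restrict_space (leb {..<n}) (punctured_ball n))"
    then have p: "dotp n y y > 0" by (simp add: space_restrict_space punctured_ball_def)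
    have "dotp n (direction n y) (direction n y) = dotp n y y / (sqrt (dotp n y y))\<^sup>2"
      by (simp add: direction_def dotp_def power2_eq_square sum_divide_distrib)
    then show "direction n y \<in> bdry n (unit_ball n)" using p unfolding bdry_unit_ball by (simp add: direction_def)
  qed
  show "direction n \<in> restrict_space (leb {..<n}) (punctured_ball n) \<rightarrow>\<^sub>M leb {..<n}"
  proof (rule measurable_restrict_space1)
    show "direction n \<in> leb {..<n} \<rightarrow>\<^sub>M leb {..<n}"
      unfolding direction_def[abs_def]
    proof (rule measurable_restrict)
      fix k assume "k \<in> {..<n}"
      then have [measurable]: "(\<lambda>x. x k) \<in> borel_measurable (leb {..<n})"
        by (rule coordinate_measurable)
      show "(\<lambda>x. x k / sqrt (dotp n x x)) \<in> leb {..<n} \<rightarrow>\<^sub>M lborel" by simp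
    qed
  qed
qed

lemma space_cone_measure: "space (cone_measure n) = bdry n (unit_ball n)"
  unfolding cone_measure_def by (auto simp: space_scale_measure space_restrict_space bdry_eq)

lemma sets_cone_measure: "sets (cone_measure n) = sets (restrict_space (leb {..<n}) (bdry n (unit_ball n)))"
  unfolding cone_measure_def by simp

lemma emeasure_cone_measure:
  assumes G: "G \<in> sets (leb {..<n})" "G \<subseteq> bdry n (unit_ball n)"
  shows "emeasure (cone_measure n) G = of_nat n * emeasure (leb {..<n}) {y \<in> punctured_ball n. direction n y \<in> G}"
proof -
  have Gr: "G \<in> sets (restrict_space (leb {..<n}) (bdry n (unit_ball n)))"
    using G bdry_sets by (subst sets_restrict_space_iff) auto
  have sp: "space (restrict_space (leb {..<n}) (punctured_ball n)) = punctured_ball n"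
    using sets.sets_into_space[OF punctured_ball_sets] by (auto simp: space_restrict_space)
  have "emeasure (cone_measure n) G = of_nat n *
     emeasure (restrict_space (leb {..<n}) (punctured_ball n)) (direction n -` G \<inter> punctured_ball n)"
    unfolding cone_measure_def using emeasure_distr[OF direction_measurable Gr] by (simp add: sp)
  also have "emeasure (restrict_space (leb {..<n}) (punctured_ball n)) (direction n -` G \<inter> punctured_ball n)
     = emeasure (leb {..<n}) (direction n -` G \<inter> punctured_ball n)"
    by (rule emeasure_restrict_space) auto
  also have "direction n -` G \<inter> punctured_ball n = {y \<in> punctured_ball n. direction n y \<in> G}" by auto
  finally show ?thesis .
qed

lemma sqn_graph:
  assumes "i < n"
  shows "dotp n (y(i := t)) (y(i := t)) = t\<^sup>2 + sqn ({..<n} - {i}) y"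
proof -
  have "insert i ({..<n} - {i}) = {..<n}" using assms by auto
  then show ?thesis unfolding sqn_eq_dotp[symmetric] using sqn_insert[of "{..<n} - {i}" i "y(i := t)"] by simp
qed

lemma graph_in_bdry_iff:
  assumes "i < n" "y \<in> Pi\<^sub>E ({..<n} - {i}) (\<lambda>_. UNIV)"
  shows "y(i := t) \<in> bdry n (unit_ball n) \<longleftrightarrow> t\<^sup>2 = 1 - sqn ({..<n} - {i}) y"
proof -
  have "insert i ({..<n} - {i}) = {..<n}" using assms by auto
  then have "y(i := t) \<in> points n" using PiE_fun_upd[of t "\<lambda>_. UNIV" i y "{..<n} - {i}"] assms(2) by simp
  then have "y(i := t) \<in> bdry n (unit_ball n) \<longleftrightarrow> t\<^sup>2 + sqn ({..<n} - {i}) y = 1"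
    unfolding bdry_unit_ball mem_Collect_eq sqn_graph[OF assms(1)] by blast
  then show ?thesis by linarith
qed

text \<open>At each point \<open>f\<close> is one of the two square roots, and its sign may change
  on \<open>A\<close>. The sets \<open>Ap\<close> and \<open>Am\<close> separate the signs, and
  reflecting the \<open>i\<close>-th coordinate reduces the lower part to the upper one.\<close>

lemma cone_measure_graph:
  assumes n: "n \<ge> 2" and i: "i < n"
  defines "I \<equiv> {..<n} - {i}"
  assumes A: "A \<in> sets (leb I)" "{y \<in> A. f y > 0} \<in> sets (leb I)" "\<And>y. y \<in> A \<Longrightarrow> sqn I y < 1"
    and f: "\<And>y. y \<in> A \<Longrightarrow> (f y)\<^sup>2 = 1 - sqn I y"
  shows "emeasure (cone_measure n) ((\<lambda>y. y(i := f y)) ` A) = (\<integral>\<^sup>+y\<in>A. ennreal (1 / sqrt (1 - sqn I y)) \<partial>leb I)"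
proof -
  define J where "J = {..<n}"
  have J: "J = insert i I" and I: "finite I" "i \<notin> I" using i by (auto simp: I_def J_def)
  have "card J = n" by (simp add: J_def)
  moreover have "card J = Suc (card I)" unfolding J using I by simp
  ultimately have I0: "I \<noteq> {}" using n by auto
  define Ap where "Ap = {y \<in> A. f y > 0}"
  define Am where "Am = A - Ap"
  have Am_eq: "Am = {y \<in> A. f y < 0}"
  proof -
    have "f y \<noteq> 0" if "y \<in> A" for y using f[OF that] A(3)[OF that] by auto
    then show ?thesis by (force simp: Am_def Ap_def)
  qed
  have Apm[measurable]: "Ap \<in> sets (leb I)" "Am \<in> sets (leb I)" using A by (auto simp: Am_def Ap_def)
  have AI: "A \<subseteq> Pi\<^sub>E I (\<lambda>_. UNIV)" using sets.sets_into_space[OF A(1)] by (simp add: space_leb)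
  define r where "r = (\<lambda>x. \<lambda>k\<in>I. x k / sqrt (sqn J x))"
  have [measurable]: "r \<in> leb J \<rightarrow>\<^sub>M leb I"
    unfolding r_def[abs_def] by (rule measurable_restrict) (use coordinate_measurable in \<open>simp add: J\<close>)
  have [measurable]: "(\<lambda>x. x i) \<in> borel_measurable (leb J)" by (rule coordinate_measurable) (simp add: J)
  define G where "G = (\<lambda>y. y(i := f y)) ` A"
  define Cp where "Cp = (\<lambda>A. {x \<in> space (leb J). 0 < x i \<and> sqn J x \<le> 1 \<and> r x \<in> A})"
  define Cm where "Cm = (\<lambda>A. {x \<in> space (leb J). 0 < - x i \<and> sqn J x \<le> 1 \<and> r x \<in> A})"
  have Cs: "Cp B \<in> sets (leb J)" "Cm B \<in> sets (leb J)" if [measurable]: "B \<in> sets (leb I)" for B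
    unfolding Cp_def Cm_def by measurable
  have refl: "emeasure (leb J) (Cm B) = emeasure (leb J) (Cp B)" if "B \<in> sets (leb I)" for B
  proof -
    have m: "(indicator (Cp B) :: _ \<Rightarrow> ennreal) \<in> borel_measurable (leb J)" using Cs[OF that] by simp
    have "emeasure (leb J) (Cp B) = (\<integral>\<^sup>+x. indicator (Cp B) x \<partial>leb J)" using Cs[OF that] by simp
    also have "\<dots> = (\<integral>\<^sup>+x. indicator (Cp B) (x(i := - x i)) \<partial>leb J)"
      by (rule nn_integral_leb_reflect[symmetric, OF _ _ m]) (use I in \<open>auto simp: J\<close>)
    also have "\<dots> = (\<integral>\<^sup>+x. indicator (Cm B) x \<partial>leb J)"
    proof (rule nn_integral_cong)
      fix x assume x: "x \<in> space (leb J)"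
      have s: "sqn J (x(i := - x i)) = sqn J x" unfolding J using I by (simp add: sqn_insert)
      then have "r (x(i := - x i)) = r x" using I(2) by (auto simp: r_def fun_eq_iff)
      moreover have "x(i := - x i) \<in> space (leb J)"
        using PiE_fun_upd[of "- x i" "\<lambda>_. UNIV" i x J] x by (simp add: space_leb J insert_absorb)
      ultimately have "x(i := - x i) \<in> Cp B \<longleftrightarrow> x \<in> Cm B" using s x by (simp add: Cp_def Cm_def)
      then show "indicator (Cp B) (x(i := - x i)) = (indicator (Cm B) x :: ennreal)" by (simp add: indicator_def)
    qed
    also have "\<dots> = emeasure (leb J) (Cm B)" using Cs[OF that] by simp
    finally show ?thesis by simp
  qed
  have Cpv: "of_nat n * emeasure (leb J) (Cp B) = (\<integral>\<^sup>+y\<in>B. ennreal (1 / sqrt (1 - sqn I y)) \<partial>leb I)"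
    if "B \<in> sets (leb I)" "B \<subseteq> A" for B
    using cone_over_graph_volume[OF I I0 that(1)] that(2) A(3) \<open>card J = n\<close>
    unfolding J[symmetric] Cp_def r_def by auto
  have G_iff: "x \<in> G \<longleftrightarrow> restrict x I \<in> A \<and> x i = f (restrict x I)" if x: "x \<in> points n" for x
  proof
    assume "x \<in> G"
    then obtain y where y: "y \<in> A" "x = y(i := f y)" by (auto simp: G_def)
    have "restrict x I = y" using y AI I(2) by (intro PiE_ext[of _ I "\<lambda>_. UNIV"]) auto
    then show "restrict x I \<in> A \<and> x i = f (restrict x I)" using y by simp
  next
    assume h: "restrict x I \<in> A \<and> x i = f (restrict x I)"
    have "x = (restrict x I)(i := x i)"
      using x i by (auto simp: fun_eq_iff PiE_def extensional_def I_def)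
    then show "x \<in> G" unfolding G_def using h by (metis (no_types, lifting) image_eqI)
  qed
  have dir: "restrict (direction n y) I = r y" "direction n y i = y i / sqrt (sqn J y)" for y
    using i by (auto simp: direction_def r_def fun_eq_iff I_def J_def sqn_eq_dotp)
  have "{y \<in> punctured_ball n. direction n y \<in> G} = Cp Ap \<union> Cm Am"
  proof (rule set_eqI)
    fix y
    show "y \<in> {y \<in> punctured_ball n. direction n y \<in> G} \<longleftrightarrow> y \<in> Cp Ap \<union> Cm Am"
    proof (cases "y \<in> space (leb J) \<and> sqn J y \<le> 1 \<and> sqn J y > 0")
      case False
      have "\<not> (sqn J y > 0) \<Longrightarrow> y i = 0"
      proof -
        assume "\<not> (sqn J y > 0)"
        then have "sqn J y = 0" using sqn_nonneg[of J y] by linarith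
        then have "dotp n y y = 0" by (simp add: J_def sqn_eq_dotp)
        then show "y i = 0" using i by (rule dotp_self_eq_0D)
      qed
      then show ?thesis using False by (auto simp: punctured_ball_eq J_def Cp_def Cm_def)
    next
      case True
      define q where "q = sqrt (sqn J y)"
      have q: "q > 0" "q\<^sup>2 = sqn J y" using True by (auto simp: q_def)
      have "sqn I (r y) = (\<Sum>k\<in>I. (y k / q)\<^sup>2)"
        unfolding sqn_def by (intro sum.cong) (auto simp: r_def q_def)
      also have "\<dots> = sqn I y / q\<^sup>2" by (simp add: sqn_def power_divide sum_divide_distrib)
      finally have "sqn I (r y) = sqn I y / q\<^sup>2" .
      moreover have "sqn J y = (y i)\<^sup>2 + sqn I y" unfolding J using I by (simp add: sqn_insert)
      ultimately have sr: "1 - sqn I (r y) = (y i / q)\<^sup>2"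
        using q True by (simp add: power_divide divide_simps) (simp add: left_diff_distrib)
      have sq: "r y \<in> A \<Longrightarrow> (f (r y))\<^sup>2 = (y i / q)\<^sup>2" using f sr by simp
      have "y \<in> {y \<in> punctured_ball n. direction n y \<in> G} \<longleftrightarrow> direction n y \<in> G"
        using True by (simp add: punctured_ball_eq J_def)
      also have "\<dots> \<longleftrightarrow> r y \<in> A \<and> y i / q = f (r y)"
        by (subst G_iff) (simp_all add: dir q_def, simp add: direction_def)
      also have "\<dots> \<longleftrightarrow> (0 < y i \<and> r y \<in> Ap) \<or> (0 < - y i \<and> r y \<in> Am)"
      proof
        assume h: "r y \<in> A \<and> y i / q = f (r y)"
        then have "f (r y) \<noteq> 0" using f[of "r y"] A(3)[of "r y"] by auto
        then have "f (r y) > 0 \<or> f (r y) < 0" by linarith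
        then show "(0 < y i \<and> r y \<in> Ap) \<or> (0 < - y i \<and> r y \<in> Am)"
        proof
          assume p: "f (r y) > 0"
          then have "0 < y i / q" using h by simp
          then have "0 < y i" using q(1) by (simp add: zero_less_divide_iff)
          then show ?thesis using h p by (simp add: Ap_def)
        next
          assume p: "f (r y) < 0"
          then have "y i / q < 0" using h by simp
          then have "y i < 0" using q(1) by (simp add: divide_less_0_iff)
          then show ?thesis using h p by (simp add: Am_eq)
        qed
      next
        assume h: "(0 < y i \<and> r y \<in> Ap) \<or> (0 < - y i \<and> r y \<in> Am)"
        then have rA: "r y \<in> A" by (auto simp: Ap_def Am_def)
        have "f (r y) = y i / q \<or> f (r y) = - (y i / q)" using sq[OF rA] by (simp add: power2_eq_iff)
        then show "r y \<in> A \<and> y i / q = f (r y)"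
        proof
          assume m: "f (r y) = - (y i / q)"
          from h show ?thesis
          proof
            assume "0 < y i \<and> r y \<in> Ap"
            then have "f (r y) > 0" "y i / q > 0" using q by (auto simp: Ap_def)
            with m show ?thesis by simp
          next
            assume "0 < - y i \<and> r y \<in> Am"
            then have "f (r y) < 0" "y i / q < 0" using q by (auto simp: Am_eq divide_less_0_iff)
            with m show ?thesis by simp
          qed
        qed (use rA in simp)
      qed
      also have "\<dots> \<longleftrightarrow> y \<in> Cp Ap \<union> Cm Am" using True by (auto simp: Cp_def Cm_def)
      finally show ?thesis .
    qed
  qed
  then have cone: "emeasure (leb J) {y \<in> punctured_ball n. direction n y \<in> G} = emeasure (leb J) (Cp Ap) + emeasure (leb J) (Cm Am)"
    using Cs by (subst plus_emeasure) (auto simp: Cp_def Cm_def)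
  have "of_nat n * emeasure (leb J) {y \<in> punctured_ball n. direction n y \<in> G}
      = of_nat n * emeasure (leb J) (Cp Ap) + of_nat n * emeasure (leb J) (Cp Am)"
    unfolding cone by (simp add: refl distrib_left)
  also have "\<dots> = (\<integral>\<^sup>+y\<in>Ap. ennreal (1 / sqrt (1 - sqn I y)) \<partial>leb I) + (\<integral>\<^sup>+y\<in>Am. ennreal (1 / sqrt (1 - sqn I y)) \<partial>leb I)"
    by (intro arg_cong2[where f="(+)"] Cpv Apm) (auto simp: Ap_def Am_def)
  also have "\<dots> = (\<integral>\<^sup>+y. ennreal (1 / sqrt (1 - sqn I y)) * indicator Ap y + ennreal (1 / sqrt (1 - sqn I y)) * indicator Am y \<partial>leb I)"
    by (rule nn_integral_add[symmetric]) measurable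
  also have "\<dots> = (\<integral>\<^sup>+y\<in>A. ennreal (1 / sqrt (1 - sqn I y)) \<partial>leb I)"
    by (intro nn_integral_cong) (auto simp: Am_def Ap_def indicator_def)
  finally have val: "of_nat n * emeasure (leb J) {y \<in> punctured_ball n. direction n y \<in> G}
     = (\<integral>\<^sup>+y\<in>A. ennreal (1 / sqrt (1 - sqn I y)) \<partial>leb I)" .
  have Gb: "G \<subseteq> bdry n (unit_ball n)"
    unfolding G_def using f AI by (auto simp: graph_in_bdry_iff[OF i] I_def)
  have rm: "(\<lambda>x. restrict x I) \<in> leb J \<rightarrow>\<^sub>M leb I"
    by (rule measurable_restrict) (use coordinate_measurable in \<open>simp add: J\<close>)
  \<comment> \<open>Measurability of \<open>G\<close> without that of \<open>f\<close>: on
    \<open>Ap\<close> and on \<open>Am\<close>, both measurable, \<open>f\<close> is an explicit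
    square root.\<close>
  have "G = {x \<in> space (leb J). restrict x I \<in> Ap \<and> x i = sqrt (1 - sqn I (restrict x I))}
      \<union> {x \<in> space (leb J). restrict x I \<in> Am \<and> x i = - sqrt (1 - sqn I (restrict x I))}"
  proof -
    have fp: "f y = sqrt (1 - sqn I y)" if "y \<in> Ap" for y
      using f[of y] that by (simp add: Ap_def real_sqrt_unique)
    have fm: "f y = - sqrt (1 - sqn I y)" if "y \<in> Am" for y
    proof -
      have "sqrt (1 - sqn I y) = - f y" by (rule real_sqrt_unique) (use f[of y] that in \<open>auto simp: Am_eq\<close>)
      then show ?thesis by simp
    qed
    have "G = {x \<in> points n. restrict x I \<in> A \<and> x i = f (restrict x I)}"
      using G_iff Gb by (auto simp: bdry_eq space_leb)
    also have "\<dots> = {x \<in> points n. (restrict x I \<in> Ap \<and> x i = f (restrict x I)) \<or> (restrict x I \<in> Am \<and> x i = f (restrict x I))}"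
      by (auto simp: Am_def Ap_def)
    finally show ?thesis using fp fm by (auto simp: space_leb J_def)
  qed
  also have "\<dots> = ((\<lambda>x. restrict x I) -` Ap \<inter> space (leb J)) \<inter> {x \<in> space (leb J). x i = sqrt (1 - sqn I (restrict x I))}
      \<union> ((\<lambda>x. restrict x I) -` Am \<inter> space (leb J)) \<inter> {x \<in> space (leb J). x i = - sqrt (1 - sqn I (restrict x I))}"
    by auto
  also have "\<dots> \<in> sets (leb J)"
  proof -
    have [measurable]: "(\<lambda>x. sqn I (restrict x I)) \<in> borel_measurable (leb J)"
      by (rule measurable_compose[OF rm sqn_measurable])
    have "{x \<in> space (leb J). x i = sqrt (1 - sqn I (restrict x I))} \<in> sets (leb J)"
      "{x \<in> space (leb J). x i = - sqrt (1 - sqn I (restrict x I))} \<in> sets (leb J)"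
      by measurable
    then show ?thesis by (intro sets.Un sets.Int measurable_sets[OF rm] Apm)
  qed
  finally have Gs: "G \<in> sets (leb {..<n})" by (simp add: J_def)
  show ?thesis using emeasure_cone_measure[OF Gs Gb] val by (simp add: J_def G_def)
qed

section \<open>Graphs in the sphere and uniqueness of the surface measure\<close>

lemma continuous_map_sqn: "finite I \<Longrightarrow> continuous_map (euclid I) euclideanreal (sqn I)"
  unfolding sqn_def[abs_def] power2_eq_square
  by (intro continuous_map_sum continuous_map_real_mult continuous_map_coordinate) auto

lemma open_unit_ball_openin: "finite I \<Longrightarrow> openin (euclid I) {y \<in> Pi\<^sub>E I (\<lambda>_. UNIV). sqn I y < 1}"
  using openin_continuous_map_preimage[OF continuous_map_sqn, of I "{..<1}"] by simp

text \<open>Every \<open>C\<^sup>1\<close> function whose graph lies in the unit sphere satisfies \<open>f\<^sup>2 = 1 - |y|\<^sup>2\<close>, so its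
  gradient is \<open>- y / f\<close> whatever the sign of \<open>f\<close>.\<close>

context
  fixes n i :: nat and I U f
  assumes i: "i < n" and I_def: "I = {..<n} - {i}"
    and U: "openin (euclid I) U" and Ck: "Ck_on I 1 U f"
    and gr: "\<forall>y\<in>U. y(i := f y) \<in> bdry n (unit_ball n)"
begin

lemma U_sub: "U \<subseteq> Pi\<^sub>E I (\<lambda>_. UNIV)" using openin_subset[OF U] by simp

lemma f_sq: "y \<in> U \<Longrightarrow> (f y)\<^sup>2 = 1 - sqn I y"
  using gr U_sub graph_in_bdry_iff[OF i, of y "f y"] unfolding I_def by blast

text \<open>At |y| = 1 the open set \<open>U\<close> would contain t y for some t > 1, where f^2 = 1
  - t^2 is negative.\<close>

lemma sqn_less_1:
  assumes y: "y \<in> U"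
  shows "sqn I y < 1"
proof (rule ccontr)
  assume "\<not> sqn I y < 1"
  moreover have le: "sqn I z \<le> 1" if "z \<in> U" for z using f_sq[OF that] zero_le_power2[of "f z"] by linarith
  ultimately have y1: "sqn I y = 1" using y by force
  define c where "c = (\<lambda>t. \<lambda>k\<in>I. t * y k + 0 * y k)"
  have cont: "continuous_map euclideanreal (euclid I) c"
    unfolding c_def by (intro continuous_map_line continuous_intros)
  have "openin euclideanreal {t \<in> topspace euclideanreal. c t \<in> U}"
    by (rule openin_continuous_map_preimage[OF cont U])
  then have op: "open {t. c t \<in> U}" by simp
  have "y \<in> Pi\<^sub>E I (\<lambda>_. UNIV)" using y U_sub by blast
  then have "c 1 = y" using PiE_restrict by (simp add: c_def)
  then have "1 \<in> {t. c t \<in> U}" using y by simp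
  then obtain e where e: "e > 0" "ball 1 e \<subseteq> {t. c t \<in> U}" using op open_contains_ball by blast
  define t where "t = 1 + e / 2"
  have "t \<in> ball 1 e" using e(1) by (simp add: t_def dist_real_def)
  then have "c t \<in> U" using e(2) by blast
  then have "sqn I (c t) \<le> 1" by (rule le)
  moreover have "sqn I (c t) = t\<^sup>2 * sqn I y"
    by (simp add: c_def sqn_def sum_distrib_left power_mult_distrib)
  moreover have "t\<^sup>2 > 1" using e(1) by (simp add: t_def one_less_power)
  ultimately show False using y1 by simp
qed

lemma partial_graph:
  assumes y: "y \<in> U" and j: "j \<in> I"
  shows "f y * partial j f y = - y j"
proof -
  have fI: "finite I" by (simp add: I_def)
  define S where "S = (\<Sum>k\<in>I - {j}. (y k)\<^sup>2)"
  have sq: "sqn I (y(j := t)) = t\<^sup>2 + S" for t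
    unfolding sqn_def S_def using fI j by (subst sum.remove[of _ j]) (auto intro!: sum.cong)
  \<comment> \<open>The coordinate line through \<open>y\<close>, written to fit
    \<open>continuous_map_line\<close>. It stays in \<open>U\<close> near \<open>y j\<close>, so the
    identity for f^2 may be differentiated there.\<close>
  define c where "c = (\<lambda>t::real. \<lambda>k\<in>I. t * (if k = j then 1 else 0) + 1 * (if k = j then 0 else y k))"
  have cont: "continuous_map euclideanreal (euclid I) c"
    unfolding c_def by (rule continuous_map_line) (intro continuous_intros)+
  have yP: "y \<in> Pi\<^sub>E I (\<lambda>_. UNIV)" using y U_sub by blast
  have c: "c t = y(j := t)" for t
    using yP j by (auto simp: c_def fun_eq_iff PiE_def extensional_def)
  have "openin euclideanreal {t \<in> topspace euclideanreal. c t \<in> U}"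
    by (rule openin_continuous_map_preimage[OF cont U])
  then have op: "open {t. y(j := t) \<in> U}" by (simp add: c)
  have "(\<lambda>t. f (y(j := t))) field_differentiable at (y j)" using Ck y j by simp
  then have D: "((\<lambda>t. f (y(j := t))) has_field_derivative partial j f y) (at (y j))"
    unfolding partial_def by (rule field_differentiable_derivI)
  have "((\<lambda>t. (f (y(j := t)))\<^sup>2) has_field_derivative 2 * f y * partial j f y) (at (y j))"
    using D by (auto intro!: derivative_eq_intros)
  then have "((\<lambda>t. 1 - (t\<^sup>2 + S)) has_field_derivative 2 * f y * partial j f y) (at (y j))"
    by (rule has_field_derivative_transform_within_open[OF _ op]) (use y f_sq sq in auto)
  moreover have "((\<lambda>t. 1 - (t\<^sup>2 + S)) has_field_derivative - 2 * y j) (at (y j))"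
    by (auto intro!: derivative_eq_intros)
  ultimately have "2 * f y * partial j f y = - 2 * y j" by (rule DERIV_unique)
  then show ?thesis by simp
qed

text \<open>Because f^2 + |y|^2 = 1, the sum 1 + |y|^2 / f^2 equals 1 / f^2.\<close>

lemma area_density:
  assumes y: "y \<in> U"
  shows "sqrt (1 + (\<Sum>j\<in>I. (partial j f y)\<^sup>2)) = 1 / sqrt (1 - sqn I y)"
proof -
  have p: "1 - sqn I y > 0" using sqn_less_1[OF y] by simp
  have "(1 - sqn I y) * (\<Sum>j\<in>I. (partial j f y)\<^sup>2) = (\<Sum>j\<in>I. (f y * partial j f y)\<^sup>2)"
    unfolding f_sq[OF y, symmetric] by (simp add: sum_distrib_left power_mult_distrib)
  also have "\<dots> = sqn I y" unfolding sqn_def by (intro sum.cong) (auto simp: partial_graph[OF y])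
  finally have "1 + (\<Sum>j\<in>I. (partial j f y)\<^sup>2) = 1 / (1 - sqn I y)" using p by (simp add: divide_simps) (simp add: algebra_simps)
  then show ?thesis by (simp add: real_sqrt_divide)
qed

end

lemma surface_measure_graph:
  assumes \<sigma>: "is_surface_measure n K \<sigma>" and i: "i < n"
    and a: "openin (euclid ({..<n} - {i})) U \<and> Ck_on ({..<n} - {i}) 1 U f \<and> (\<forall>y\<in>U. y(i := f y) \<in> bdry n K) \<and>
        A \<in> sets (leb ({..<n} - {i})) \<and> A \<subseteq> U"
  shows "emeasure \<sigma> ((\<lambda>y. y(i := f y)) ` A) =
    (\<integral>\<^sup>+y\<in>A. ennreal (sqrt (1 + (\<Sum>j\<in>{..<n} - {i}. (partial j f y)\<^sup>2))) \<partial>leb ({..<n} - {i}))"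
proof -
  note h = conjunct2[OF conjunct2[OF \<sigma>[unfolded is_surface_measure_def Let_def]]]
  show ?thesis by (rule h[THEN spec, THEN mp, OF i, THEN spec, THEN spec, THEN spec, THEN mp, OF a])
qed

lemma is_surface_measure_cone_measure:
  assumes n: "n \<ge> 2"
  shows "is_surface_measure n (unit_ball n) (cone_measure n)"
  unfolding is_surface_measure_def Let_def
proof (intro conjI allI impI)
  show "space (cone_measure n) = bdry n (unit_ball n)" by (rule space_cone_measure)
  show "sets (cone_measure n) = sets (restrict_space (leb {..<n}) (bdry n (unit_ball n)))" by (rule sets_cone_measure)
  fix i U f A assume i: "i < n"
  define I where "I = {..<n} - {i}"
  assume a: "openin (euclid ({..<n} - {i})) U \<and> Ck_on ({..<n} - {i}) 1 U f \<and>
        (\<forall>y\<in>U. y(i := f y) \<in> bdry n (unit_ball n)) \<and> A \<in> sets (leb ({..<n} - {i})) \<and> A \<subseteq> U"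
  have U: "openin (euclid I) U" and Ck: "Ck_on I 1 U f" and gr: "\<forall>y\<in>U. y(i := f y) \<in> bdry n (unit_ball n)"
    and A: "A \<in> sets (leb I)" "A \<subseteq> U"
    using a by (auto simp: I_def)
  \<comment> \<open>Continuity of \<open>f\<close> on \<open>U\<close> makes the set where it is
    positive measurable, as the splitting by sign demands.\<close>
  have "openin (subtopology (euclid I) U) {y \<in> topspace (subtopology (euclid I) U). f y \<in> {0<..}}"
    by (rule openin_continuous_map_preimage) (use Ck in auto)
  then have "openin (subtopology (euclid I) U) {y \<in> U. f y \<in> {0<..}}"
    unfolding topspace_subtopology_subset[OF openin_subset[OF U]] .
  then have "openin (euclid I) {y \<in> U. f y \<in> {0<..}}" using U by (simp add: openin_open_subtopology)
  then have "{y \<in> U. f y \<in> {0<..}} \<in> sets (leb I)" by (rule openin_euclid_sets)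
  then have "A \<inter> {y \<in> U. f y \<in> {0<..}} \<in> sets (leb I)" using A by simp
  also have "A \<inter> {y \<in> U. f y \<in> {0<..}} = {y \<in> A. f y > 0}" using A by auto
  finally have Ap: "{y \<in> A. f y > 0} \<in> sets (leb I)" .
  have "emeasure (cone_measure n) ((\<lambda>y. y(i := f y)) ` A) = (\<integral>\<^sup>+y\<in>A. ennreal (1 / sqrt (1 - sqn I y)) \<partial>leb I)"
  proof (rule cone_measure_graph[OF n i, folded I_def])
    show "y \<in> A \<Longrightarrow> sqn I y < 1" "y \<in> A \<Longrightarrow> (f y)\<^sup>2 = 1 - sqn I y" for y
      using sqn_less_1[OF i I_def U Ck gr, of y] f_sq[OF i I_def U Ck gr, of y] A(2) by blast+
  qed (use A Ap in simp_all)
  also have "\<dots> = (\<integral>\<^sup>+y\<in>A. ennreal (sqrt (1 + (\<Sum>j\<in>I. (partial j f y)\<^sup>2))) \<partial>leb I)"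
  proof (rule nn_integral_cong)
    fix y
    show "ennreal (1 / sqrt (1 - sqn I y)) * indicator A y = ennreal (sqrt (1 + (\<Sum>j\<in>I. (partial j f y)\<^sup>2))) * indicator A y"
    proof (cases "y \<in> A")
      case True
      then have "y \<in> U" using A(2) by blast
      then show ?thesis using area_density[OF i I_def U Ck gr, of y] by simp
    qed simp
  qed
  finally show "emeasure (cone_measure n) ((\<lambda>y. y(i := f y)) ` A) =
          (\<integral>\<^sup>+y\<in>A. ennreal (sqrt (1 + (\<Sum>j\<in>{..<n} - {i}. (partial j f y)\<^sup>2))) \<partial>leb ({..<n} - {i}))"
    by (simp add: I_def)
qed

lemma Ck_on_hemisphere:
  assumes I: "finite I" and f: "f = (\<lambda>y. s * sqrt (1 - sqn I y))"
  defines "U \<equiv> {y \<in> Pi\<^sub>E I (\<lambda>_. UNIV). sqn I y < 1}"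
  shows "Ck_on I 1 U f"
proof -
  have cmsqrt: "continuous_map (subtopology (euclid I) U) euclideanreal (\<lambda>y. sqrt (1 - sqn I y))"
  proof -
    have "continuous_map euclideanreal euclideanreal sqrt" by (auto intro!: continuous_intros)
    from continuous_map_compose[OF _ this, of "subtopology (euclid I) U" "\<lambda>y. 1 - sqn I y"]
    show ?thesis
      using I by (simp add: o_def continuous_map_from_subtopology continuous_map_diff continuous_map_sqn)
  qed
  have der: "((\<lambda>t. f (y(j := t))) has_field_derivative - s * y j / sqrt (1 - sqn I y)) (at (y j))"
    if "y \<in> U" "j \<in> I" for y j
  proof -
    define S where "S = (\<Sum>k\<in>I - {j}. (y k)\<^sup>2)"
    have sq: "sqn I (y(j := t)) = t\<^sup>2 + S" for t
      unfolding sqn_def S_def using I that by (subst sum.remove[of _ j]) (auto intro!: sum.cong)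
    have sy: "sqn I y = (y j)\<^sup>2 + S" using sq[of "y j"] by simp
    have "1 - ((y j)\<^sup>2 + S) > 0" using that(1) sy by (simp add: U_def)
    then show ?thesis unfolding f sq sy
      by (auto intro!: derivative_eq_intros simp: field_simps)
  qed
  have par: "partial j f y = - s * y j / sqrt (1 - sqn I y)" if "y \<in> U" "j \<in> I" for y j
    unfolding partial_def by (rule DERIV_imp_deriv[OF der[OF that]])
  have "continuous_map (subtopology (euclid I) U) euclideanreal (partial j f)" if j: "j \<in> I" for j
  proof (rule continuous_map_eq)
    show "continuous_map (subtopology (euclid I) U) euclideanreal (\<lambda>y. - s * y j / sqrt (1 - sqn I y))"
      by (intro continuous_map_real_divide continuous_map_real_mult cmsqrt continuous_map_from_subtopology
          continuous_map_coordinate j) (auto simp: U_def)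
    show "- s * y j / sqrt (1 - sqn I y) = partial j f y" if "y \<in> topspace (subtopology (euclid I) U)" for y
      using that par[OF _ j] by auto
  qed
  moreover have "continuous_map (subtopology (euclid I) U) euclideanreal f"
    unfolding f by (intro continuous_map_real_mult cmsqrt) auto
  moreover have "(\<lambda>t. f (y(j := t))) field_differentiable at (y j)" if "y \<in> U" "j \<in> I" for y j
    using der[OF that] unfolding field_differentiable_def by blast
  ultimately show ?thesis by simp
qed

text \<open>The sphere is the disjoint union of the pieces on which \<open>x i\<close> is the first nonzero coordinate and
  has sign \<open>s\<close>; each piece is a part of a hemisphere, on which the surface measure is prescribed.\<close>

lemma surface_measure_unique:
  assumes M: "is_surface_measure n (unit_ball n) M" and N: "is_surface_measure n (unit_ball n) N"
  shows "M = N"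
proof (rule measure_eqI)
  have sets: "sets M = sets (restrict_space (leb {..<n}) (bdry n (unit_ball n)))"
     "sets N = sets (restrict_space (leb {..<n}) (bdry n (unit_ball n)))"
    using M N by (auto simp: is_surface_measure_def)
  then show "sets M = sets N" by simp
  fix B assume "B \<in> sets M"
  then have B: "B \<in> sets (leb {..<n})" "B \<subseteq> bdry n (unit_ball n)"
    using sets bdry_sets[of n] by (auto simp: sets_restrict_space_iff)
  have Bs: "C \<in> sets M" "C \<in> sets N" if "C \<in> sets (leb {..<n})" "C \<subseteq> B" for C
    using that B sets bdry_sets[of n] by (auto simp: sets_restrict_space_iff)
  define E where "E = (\<lambda>(i, s::real). {x \<in> B. s * x i > 0 \<and> (\<forall>j<i. x j = 0)})"
  define K where "K = {..<n} \<times> {1, -1::real}"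
  have Em: "E p \<in> sets (leb {..<n})" if pK: "p \<in> K" for p
  proof -
    obtain i s where p: "p = (i, s)" "i < n" using pK by (cases p) (auto simp: K_def)
    have "E p = B \<inter> ({x \<in> space (leb {..<n}). s * x i > 0} \<inter> {x \<in> space (leb {..<n}). \<forall>j\<in>{..<i}. x j = 0})"
      using sets.sets_into_space[OF B(1)] by (auto simp: E_def p)
    also have "\<dots> \<in> sets (leb {..<n})"
    proof (intro sets.Int B(1) sets.sets_Collect_finite_All)
      have [measurable]: "(\<lambda>x. x i) \<in> borel_measurable (leb {..<n})" using p by (intro coordinate_measurable) simp
      show "{x \<in> space (leb {..<n}). 0 < s * x i} \<in> sets (leb {..<n})" by measurable
      fix j assume "j \<in> {..<i}"
      then have [measurable]: "(\<lambda>x. x j) \<in> borel_measurable (leb {..<n})" using p by (intro coordinate_measurable) simp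
      show "{x \<in> space (leb {..<n}). x j = 0} \<in> sets (leb {..<n})" by measurable
    qed simp
    finally show ?thesis .
  qed
  have Esub: "E p \<subseteq> B" for p by (auto simp: E_def split: prod.splits)
  have union: "B = (\<Union>p\<in>K. E p)"
  proof
    show "B \<subseteq> (\<Union>p\<in>K. E p)"
    proof
      fix x assume x: "x \<in> B"
      then have x1: "dotp n x x = 1" using B(2) unfolding bdry_unit_ball by blast
      have ex: "\<exists>i. i < n \<and> x i \<noteq> 0"
      proof (rule ccontr)
        assume "\<not> ?thesis"
        then have "dotp n x x = 0" by (simp add: dotp_def)
        with x1 show False by simp
      qed
      define i where "i = (LEAST i. i < n \<and> x i \<noteq> 0)"
      have i: "i < n" "x i \<noteq> 0" using LeastI_ex[OF ex] by (auto simp: i_def)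
      have "x j = 0" if "j < i" for j
        using not_less_Least[OF that[unfolded i_def]] that i(1) by auto
      then have "x \<in> E (i, sgn (x i))" using x i(2) by (simp add: E_def sgn_mult_self_eq mult_sgn_abs sgn_if)
      moreover have "(i, sgn (x i)) \<in> K" using i by (auto simp: K_def sgn_if)
      ultimately show "x \<in> (\<Union>p\<in>K. E p)" by blast
    qed
  qed (use Esub in blast)
  have disj: "disjoint_family_on E K"
    unfolding disjoint_family_on_def
  proof (intro ballI impI, rule ccontr)
    fix p q assume pq: "p \<in> K" "q \<in> K" "p \<noteq> q" "E p \<inter> E q \<noteq> {}"
    obtain i s i' s' where p: "p = (i, s)" "q = (i', s')" by (cases p, cases q)
    obtain x where "x \<in> E p" "x \<in> E q" using pq by blast
    then have x: "s * x i > 0" "\<forall>j<i. x j = 0" "s' * x i' > 0" "\<forall>j<i'. x j = 0" by (auto simp: E_def p)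
    then have "i = i'" by (metis linorder_neqE_nat mult_zero_right less_irrefl)
    moreover have "s = 1 \<or> s = -1" "s' = 1 \<or> s' = -1" using pq by (auto simp: K_def p)
    ultimately show False using x(1,3) pq(3) by (auto simp: p)
  qed
  have finK: "finite K" by (simp add: K_def)
  have MN: "emeasure M (E p) = emeasure N (E p)" if pK: "p \<in> K" for p
  proof -
    obtain i s where p: "p = (i, s)" "i < n" and s: "s\<^sup>2 = 1" using pK by (cases p) (auto simp: K_def)
    define I where "I = {..<n} - {i}"
    define f where "f = (\<lambda>y. s * sqrt (1 - sqn I y))"
    define U where "U = {y \<in> Pi\<^sub>E I (\<lambda>_. UNIV). sqn I y < 1}"
    have I: "finite I" by (simp add: I_def)
    have U: "openin (euclid I) U" unfolding U_def by (rule open_unit_ball_openin[OF I])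
    have Ck: "Ck_on I 1 U f" unfolding U_def by (rule Ck_on_hemisphere[OF I f_def])
    have fsq: "(f y)\<^sup>2 = 1 - sqn I y" if "y \<in> U" for y
      using that s by (simp add: f_def U_def power_mult_distrib)
    have gr: "\<forall>y\<in>U. y(i := f y) \<in> bdry n (unit_ball n)"
      using fsq graph_in_bdry_iff[OF p(2)] by (auto simp: U_def I_def)
    define A where "A = {y \<in> U. y(i := f y) \<in> E p}"
    have Us: "U \<in> sets (leb I)" by (rule openin_euclid_sets[OF U])
    have "(\<lambda>y. y(i := f y)) \<in> leb I \<rightarrow>\<^sub>M leb {..<n}"
    proof (rule measurable_fun_upd[where J=I])
      show "f \<in> leb I \<rightarrow>\<^sub>M lborel" unfolding f_def by simp
    qed (use p in \<open>auto simp: I_def\<close>)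
    from measurable_sets[OF this Em[OF pK]]
    have "(\<lambda>y. y(i := f y)) -` E p \<inter> space (leb I) \<inter> U \<in> sets (leb I)" using Us by simp
    also have "(\<lambda>y. y(i := f y)) -` E p \<inter> space (leb I) \<inter> U = A" by (auto simp: A_def U_def space_leb)
    finally have A: "A \<in> sets (leb I)" .
    have "E p = (\<lambda>y. y(i := f y)) ` A"
    proof
      show "E p \<subseteq> (\<lambda>y. y(i := f y)) ` A"
      proof
        fix x assume x: "x \<in> E p"
        then have xb: "x \<in> bdry n (unit_ball n)" using Esub B(2) by blast
        then have xp: "x \<in> points n" unfolding bdry_unit_ball by simp
        define y where "y = restrict x I"
        have xy: "y(i := x i) = x" using xp p(2) by (auto simp: y_def I_def fun_eq_iff PiE_def extensional_def)
        have yI: "y \<in> Pi\<^sub>E I (\<lambda>_. UNIV)" by (simp add: y_def)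
        have x2: "(x i)\<^sup>2 = 1 - sqn I y"
          using xb graph_in_bdry_iff[OF p(2), of y "x i"] yI xy by (simp add: I_def)
        have sx: "s * x i > 0" using x by (simp add: E_def p)
        then have "x i \<noteq> 0" by auto
        then have yU: "y \<in> U" using x2 yI by (simp add: U_def) (metis diff_gt_0_iff_gt zero_less_power2)
        have "sqrt (1 - sqn I y) = s * x i"
          by (rule real_sqrt_unique) (use x2 sx s in \<open>auto simp: power_mult_distrib\<close>)
        then have "f y = s\<^sup>2 * x i" by (simp add: f_def power2_eq_square mult.assoc)
        then have "y(i := f y) = x" using s xy by simp
        then show "x \<in> (\<lambda>y. y(i := f y)) ` A" using yU x by (auto simp: A_def intro!: image_eqI[of _ _ y])
      qed
    qed (auto simp: A_def)
    moreover have "emeasure M ((\<lambda>y. y(i := f y)) ` A) = emeasure N ((\<lambda>y. y(i := f y)) ` A)"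
    proof -
      have "A \<subseteq> U" by (auto simp: A_def)
      with U Ck gr A have a: "openin (euclid I) U \<and> Ck_on I 1 U f \<and> (\<forall>y\<in>U. y(i := f y) \<in> bdry n (unit_ball n)) \<and>
          A \<in> sets (leb I) \<and> A \<subseteq> U" by (intro conjI)
      show ?thesis
        unfolding surface_measure_graph[OF M p(2) a[unfolded I_def]] surface_measure_graph[OF N p(2) a[unfolded I_def]] ..
    qed
    ultimately show ?thesis by simp
  qed
  have "emeasure M B = (\<Sum>p\<in>K. emeasure M (E p))"
    unfolding union using disj finK Bs Em Esub union by (intro sum_emeasure[symmetric]) auto
  also have "\<dots> = (\<Sum>p\<in>K. emeasure N (E p))" by (intro sum.cong MN) auto
  also have "\<dots> = emeasure N B"
    unfolding union using disj finK Bs Em Esub union by (intro sum_emeasure) auto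
  finally show "emeasure M B = emeasure N B" .
qed

text \<open>Curvature 1 reduces the integral to the total mass of \<open>cone_measure\<close>, that
  is \<open>n\<close> times the volume of the ball, as the missing origin is a null set.\<close>

lemma affine_surface_area_unit_ball:
  assumes n: "n \<ge> 2"
  shows "affine_surface_area n (unit_ball n) = n * unit_ball_vol n"
proof -
  have S: "surface_measure n (unit_ball n) = cone_measure n"
    unfolding surface_measure_def
    by (rule the_equality) (use is_surface_measure_cone_measure[OF n] surface_measure_unique in auto)
  have "{y \<in> punctured_ball n. direction n y \<in> bdry n (unit_ball n)} = punctured_ball n"
    using measurable_space[OF direction_measurable[of n]]
    by (auto simp: space_restrict_space punctured_ball_def unit_ball_def space_leb bdry_unit_ball)
  then have "emeasure (cone_measure n) (bdry n (unit_ball n)) = of_nat n * emeasure (leb {..<n}) (punctured_ball n)"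
    using emeasure_cone_measure[OF bdry_sets subset_refl] by simp
  also have "emeasure (leb {..<n}) (punctured_ball n) = emeasure (leb {..<n}) (unit_ball n)"
  proof -
    define Z where "Z = {x \<in> space (leb {..<n}). sqn {..<n} x \<le> 0\<^sup>2}"
    have "emeasure (leb {..<n}) Z = ennreal (unit_ball_vol n * 0 ^ n)"
      unfolding Z_def by (subst emeasure_ball_leb) simp_all
    then have "Z \<in> null_sets (leb {..<n})" using n by (auto simp: Z_def null_sets_def zero_power)
    moreover have "punctured_ball n = unit_ball n - Z"
      by (rule set_eqI) (simp add: punctured_ball_eq unit_ball_eq Z_def, linarith)
    ultimately show ?thesis by (simp add: emeasure_Diff_null_set)
  qed
  also have "\<dots> = ennreal (unit_ball_vol n)" by (rule emeasure_unit_ball)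
  finally have "measure (cone_measure n) (space (cone_measure n)) = n * unit_ball_vol n"
    by (simp add: measure_def space_cone_measure enn2real_mult)
  moreover have "affine_surface_area n (unit_ball n) = (\<integral>x. 1 \<partial>cone_measure n)"
    unfolding affine_surface_area_def S
    by (rule Bochner_Integration.integral_cong[OF refl]) (use n gauss_curvature_unit_ball in \<open>simp add: space_cone_measure\<close>)
  ultimately show ?thesis by simp
qed

section \<open>The tiling numbers\<close>

text \<open>The defining property at the unit ball, with (n + 1) / (n - 1) rewritten as 1 +
  2/d.\<close>

lemma is_div_number_limit:
  assumes d: "d \<ge> 1" and \<delta>: "is_div_number d \<delta>"
  defines "n \<equiv> Suc d"
  shows "(\<lambda>N. real N powr (2 / d) * min_volume_diff n (unit_ball n) N)
    \<longlonglongrightarrow> \<delta> * ((n * unit_ball_vol n) powr (1 + 2 / d) / 2)"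
proof -
  have n: "n \<ge> 2" using d by (simp add: n_def)
  have "\<forall>x\<in>bdry n (unit_ball n). gauss_curvature n (unit_ball n) x > 0"
    using gauss_curvature_unit_ball n by simp
  with \<delta> convex_body_unit_ball[of n] C2_boundary_unit_ball[of n]
  have "(\<lambda>N. real N powr (2 / (real n - 1)) * min_volume_diff n (unit_ball n) N)
          \<longlonglongrightarrow> 1 / 2 * \<delta> * affine_surface_area n (unit_ball n) powr ((real n + 1) / (real n - 1))"
    unfolding is_div_number_def Let_def n_def by simp
  moreover have "real n - 1 = d" "(real n + 1) / d = 1 + 2 / d"
    using d by (simp_all add: n_def field_simps)
  ultimately show ?thesis
    unfolding affine_surface_area_unit_ball[OF n] by (simp add: mult_ac)
qed

text \<open>The same sequence has both limits, and the factor beside \<delta> is not zero.\<close>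

lemma div_number_unique:
  assumes d: "d \<ge> 1" and "is_div_number d \<delta>" "is_div_number d \<delta>'"
  shows "\<delta> = \<delta>'"
proof -
  have "\<delta> * ((Suc d * unit_ball_vol (Suc d)) powr (1 + 2 / d) / 2)
    = \<delta>' * ((Suc d * unit_ball_vol (Suc d)) powr (1 + 2 / d) / 2)"
    by (rule LIMSEQ_unique[OF is_div_number_limit is_div_number_limit]) fact+
  then show ?thesis by (simp add: less_imp_neq[OF unit_ball_vol_pos, symmetric])
qed

text \<open>The two limit bounds share the positive factor \<open>S\<close>. The interval is made
  symmetric by d / (d + 2) = 1 - 2 / (d + 2) >= 1 - 2/d.\<close>

lemma div_number_bounds:
  assumes d: "d \<ge> 2" and \<delta>: "is_div_number d \<delta>"
  shows "\<bar>\<delta> - unit_ball_vol d powr (- 2 / d)\<bar> \<le> unit_ball_vol d powr (- 2 / d) * (2 / d)"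
proof -
  define X where "X = unit_ball_vol d powr (- 2 / d)"
  define S where "S = (Suc d * unit_ball_vol (Suc d)) powr (1 + 2 / d) / 2"
  have d1: "d \<ge> 1" using d by simp
  have S: "S > 0" by (simp add: S_def less_imp_neq[OF unit_ball_vol_pos, symmetric])
  have X: "X > 0" by (simp add: X_def less_imp_neq[OF unit_ball_vol_pos, symmetric])
  note lim = is_div_number_limit[OF d1 \<delta>]
  have "S * (X * (d / (d + 2))) \<le> S * \<delta>"
    using min_volume_limit_ge[OF d1 lim] by (simp add: S_def X_def mult_ac)
  then have lo: "X * (d / (d + 2)) \<le> \<delta>" by (rule mult_left_le_imp_le[OF _ S])
  have "S * \<delta> \<le> S * (X * (1 + 2 / d))"
    using min_volume_limit_le[OF d lim] by (simp add: S_def X_def mult_ac)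
  then have hi: "\<delta> \<le> X * (1 + 2 / d)" by (rule mult_left_le_imp_le[OF _ S])
  have "1 - 2 / d \<le> d / (d + 2)" using d by (simp add: field_simps)
  then have "X * (1 - 2 / d) \<le> X * (d / (d + 2))" using X by (intro mult_left_mono) auto
  with lo hi show ?thesis unfolding X_def[symmetric] by (simp add: algebra_simps abs_le_iff)
qed

theorem theorem1p4:
  shows "\<exists>C::real. C > 0 \<and>
    (\<forall>n::nat. n \<ge> 2 \<longrightarrow> (\<forall>\<delta>::real. is_div_number (n - 1) \<delta> \<longrightarrow>
       \<bar>\<delta> - (real n + ln (real n)) / (2 * pi * exp 1)\<bar> \<le> C))"
proof -
  define q where "q = 2 * pi * exp (1 :: real)"
  have q: "q \<ge> 1"
  proof -
    have "1 * 1 \<le> (2 * pi) * exp (1 :: real)" using pi_gt3 by (intro mult_mono) auto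
    then show ?thesis by (simp add: q_def)
  qed
  obtain C where C: "\<And>d::nat. d \<ge> (1::nat) \<Longrightarrow> \<bar>unit_ball_vol d powr (- 2 / d) - (d + ln d) / q\<bar> \<le> C"
    using unit_ball_vol_powr_asymp unfolding q_def by blast
  have C0: "C \<ge> 0" using C[of 1] by linarith
  \<comment> \<open>The upper bound uses Bernoulli's inequality with exponent \<open>d / 2 \<ge> 1\<close>; in the plane, uniqueness
    of the constant is enough.\<close>
  obtain C2 where C2: "\<And>\<delta>. is_div_number 1 \<delta> \<Longrightarrow> \<bar>\<delta> - (2 + ln 2) / q\<bar> \<le> C2"
  proof (cases "\<exists>\<delta>. is_div_number 1 \<delta>")
    case True
    then obtain \<delta>0 where "is_div_number 1 \<delta>0" by blast
    then show ?thesis using div_number_unique[of 1] that[of "\<bar>\<delta>0 - (2 + ln 2) / q\<bar>"] by force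
  qed (use that in blast)
  \<comment> \<open>\<open>\<bar>C2\<bar>\<close> serves n = 2. For larger n the budget is 4 + 2 C
    for the distance from \<delta> to \<open>X\<close>, \<open>C\<close> from \<open>X\<close> to
    \<open>Y\<close>, and 2 for passing from \<open>d\<close> to \<open>n\<close>.\<close>
  have "\<bar>\<delta> - (real n + ln (real n)) / q\<bar> \<le> \<bar>C2\<bar> + 3 * C + 6"
    if n: "n \<ge> 2" and \<delta>: "is_div_number (n - 1) \<delta>" for n :: nat and \<delta>
  proof (cases "n = 2")
    case True
    then show ?thesis using C2[of \<delta>] \<delta> C0 by simp
  next
    case False
    define d where "d = n - 1"
    have d: "d \<ge> 2" "real n = d + 1" using n False by (auto simp: d_def)
    define X where "X = unit_ball_vol d powr (- 2 / d)"
    define Y where "Y = (d + ln d) / q"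
    have ld: "0 \<le> ln d" "ln d \<le> d" using d ln_le_minus_one[of d] by auto
    have Y: "0 \<le> Y" "Y \<le> 2 * d"
    proof -
      show "0 \<le> Y" using ld q by (simp add: Y_def)
      have "Y \<le> (d + ln d) / 1" unfolding Y_def using ld q by (intro divide_left_mono) auto
      then show "Y \<le> 2 * d" using ld by simp
    qed
    have XY: "\<bar>X - Y\<bar> \<le> C" using C[of d] d by (simp add: X_def Y_def)
    \<comment> \<open>Here the relative error 2/d turns into an absolute constant, because
      \<open>X\<close> is at most 2 d + C.\<close>
    then have "X * (2 / d) \<le> (2 * d + C) * (2 / d)" using Y by (intro mult_right_mono) auto
    also have "\<dots> = 4 + 2 * C / d" using d by (simp add: field_simps)
    also have "2 * C / d \<le> 2 * C" using d C0 by (simp add: divide_le_eq mult_le_cancel_left1)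
    finally have "\<bar>\<delta> - X\<bar> \<le> 4 + 2 * C"
      using div_number_bounds[OF d(1), of \<delta>] \<delta> by (simp add: X_def d_def)
    moreover have "\<bar>(real n + ln (real n)) / q - Y\<bar> \<le> 2"
    proof -
      have "1 + 1 / d = real n / d" using d by (simp add: field_simps)
      then have "ln (real n) - ln d = ln (1 + 1 / d)" using d by (simp add: ln_divide_pos)
      also have "\<dots> \<le> 1 / d" by (rule ln_add_one_self_le_self) simp
      also have "\<dots> \<le> 1" using d by simp
      finally have "ln (real n) - ln d \<le> 1" .
      moreover have "ln d \<le> ln (real n)" using d by simp
      ultimately have "\<bar>(real n + ln (real n)) - (d + ln d)\<bar> \<le> 2" using d(2) by linarith
      then have "\<bar>(real n + ln (real n)) - (d + ln d)\<bar> / q \<le> 2 / 1" using q by (intro frac_le) auto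
      moreover have "(real n + ln (real n)) / q - Y = ((real n + ln (real n)) - (d + ln d)) / q"
        by (simp add: Y_def diff_divide_distrib)
      ultimately show ?thesis using q by (simp add: abs_divide)
    qed
    ultimately show ?thesis using XY by linarith
  qed
  moreover have "\<bar>C2\<bar> + 3 * C + 6 > 0" using C0 by linarith
  ultimately show ?thesis unfolding q_def by blast
qed

end
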